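(* Assume that for every $\check\delta>0$ $$\lim_{n\to\infty}\frac{\varsigma(n)}{n^{\check\delta}}=0\quad\text{and}\quad\lim_{n\to\infty}\frac{\nu(n)}{n^{\check\delta}}=0 .$$ Then for any $p\in\mathcal{P}$ there is a sequence $\check{\mathbf B}_n(p)$ with $\lim_{n\to\infty}\check{\mathbf B}_n(p)/n^{\check\delta}=0$ for every $\check\delta>0$, such that for any $S\in\Theta_{\epsilon,L}$, any $n\ge3$ and any $0<\delta\le1/12$, the sequential model selection procedure $\widehat S_*$ (with penalty coefficient $\delta$) for the autoregressive model described in the context satisfies $$\mathcal{R}_p(\widehat S_*,S)\le\frac{(1+4\delta)(1+\delta)^2}{1-6\delta}\min_{\lambda\in\Lambda}\mathcal{R}_p(\widehat S_\lambda,S)+\frac{\check{\mathbf B}_n(p)}{\delta n}.$$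
   Context: **Model.** $a<b$, $0<\epsilon<1$, $L>0$ and $y_0\in\mathbb{R}$ are fixed. For $1\le k\le n$, $y_k=S(x_k)y_{k-1}+\xi_k$, $x_k=a+\frac{k(b-a)}{n}$, with $(\xi_k)$ i.i.d. with density $p$. $\mathbf{P}_{p,S},\mathbf{E}_{p,S}$ are the corresponding probability and expectation. $\mathcal{P}$ is the set of densities $p$ on $\mathbb{R}$ with $\int xp=0$, $\int x^2p=1$, $\sup_{k\ge1}\frac{\int|x|^{2k}p(x)dx}{\varsigma^k(2k-1)!!}\le1$, where $\varsigma=\varsigma(n)\ge1$ may depend on $n$; "$p\in\mathcal{P}$" means that $p$ belongs to this class for every $n\ge 3$. $\Theta_{\epsilon,L}=\{S\in C^1([a,b],\mathbb{R}):\sup|S|\le1-\epsilon,\ \sup|\dot S|\le L\}$. Risk: $\mathcal{R}_p(\widehat S,S)=\mathbf{E}_{p,S}\int_a^b(\widehat S(x)-S(x))^2dx$. $[\cdot]$ is the integer part. **Sequential procedures.** Let $d=[\sqrt n]$, $z_l=a+\frac ld(b-a)$ ($1\le l\le d$), $h=\frac{b-a}{2d}$, $\tilde z_l=\frac{z_l-a}{b-a}$, $\tilde h=\frac{h}{b-a}$, $Q_{l,j}=\mathbf{1}_{\{|x_j-z_l|\le h\}}$, $k_{1,l}=[n\tilde z_l-n\tilde h]+1$, $k_{2,l}=[n\tilde z_l+n\tilde h]\wedge n$, $\mathbf q=[(n\tilde h)^{\mu_0}]$ for a fixed $0<\mu_0<1$, $\iota_l=k_{1,l}+\mathbf q$.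 Put $A_{k,m}=\sum_{j=k+1}^mQ_{l,j}y_{j-1}^2$ (with $l$ understood), $\tilde\epsilon=\frac1{2+\ln n}$, $$\widehat S_{\iota_l}=\frac{\sum_{j=1}^{\iota_l}Q_{l,j}y_{j-1}y_j}{A_{0,\iota_l}},\quad\widetilde S_{\iota_l}=\min(\max(\widehat S_{\iota_l},-1+\tilde\epsilon),1-\tilde\epsilon),\quad\tilde\gamma_l=1-\widetilde S_{\iota_l}^2,\quad H_l=\frac{1-\tilde\epsilon}{\tilde\gamma_l}(k_{2,l}-\iota_l-1),$$ where the threshold $H_l$ is understood to be positive. Let $\tau_l=\inf\{\iota_l+1\le k\le k_{2,l}:A_{\iota_l,k}\ge H_l\}$ ($\inf\emptyset=k_{2,l}$), $\Gamma_l=\{A_{\iota_l,k_{2,l}-1}\ge H_l\}$, and on $\Gamma_l$ let $0<\varkappa_l\le1$ be defined by $A_{\iota_l,\tau_l-1}+\varkappa_l^2Q_{l,\tau_l}y_{\tau_l-1}^2=H_l$. Set $$S_l^*=\frac1{H_l}\Big(\sum_{j=\iota_l+1}^{\tau_l-1}Q_{l,j}y_{j-1}y_j+\varkappa_lQ_{l,\tau_l}y_{\tau_l-1}y_{\tau_l}\Big)\mathbf{1}_{\Gamma_l},\quad\Gamma=\bigcap_{l=1}^d\Gamma_l,\quad Y_l=S_l^*\mathbf{1}_\Gamma,\quad\sigma_l=H_l^{-1/2}.$$ **Model selection.** $(\phi_j)_{1\le j\le d}$ is a system of functions on $[a,b]$ with $\frac{b-a}d\sum_{l=1}^d\phi_i(z_l)\phi_j(z_l)=\mathbf{1}_{\{i=j\}}$.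 $\Lambda=\Lambda_n\subset[0,1]^d$ is a finite set of weight vectors with cardinality $\nu=\nu(n)$. Let $\widehat\theta_{j,d}=\frac{b-a}d\sum_{l=1}^dY_l\phi_j(z_l)$; for $\lambda\in\Lambda$, $\widehat S_\lambda(z_l)=\sum_{j=1}^d\lambda(j)\widehat\theta_{j,d}\phi_j(z_l)\mathbf{1}_\Gamma$, extended to $[a,b]$ by $\widehat S_\lambda(t)=\widehat S_\lambda(z_1)$ for $a\le t\le z_1$ and $\widehat S_\lambda(t)=\widehat S_\lambda(z_l)$ for $z_{l-1}<t\le z_l$, $l\ge2$. Let $\mathbf s_{j,d}=\frac{b-a}d\sum_{l=1}^d\sigma_l^2\phi_j^2(z_l)$, $\widetilde\theta_{j,d}=\widehat\theta_{j,d}^2-\frac{b-a}d\mathbf s_{j,d}$, $P_d(\lambda)=\frac{b-a}d\sum_{j=1}^d\lambda^2(j)\mathbf s_{j,d}$, $$J_d(\lambda)=\sum_{j=1}^d\lambda^2(j)\widehat\theta_{j,d}^2-2\sum_{j=1}^d\lambda(j)\widetilde\theta_{j,d}+\delta P_d(\lambda),$$ $\widehat\lambda\in\operatorname{argmin}_{\lambda\in\Lambda}J_d(\lambda)$ and $\widehat S_*=\widehat S_{\widehat\lambda}$. *)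

theory Defs
  imports "HOL-Probability.Probability"
begin

section \<open>The autoregressive model\<close>

definition grid :: "real \<Rightarrow> real \<Rightarrow> nat \<Rightarrow> nat \<Rightarrow> real" where
  "grid a b n k = a + real k * (b - a) / real n"

primrec ar_seq :: "real \<Rightarrow> real \<Rightarrow> real \<Rightarrow> nat \<Rightarrow> (real \<Rightarrow> real) \<Rightarrow> (nat \<Rightarrow> real) \<Rightarrow> nat \<Rightarrow> real" where
  "ar_seq a b y0 n S xi 0 = y0"
| "ar_seq a b y0 n S xi (Suc k) = S (grid a b n (Suc k)) * ar_seq a b y0 n S xi k + xi (Suc k)"

definition observation :: "real \<Rightarrow> real \<Rightarrow> real \<Rightarrow> nat \<Rightarrow> (real \<Rightarrow> real) \<Rightarrow> (nat \<Rightarrow> real) \<Rightarrow> (nat \<Rightarrow> real)" where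
  "observation a b y0 n S xi = (\<lambda>k\<in>{0..n}. ar_seq a b y0 n S xi k)"

definition noise_law :: "nat \<Rightarrow> (real \<Rightarrow> real) \<Rightarrow> (nat \<Rightarrow> real) measure" where
  "noise_law n p = (\<Pi>\<^sub>M k\<in>{1..n}. density lborel (\<lambda>x. ennreal (p x)))"

definition observation_space :: "nat \<Rightarrow> (nat \<Rightarrow> real) measure" where
  "observation_space n = (\<Pi>\<^sub>M k\<in>{0..n}. borel)"

text \<open>
  An estimator maps the observations \<open>(y\<^sub>0, \<dots>, y\<^sub>n)\<close> to a function on \<open>[a,b]\<close>. The risk is taken
  in \<open>[0,\<infinity>]\<close>, so that it is not set to zero when an integral diverges.
\<close>

definition risk ::
  "real \<Rightarrow> real \<Rightarrow> real \<Rightarrow> nat \<Rightarrow> (real \<Rightarrow> real) \<Rightarrow> ((nat \<Rightarrow> real) \<Rightarrow> real \<Rightarrow> real) \<Rightarrow> (real \<Rightarrow> real) \<Rightarrow> ennreal" where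
  "risk a b y0 n p Shat S =
     (\<integral>\<^sup>+xi. (\<integral>\<^sup>+x\<in>{a..b}. ennreal ((Shat (observation a b y0 n S xi) x - S x)\<^sup>2) \<partial>lborel)
        \<partial>noise_law n p)"

text \<open>
  The double factorial \<open>(2k-1)!!\<close> is written as the product of the first \<open>k\<close> odd numbers. The
  supremum is taken in \<open>[0,\<infinity>]\<close>, so the bound includes finiteness of all moments.
\<close>

definition noise_densities :: "real \<Rightarrow> (real \<Rightarrow> real) set" where
  "noise_densities s = {p. p \<in> borel_measurable borel \<and> (\<forall>x. 0 \<le> p x)
     \<and> (\<integral>\<^sup>+x. ennreal (p x) \<partial>lborel) = 1
     \<and> has_bochner_integral lborel (\<lambda>x. x * p x) 0
     \<and> has_bochner_integral lborel (\<lambda>x. x\<^sup>2 * p x) 1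
     \<and> (SUP k\<in>{1::nat..}. (\<integral>\<^sup>+x. ennreal (\<bar>x\<bar> ^ (2 * k) * p x) \<partial>lborel)
            / ennreal (s ^ k * (\<Prod>i=1..k. 2 * real i - 1))) \<le> 1}"

definition smooth_class :: "real \<Rightarrow> real \<Rightarrow> real \<Rightarrow> real \<Rightarrow> (real \<Rightarrow> real) set" where
  "smooth_class a b eps L = {S. \<exists>S'. continuous_on {a..b} S'
     \<and> (\<forall>x\<in>{a..b}. (S has_real_derivative S' x) (at x within {a..b})
          \<and> \<bar>S x\<bar> \<le> 1 - eps \<and> \<bar>S' x\<bar> \<le> L)}"

definition subpolynomial :: "(nat \<Rightarrow> real) \<Rightarrow> bool" where
  "subpolynomial f \<longleftrightarrow> (\<forall>c>0. (\<lambda>n. f n / real n powr c) \<longlonglongrightarrow> 0)"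


section \<open>The sequential procedure\<close>

text \<open>
  The locale only abbreviates the parameter lists. In it, \<open>l\<close> ranges over \<open>{1..d}\<close> and \<open>y\<close> is the
  vector of observations.
\<close>

locale ar_procedure =
  fixes a b \<mu>0 :: real and n :: nat and \<phi> :: "nat \<Rightarrow> real \<Rightarrow> real"
begin

definition d :: nat where "d = nat \<lfloor>sqrt (real n)\<rfloor>"

definition z :: "nat \<Rightarrow> real" where "z l = a + real l / real d * (b - a)"

definition h :: real where "h = (b - a) / (2 * real d)"

definition z_tilde :: "nat \<Rightarrow> real" where "z_tilde l = (z l - a) / (b - a)"

definition h_tilde :: real where "h_tilde = h / (b - a)"

definition Q :: "nat \<Rightarrow> nat \<Rightarrow> real" where
  "Q l j = (if \<bar>grid a b n j - z l\<bar> \<le> h then 1 else 0)"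

definition k1 :: "nat \<Rightarrow> nat" where
  "k1 l = nat \<lfloor>real n * z_tilde l - real n * h_tilde\<rfloor> + 1"

definition k2 :: "nat \<Rightarrow> nat" where
  "k2 l = min (nat \<lfloor>real n * z_tilde l + real n * h_tilde\<rfloor>) n"

definition q :: nat where "q = nat \<lfloor>(real n * h_tilde) powr \<mu>0\<rfloor>"

definition \<iota> :: "nat \<Rightarrow> nat" where "\<iota> l = k1 l + q"

definition A :: "nat \<Rightarrow> (nat \<Rightarrow> real) \<Rightarrow> nat \<Rightarrow> nat \<Rightarrow> real" where
  "A l y k m = (\<Sum>j=k+1..m. Q l j * (y (j - 1))\<^sup>2)"

definition eps_tilde :: real where "eps_tilde = 1 / (2 + ln (real n))"

definition S_pilot :: "nat \<Rightarrow> (nat \<Rightarrow> real) \<Rightarrow> real" where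
  "S_pilot l y = (\<Sum>j=1..\<iota> l. Q l j * y (j - 1) * y j) / A l y 0 (\<iota> l)"

definition S_trunc :: "nat \<Rightarrow> (nat \<Rightarrow> real) \<Rightarrow> real" where
  "S_trunc l y = min (max (S_pilot l y) (- 1 + eps_tilde)) (1 - eps_tilde)"

definition \<gamma>_tilde :: "nat \<Rightarrow> (nat \<Rightarrow> real) \<Rightarrow> real" where
  "\<gamma>_tilde l y = 1 - (S_trunc l y)\<^sup>2"

definition H :: "nat \<Rightarrow> (nat \<Rightarrow> real) \<Rightarrow> real" where
  "H l y = (1 - eps_tilde) / \<gamma>_tilde l y * (real (k2 l) - real (\<iota> l) - 1)"

text \<open>
  The procedure is only meaningful for positive thresholds. The sign of \<open>H l y\<close> does not depend on
  \<open>y\<close>: for \<open>n \<ge> 3\<close> and \<open>a < b\<close> it is the sign of \<open>k2 l - \<iota> l - 1\<close>. This is positive for all large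
  \<open>n\<close>, but not for all small ones (not for \<open>n = 3\<close>, say).
\<close>

definition thresholds_positive :: bool where
  "thresholds_positive \<longleftrightarrow> (\<forall>l\<in>{1..d}. \<forall>y. 0 < H l y)"

definition \<tau> :: "nat \<Rightarrow> (nat \<Rightarrow> real) \<Rightarrow> nat" where
  "\<tau> l y = (if \<exists>k\<in>{\<iota> l + 1..k2 l}. A l y (\<iota> l) k \<ge> H l y
            then LEAST k. k \<in> {\<iota> l + 1..k2 l} \<and> A l y (\<iota> l) k \<ge> H l y else k2 l)"

definition Gamma_at :: "nat \<Rightarrow> (nat \<Rightarrow> real) \<Rightarrow> bool" where
  "Gamma_at l y \<longleftrightarrow> A l y (\<iota> l) (k2 l - 1) \<ge> H l y"

text \<open>The correction weight is used only where \<open>Gamma_at l y\<close> holds.\<close>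

definition \<kappa> :: "nat \<Rightarrow> (nat \<Rightarrow> real) \<Rightarrow> real" where
  "\<kappa> l y = (THE c. 0 < c \<and> c \<le> 1 \<and>
     A l y (\<iota> l) (\<tau> l y - 1) + c\<^sup>2 * Q l (\<tau> l y) * (y (\<tau> l y - 1))\<^sup>2 = H l y)"

definition S_seq :: "nat \<Rightarrow> (nat \<Rightarrow> real) \<Rightarrow> real" where
  "S_seq l y = (if Gamma_at l y
     then 1 / H l y * ((\<Sum>j=\<iota> l + 1..\<tau> l y - 1. Q l j * y (j - 1) * y j)
            + \<kappa> l y * Q l (\<tau> l y) * y (\<tau> l y - 1) * y (\<tau> l y))
     else 0)"

definition Gamma :: "(nat \<Rightarrow> real) \<Rightarrow> bool" where
  "Gamma y \<longleftrightarrow> (\<forall>l\<in>{1..d}. Gamma_at l y)"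

definition Y :: "nat \<Rightarrow> (nat \<Rightarrow> real) \<Rightarrow> real" where
  "Y l y = S_seq l y * of_bool (Gamma y)"

definition \<sigma> :: "nat \<Rightarrow> (nat \<Rightarrow> real) \<Rightarrow> real" where
  "\<sigma> l y = H l y powr (- 1 / 2)"


section \<open>Model selection\<close>

definition orthonormal_system :: bool where
  "orthonormal_system \<longleftrightarrow> (\<forall>i\<in>{1..d}. \<forall>j\<in>{1..d}.
     (b - a) / real d * (\<Sum>l=1..d. \<phi> i (z l) * \<phi> j (z l)) = of_bool (i = j))"

definition \<theta>_hat :: "nat \<Rightarrow> (nat \<Rightarrow> real) \<Rightarrow> real" where
  "\<theta>_hat j y = (b - a) / real d * (\<Sum>l=1..d. Y l y * \<phi> j (z l))"

text \<open>
  Elements of \<open>[0,1]^d\<close> are functions that are \<open>undefined\<close> outside \<open>{1..d}\<close>, so distinct weight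
  functions are distinct vectors and \<open>card\<close> counts vectors.
\<close>

definition weight_vectors :: "(nat \<Rightarrow> real) set" where
  "weight_vectors = {1..d} \<rightarrow>\<^sub>E {0..1}"

definition S_knot :: "(nat \<Rightarrow> real) \<Rightarrow> (nat \<Rightarrow> real) \<Rightarrow> nat \<Rightarrow> real" where
  "S_knot w y l = (\<Sum>j=1..d. w j * \<theta>_hat j y * \<phi> j (z l)) * of_bool (Gamma y)"

definition S_weight :: "(nat \<Rightarrow> real) \<Rightarrow> (nat \<Rightarrow> real) \<Rightarrow> real \<Rightarrow> real" where
  "S_weight w y t = S_knot w y 1 * indicator {a..z 1} t
     + (\<Sum>l=2..d. S_knot w y l * indicator {z (l - 1)<..z l} t)"

definition s :: "nat \<Rightarrow> (nat \<Rightarrow> real) \<Rightarrow> real" where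
  "s j y = (b - a) / real d * (\<Sum>l=1..d. (\<sigma> l y)\<^sup>2 * (\<phi> j (z l))\<^sup>2)"

definition \<theta>_tilde :: "nat \<Rightarrow> (nat \<Rightarrow> real) \<Rightarrow> real" where
  "\<theta>_tilde j y = (\<theta>_hat j y)\<^sup>2 - (b - a) / real d * s j y"

definition penalty :: "(nat \<Rightarrow> real) \<Rightarrow> (nat \<Rightarrow> real) \<Rightarrow> real" where
  "penalty y w = (b - a) / real d * (\<Sum>j=1..d. (w j)\<^sup>2 * s j y)"

definition J :: "real \<Rightarrow> (nat \<Rightarrow> real) \<Rightarrow> (nat \<Rightarrow> real) \<Rightarrow> real" where
  "J \<delta> y w = (\<Sum>j=1..d. (w j)\<^sup>2 * (\<theta>_hat j y)\<^sup>2) - 2 * (\<Sum>j=1..d. w j * \<theta>_tilde j y)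
     + \<delta> * penalty y w"

text \<open>
  The minimiser of \<open>J\<close> need not be unique. A selector is any rule that picks one as a
  measurable function of the observations.
\<close>

definition is_selector ::
  "real \<Rightarrow> (nat \<Rightarrow> real) set \<Rightarrow> ((nat \<Rightarrow> real) \<Rightarrow> (nat \<Rightarrow> real)) \<Rightarrow> bool" where
  "is_selector \<delta> \<Lambda> w_hat \<longleftrightarrow>
     w_hat \<in> observation_space n \<rightarrow>\<^sub>M count_space \<Lambda> \<and>
     (\<forall>y\<in>space (observation_space n). is_arg_min (J \<delta> y) (\<lambda>w. w \<in> \<Lambda>) (w_hat y))"

definition S_star :: "((nat \<Rightarrow> real) \<Rightarrow> (nat \<Rightarrow> real)) \<Rightarrow> (nat \<Rightarrow> real) \<Rightarrow> real \<Rightarrow> real" where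
  "S_star w_hat y = S_weight (w_hat y) y"

end

end

theory Submission
  imports Defs
begin

text \<open>
  On the complement of \<open>Gamma\<close> every estimator vanishes, so there all losses coincide and nothing has to be
  proved: no estimate of the probability of \<open>Gamma\<close> is needed. On \<open>Gamma\<close> the sequential estimators satisfy
  \<open>Y l = S (z l) + \<eta> l + \<beta> l\<close>, where the bias \<open>\<beta> l\<close> is of order \<open>1 / sqrt n\<close> times
  one plus the largest squared observation and \<open>\<eta> l = (\<Sum>k. u l k * xi k)\<close> has predictable weights. By the choice of the
  stopping rule and of \<open>\<kappa>\<close> the squares of the weights add up to exactly \<open>1 / H l\<close>; the weights
  extend to all of the sample space with the same property. The oracle inequality
  is then a pathwise inequality whose remainder consists of squared linear and
  centred quadratic forms in \<open>\<eta>\<close>, normalised and summed over \<open>\<Lambda>\<close>. Their expectations are bounded by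
  Lyapunov functions that trade the conditional variance already spent against
  the one still available; each step is a one-dimensional integral of a polynomial
  of degree four.
\<close>

text \<open>The selected weight vector and the thresholds \<open>H l\<close> both depend on the
  data. The first is met by summing over \<open>\<Lambda>\<close>, which costs a factor
  \<open>card \<Lambda>\<close>; the second by deterministic bounds. \<open>1 / H l\<close> is at
  most a multiple of 1 / sqrt n, and at least d / (n (2 + ln n)), because truncating the pilot keeps
  \<open>\<gamma>_tilde\<close> above \<open>eps_tilde\<close>. So the random penalty in a
  denominator can be replaced by a constant at the price of one logarithm. The order 1 / n arises
  because the mesh of the knots and the variance of one sequential estimator are both of order 1 /
  sqrt n.

  The factor \<open>(1 + \<delta>)^2\<close> comes from passing between integrated and knot errors
  twice. The quotient comes from absorbing forms of relative size \<open>\<delta>\<close> into the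
  errors; this works because the error of each weight vector dominates its squared bias plus
  penalty, up to the remainder.

  The upper bound on \<open>1 / H l\<close> requires blocks of length at least a multiple of sqrt n
  for every admissible n. For small n, positivity of the thresholds makes the length at least 1, and
  a smaller constant does the rest.\<close>

section \<open>The pathwise oracle inequality for coefficients\<close>

text \<open>\<open>x * P\<close> is the product of \<open>t * P\<close> and \<open>x / t\<close>,
  hence at most the square of their sum. Every normalised remainder term enters in this form: a
  small multiple of an absorbable quantity plus a multiple of \<open>x\<close>.\<close>

lemma abs_le_weighted_sum:
  fixes u x P t :: real
  assumes "u\<^sup>2 \<le> x * P" "0 \<le> x" "0 \<le> P" "0 < t"
  shows "\<bar>u\<bar> \<le> t * P + x / t"
proof -
  have "u\<^sup>2 \<le> (t * P) * (x / t)" using assms by (simp add: mult.commute)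
  also have "\<dots> \<le> (t * P + x / t)\<^sup>2"
    using assms by (simp add: power2_eq_square algebra_simps)
  finally show ?thesis using assms
    by (intro power2_le_imp_le[of "\<bar>u\<bar>"]) auto
qed

lemma abs_mult_le_weighted:
  fixes u v t :: real
  assumes "0 < t"
  shows "2 * \<bar>u * v\<bar> \<le> t * u\<^sup>2 + v\<^sup>2 / t"
proof -
  have "0 \<le> (t * \<bar>u\<bar> - \<bar>v\<bar>)\<^sup>2 / t" using assms by simp
  also have "\<dots> = t * u\<^sup>2 - 2 * \<bar>u * v\<bar> + v\<^sup>2 / t"
    using assms by (simp add: power2_diff power_mult_distrib abs_mult field_simps power2_eq_square)
  finally show ?thesis by simp
qed

lemma abs_sum_mult_le_weighted:
  fixes f g :: "'a \<Rightarrow> real"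
  assumes "0 < t"
  shows "2 * \<bar>\<Sum>j\<in>I. f j * g j\<bar> \<le> t * (\<Sum>j\<in>I. (f j)\<^sup>2) + (\<Sum>j\<in>I. (g j)\<^sup>2) / t"
proof -
  have "2 * \<bar>\<Sum>j\<in>I. f j * g j\<bar> \<le> (\<Sum>j\<in>I. 2 * \<bar>f j * g j\<bar>)"
    by (simp flip: sum_distrib_left)
  also have "\<dots> \<le> (\<Sum>j\<in>I. t * (f j)\<^sup>2 + (g j)\<^sup>2 / t)"
    by (intro sum_mono abs_mult_le_weighted assms)
  finally show ?thesis
    by (simp add: sum.distrib sum_distrib_left sum_divide_distrib)
qed

text \<open>This makes absorption possible: squared bias and penalty, in which all the stochastic
  terms are measured, are themselves controlled by the error. Write the error of coefficient j as
  \<open>- (1 - w j) * \<theta> j + w j * \<xi> j + w j * \<beta> j\<close>, square it, and replace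
  \<open>(\<xi> j)^2\<close> by \<open>s j\<close> plus a centred term.\<close>

lemma coefficient_error_lower_bound:
  fixes w \<theta> \<xi> \<beta> s :: "nat \<Rightarrow> real" and x :: real
  assumes w: "\<And>j. j \<in> I \<Longrightarrow> 0 \<le> w j \<and> w j \<le> 1"
    and s: "\<And>j. j \<in> I \<Longrightarrow> 0 \<le> s j"
    and x: "0 \<le> x"
    and U: "(\<Sum>j\<in>I. (w j)\<^sup>2 * ((\<xi> j)\<^sup>2 - s j))\<^sup>2 \<le> x * (\<Sum>j\<in>I. (w j)\<^sup>2 * s j)"
    and N: "(\<Sum>j\<in>I. w j * (1 - w j) * \<theta> j * \<xi> j)\<^sup>2 \<le> x * (\<Sum>j\<in>I. ((1 - w j) * \<theta> j)\<^sup>2)"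
    and \<beta>: "(\<Sum>j\<in>I. (\<beta> j)\<^sup>2) \<le> x"
  shows "(\<Sum>j\<in>I. ((1 - w j) * \<theta> j)\<^sup>2) + (\<Sum>j\<in>I. (w j)\<^sup>2 * s j)
      \<le> 4 * (\<Sum>j\<in>I. (w j * (\<theta> j + \<xi> j + \<beta> j) - \<theta> j)\<^sup>2) + 88 * x"
proof -
  define D where "D = (\<Sum>j\<in>I. ((1 - w j) * \<theta> j)\<^sup>2)"
  define P where "P = (\<Sum>j\<in>I. (w j)\<^sup>2 * s j)"
  define e where "e = (\<Sum>j\<in>I. (w j * (\<theta> j + \<xi> j + \<beta> j) - \<theta> j)\<^sup>2)"
  have D0: "0 \<le> D" and P0: "0 \<le> P" by (auto simp: D_def P_def s intro!: sum_nonneg mult_nonneg_nonneg)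
  \<comment> \<open>The parameters 1/2, 1/8 and 1/4 used here, in \<open>N'\<close> and in
    \<open>B'\<close> leave \<open>D / 2 + P / 4\<close> of the main terms; the error adds up to (1
    + 16 + 4 + 1) * x = 22 * x.\<close>
  have U': "\<bar>\<Sum>j\<in>I. (w j)\<^sup>2 * ((\<xi> j)\<^sup>2 - s j)\<bar> \<le> P / 2 + 2 * x"
    using abs_le_weighted_sum[OF U x P0[unfolded P_def], of "1/2"] by (simp add: P_def)
  have N': "\<bar>\<Sum>j\<in>I. w j * (1 - w j) * \<theta> j * \<xi> j\<bar> \<le> D / 8 + 8 * x"
    using abs_le_weighted_sum[OF N x D0[unfolded D_def], of "1/8"] by (simp add: D_def)
  have sq: "(w j * \<beta> j)\<^sup>2 \<le> (\<beta> j)\<^sup>2" if "j \<in> I" for j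
    using w[OF that] by (simp add: power_mult_distrib mult_left_le_one_le power_le_one)
  have wb: "(\<Sum>j\<in>I. (w j * \<beta> j)\<^sup>2) \<le> x"
    using sum_mono[of I "\<lambda>j. (w j * \<beta> j)\<^sup>2" "\<lambda>j. (\<beta> j)\<^sup>2", OF sq] \<beta> by simp
  have B': "2 * \<bar>\<Sum>j\<in>I. ((1 - w j) * \<theta> j) * (w j * \<beta> j)\<bar> \<le> D / 4 + 4 * x"
    using abs_sum_mult_le_weighted[of "1/4" "\<lambda>j. (1 - w j) * \<theta> j" "\<lambda>j. w j * \<beta> j" I] wb
    by (simp add: D_def)
  have "e \<ge> (\<Sum>j\<in>I. ((1 - w j) * \<theta> j)\<^sup>2 - 2 * (w j * (1 - w j) * \<theta> j * \<xi> j)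
      - 2 * (((1 - w j) * \<theta> j) * (w j * \<beta> j))
      + ((w j)\<^sup>2 * ((\<xi> j)\<^sup>2 - s j) / 2 + (w j)\<^sup>2 * s j / 2 - (w j * \<beta> j)\<^sup>2))"
    unfolding e_def
  proof (rule sum_mono)
    fix j
    \<comment> \<open>This amounts to \<open>(\<xi> j + \<beta> j)^2 \<ge> (\<xi> j)^2 / 2 -
      (\<beta> j)^2\<close>: the cross term between noise and bias costs half of the noise
      part.\<close>
    have "0 \<le> (w j)\<^sup>2 * (\<xi> j / sqrt 2 + sqrt 2 * \<beta> j)\<^sup>2" by simp
    also have "(\<xi> j / sqrt 2 + sqrt 2 * \<beta> j)\<^sup>2 = (\<xi> j)\<^sup>2 / 2 + 2 * \<xi> j * \<beta> j + 2 * (\<beta> j)\<^sup>2"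
      by (simp add: power2_sum power_divide power_mult_distrib)
    finally show "((1 - w j) * \<theta> j)\<^sup>2 - 2 * (w j * (1 - w j) * \<theta> j * \<xi> j)
      - 2 * (((1 - w j) * \<theta> j) * (w j * \<beta> j))
      + ((w j)\<^sup>2 * ((\<xi> j)\<^sup>2 - s j) / 2 + (w j)\<^sup>2 * s j / 2 - (w j * \<beta> j)\<^sup>2)
      \<le> (w j * (\<theta> j + \<xi> j + \<beta> j) - \<theta> j)\<^sup>2"
      by (simp add: power2_eq_square field_simps)
  qed
  also have "(\<Sum>j\<in>I. ((1 - w j) * \<theta> j)\<^sup>2 - 2 * (w j * (1 - w j) * \<theta> j * \<xi> j)
      - 2 * (((1 - w j) * \<theta> j) * (w j * \<beta> j))
      + ((w j)\<^sup>2 * ((\<xi> j)\<^sup>2 - s j) / 2 + (w j)\<^sup>2 * s j / 2 - (w j * \<beta> j)\<^sup>2))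
    = D - 2 * (\<Sum>j\<in>I. w j * (1 - w j) * \<theta> j * \<xi> j)
      - 2 * (\<Sum>j\<in>I. ((1 - w j) * \<theta> j) * (w j * \<beta> j))
      + ((\<Sum>j\<in>I. (w j)\<^sup>2 * ((\<xi> j)\<^sup>2 - s j)) / 2 + P / 2 - (\<Sum>j\<in>I. (w j * \<beta> j)\<^sup>2))"
    by (simp add: D_def P_def sum.distrib sum_subtractf sum_distrib_left sum_divide_distrib)
  finally have "e \<ge> D / 2 + P / 4 - 22 * x"
    using U' N' B' wb by linarith
  then show ?thesis unfolding D_def[symmetric] P_def[symmetric] e_def[symmetric]
    using D0 by simp
qed

text \<open>Up to a constant, the error differs from the unpenalised criterion only by terms that
  are linear or centred quadratic in the noise, or involve \<open>\<beta>\<close>. After comparing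
  the criteria at \<open>w\<close> and \<open>w0\<close>, these are bounded by a small multiple of
  squared bias plus penalty, which the preceding lemma turns back into errors.\<close>

lemma oracle_inequality_coefficients:
  fixes I :: "nat set" and w w0 \<theta> \<xi> \<beta> s :: "nat \<Rightarrow> real" and x \<delta> :: real
  defines "P \<equiv> \<lambda>w. \<Sum>j\<in>I. (w j)\<^sup>2 * s j"
    and "e \<equiv> \<lambda>w. \<Sum>j\<in>I. (w j * (\<theta> j + \<xi> j + \<beta> j) - \<theta> j)\<^sup>2"
  assumes w: "\<And>v j. v \<in> {w, w0} \<Longrightarrow> j \<in> I \<Longrightarrow> 0 \<le> v j \<and> v j \<le> 1"
    and s: "\<And>j. j \<in> I \<Longrightarrow> 0 \<le> s j"
    and x: "0 \<le> x"
    and \<delta>: "0 < \<delta>" "\<delta> \<le> 1 / 12"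
    and U1: "\<And>v. v \<in> {w, w0} \<Longrightarrow> (\<Sum>j\<in>I. v j * ((\<xi> j)\<^sup>2 - s j))\<^sup>2 \<le> x * P v"
    and U2: "\<And>v. v \<in> {w, w0} \<Longrightarrow> (\<Sum>j\<in>I. (v j)\<^sup>2 * ((\<xi> j)\<^sup>2 - s j))\<^sup>2 \<le> x * P v"
    and N1: "(\<Sum>j\<in>I. (w j - w0 j) * \<theta> j * \<xi> j)\<^sup>2 \<le> x * (\<Sum>j\<in>I. ((w j - w0 j) * \<theta> j)\<^sup>2)"
    and N2: "\<And>v. v \<in> {w, w0} \<Longrightarrow>
      (\<Sum>j\<in>I. v j * (1 - v j) * \<theta> j * \<xi> j)\<^sup>2 \<le> x * (\<Sum>j\<in>I. ((1 - v j) * \<theta> j)\<^sup>2)"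
    and \<beta>: "(\<Sum>j\<in>I. (\<beta> j)\<^sup>2) \<le> x"
    and J: "(\<Sum>j\<in>I. (w j)\<^sup>2 * (\<theta> j + \<xi> j + \<beta> j)\<^sup>2)
        - 2 * (\<Sum>j\<in>I. w j * ((\<theta> j + \<xi> j + \<beta> j)\<^sup>2 - s j)) + \<delta> * P w
      \<le> (\<Sum>j\<in>I. (w0 j)\<^sup>2 * (\<theta> j + \<xi> j + \<beta> j)\<^sup>2)
        - 2 * (\<Sum>j\<in>I. w0 j * ((\<theta> j + \<xi> j + \<beta> j)\<^sup>2 - s j)) + \<delta> * P w0"
  shows "e w \<le> (1 + 4 * \<delta>) / (1 - 6 * \<delta>) * e w0 + 300 * x / \<delta>"
proof -
  define D where "D v = (\<Sum>j\<in>I. ((1 - v j) * \<theta> j)\<^sup>2)" for v :: "nat \<Rightarrow> real"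
  define U where "U v = (\<Sum>j\<in>I. v j * ((\<xi> j)\<^sup>2 - s j))" for v :: "nat \<Rightarrow> real"
  \<comment> \<open>The bound \<open>6 * t * (4 * e v + 88 * x)\<close> then contributes exactly
    \<open>\<delta> * e v\<close> for each of \<open>w\<close> and \<open>w0\<close>. The penalty of
    \<open>w0\<close> adds \<open>4 * \<delta> * e w0\<close>, whence the coefficients
    \<open>\<delta>\<close> and \<open>1 + 5 * \<delta>\<close> further down.\<close>
  define t where "t = \<delta> / 24"
  have t: "0 < t" using \<delta> by (simp add: t_def)
  have D0: "0 \<le> D v" and P0: "0 \<le> P v" and e0: "0 \<le> e v" for v
    by (auto simp: D_def P_def e_def s intro!: sum_nonneg mult_nonneg_nonneg)
  have DP: "D v + P v \<le> 4 * e v + 88 * x" if v: "v \<in> {w, w0}" for v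
    using coefficient_error_lower_bound[OF w[OF v] s x U2[OF v, unfolded P_def] N2[OF v] \<beta>]
    by (simp add: D_def P_def e_def)
  \<comment> \<open>The criterion replaces the unknown product of \<open>\<theta> j\<close> and its
    estimate by the squared estimate minus \<open>s j\<close>. The sums with \<open>\<xi>\<close>,
    \<open>\<beta>\<close> and \<open>U\<close> are the error of that substitution; the last sum is
    independent of \<open>v\<close> and cancels in the comparison.\<close>
  have e_J: "e v = (\<Sum>j\<in>I. (v j)\<^sup>2 * (\<theta> j + \<xi> j + \<beta> j)\<^sup>2)
        - 2 * (\<Sum>j\<in>I. v j * ((\<theta> j + \<xi> j + \<beta> j)\<^sup>2 - s j)) 
        + 2 * (\<Sum>j\<in>I. v j * \<theta> j * \<xi> j) + 2 * (\<Sum>j\<in>I. v j * \<theta> j * \<beta> j)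
        + 2 * U v + 4 * (\<Sum>j\<in>I. v j * \<xi> j * \<beta> j) + 2 * (\<Sum>j\<in>I. v j * (\<beta> j)\<^sup>2)
        + (\<Sum>j\<in>I. (\<theta> j)\<^sup>2)" for v
    unfolding e_def U_def sum_distrib_left sum.distrib[symmetric] sum_subtractf[symmetric]
    by (intro sum.cong refl) (simp add: power2_eq_square algebra_simps)
  have cross: "4 * \<bar>\<Sum>j\<in>I. v j * \<xi> j * \<beta> j\<bar> \<le> 2 * t * (2 * P v + x) + 2 * x / t"
    if v: "v \<in> {w, w0}" for v
  proof -
    have "(\<Sum>j\<in>I. (v j * \<xi> j)\<^sup>2) = P v + (\<Sum>j\<in>I. (v j)\<^sup>2 * ((\<xi> j)\<^sup>2 - s j))"
      by (simp add: P_def algebra_simps power_mult_distrib sum_subtractf)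
    also have "\<dots> \<le> 2 * P v + x"
      using abs_le_weighted_sum[OF U2[OF v] x P0, of 1] by simp
    finally have 1: "t * (\<Sum>j\<in>I. (v j * \<xi> j)\<^sup>2) \<le> t * (2 * P v + x)" using t by simp
    have "(\<Sum>j\<in>I. (\<beta> j)\<^sup>2) / t \<le> x / t" using \<beta> t by (simp add: divide_right_mono)
    with 1 abs_sum_mult_le_weighted[OF t, of "\<lambda>j. v j * \<xi> j" "\<beta>" I] show ?thesis
      by (simp add: mult.assoc)
  qed
  \<comment> \<open>\<open>(w j - w0 j) * \<theta> j\<close> is the difference of the biases
    \<open>(1 - w0 j) * \<theta> j\<close> and \<open>(1 - w j) * \<theta> j\<close>, so linear
    forms in \<open>w - w0\<close> are controlled by the two bias sums.\<close>
  have G: "(\<Sum>j\<in>I. ((w j - w0 j) * \<theta> j)\<^sup>2) \<le> 2 * D w + 2 * D w0"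
    unfolding D_def sum_distrib_left sum.distrib[symmetric]
  proof (rule sum_mono)
    fix j
    have "0 \<le> ((1 - w j) * \<theta> j + (1 - w0 j) * \<theta> j)\<^sup>2" by simp
    then show "((w j - w0 j) * \<theta> j)\<^sup>2 \<le> 2 * ((1 - w j) * \<theta> j)\<^sup>2 + 2 * ((1 - w0 j) * \<theta> j)\<^sup>2"
      by (simp add: power2_eq_square algebra_simps)
  qed
  have tG: "3 * t * (\<Sum>j\<in>I. ((w j - w0 j) * \<theta> j)\<^sup>2) \<le> 6 * t * (D w + D w0)"
    using mult_left_mono[OF G, of "3 * t"] t by (simp add: algebra_simps)
  have lin: "2 * \<bar>\<Sum>j\<in>I. (w j - w0 j) * \<theta> j * \<xi> j\<bar> + 2 * \<bar>\<Sum>j\<in>I. (w j - w0 j) * \<theta> j * \<beta> j\<bar>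
      \<le> 6 * t * (D w + D w0) + 3 * x / t"
  proof -
    have a: "\<bar>\<Sum>j\<in>I. (w j - w0 j) * \<theta> j * \<xi> j\<bar> \<le> t * (\<Sum>j\<in>I. ((w j - w0 j) * \<theta> j)\<^sup>2) + x / t"
      by (rule abs_le_weighted_sum[OF N1 x _ t]) (simp add: sum_nonneg)
    have "(\<Sum>j\<in>I. (\<beta> j)\<^sup>2) / t \<le> x / t" using \<beta> t by (simp add: divide_right_mono)
    with a tG abs_sum_mult_le_weighted[OF t, of "\<lambda>j. (w j - w0 j) * \<theta> j" "\<beta>" I] show ?thesis
      by simp
  qed
  have UU: "\<bar>U v\<bar> \<le> t * P v + x / t" if v: "v \<in> {w, w0}" for v
    using abs_le_weighted_sum[OF U1[OF v] x P0 t] by (simp add: U_def)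
  have bb: "2 * (\<Sum>j\<in>I. w j * (\<beta> j)\<^sup>2) - 2 * (\<Sum>j\<in>I. w0 j * (\<beta> j)\<^sup>2) \<le> 2 * x"
  proof -
    have "(\<Sum>j\<in>I. w j * (\<beta> j)\<^sup>2) \<le> (\<Sum>j\<in>I. (\<beta> j)\<^sup>2)"
      using w by (intro sum_mono mult_left_le_one_le) auto
    moreover have "0 \<le> (\<Sum>j\<in>I. w0 j * (\<beta> j)\<^sup>2)" using w by (intro sum_nonneg) auto
    ultimately show ?thesis using \<beta> by simp
  qed
  have d1: "(\<Sum>j\<in>I. (w j - w0 j) * \<theta> j * \<xi> j) = (\<Sum>j\<in>I. w j * \<theta> j * \<xi> j) - (\<Sum>j\<in>I. w0 j * \<theta> j * \<xi> j)"
    and d2: "(\<Sum>j\<in>I. (w j - w0 j) * \<theta> j * \<beta> j) = (\<Sum>j\<in>I. w j * \<theta> j * \<beta> j) - (\<Sum>j\<in>I. w0 j * \<theta> j * \<beta> j)"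
    by (simp_all add: algebra_simps sum_subtractf)
  have "e w \<le> e w0 + (6 * t * (D w + D w0) + 3 * x / t)
      + 2 * (t * P w + x / t) + 2 * (t * P w0 + x / t)
      + (2 * t * (2 * P w + x) + 2 * x / t) + (2 * t * (2 * P w0 + x) + 2 * x / t)
      + 2 * x + \<delta> * P w0 - \<delta> * P w"
    using J lin[unfolded d1 d2] UU[of w] UU[of w0] cross[of w] cross[of w0] bb
    unfolding e_J[of w] e_J[of w0] by simp argo
  also have "\<dots> = e w0 + 6 * t * (D w + P w) + 6 * t * (D w0 + P w0)
      + \<delta> * P w0 - \<delta> * P w + 11 * (x / t) + (2 + 4 * t) * x"
    by (simp add: algebra_simps)
  also have "\<dots> \<le> e w0 + 6 * t * (4 * e w + 88 * x) + 6 * t * (4 * e w0 + 88 * x)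
      + \<delta> * (4 * e w0 + 88 * x) - 0 + 11 * (x / t) + (2 + 4 * t) * x"
  proof -
    have "6 * t * (D w + P w) \<le> 6 * t * (4 * e w + 88 * x)"
      "6 * t * (D w0 + P w0) \<le> 6 * t * (4 * e w0 + 88 * x)"
      using DP t by (auto intro!: mult_left_mono)
    moreover have "\<delta> * P w0 \<le> \<delta> * (4 * e w0 + 88 * x)"
      using DP[of w0] D0[of w0] \<delta> by (intro mult_left_mono) auto
    moreover have "0 \<le> \<delta> * P w" using \<delta> P0 by simp
    ultimately show ?thesis by linarith
  qed
  also have "\<dots> = e w0 * (1 + 5 * \<delta>) + \<delta> * e w + x * (2 + (132 + 1/6) * \<delta> + 264 / \<delta>)"
    using \<delta> by (simp add: t_def field_simps)
  also have "2 + (132 + 1/6) * \<delta> + 264 / \<delta> \<le> 270 / \<delta>"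
  proof -
    have "2 * \<delta> + (132 + 1/6) * (\<delta> * \<delta>) \<le> 2 * (1/12) + (132 + 1/6) * ((1/12) * (1/12))"
      using \<delta> by (intro add_mono mult_left_mono mult_mono) auto
    then have "(2 * \<delta> + (132 + 1/6) * (\<delta> * \<delta>) + 264) / \<delta> \<le> 270 / \<delta>"
      using \<delta> by (intro divide_right_mono) auto
    then show ?thesis using \<delta> by (simp add: add_divide_distrib)
  qed
  finally have "e w \<le> e w0 * (1 + 5 * \<delta>) + \<delta> * e w + x * (270 / \<delta>)"
    using x by (simp only: mult_left_mono add_left_mono)
  then have main: "(1 - \<delta>) * e w \<le> (1 + 5 * \<delta>) * e w0 + 270 * x / \<delta>"
    by (simp add: algebra_simps)
  \<comment> \<open>After multiplication by \<open>1 - 6 * \<delta>\<close>, which is at least 1/2,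
    the two sides differ by 4 * \<open>\<delta>\<close> + 26 * \<open>\<delta>\<close>^2.\<close>
  have r1: "(1 + 5 * \<delta>) \<le> (1 - \<delta>) * ((1 + 4 * \<delta>) / (1 - 6 * \<delta>))"
    using \<delta> by (simp add: field_simps)
  have r2: "270 * x / \<delta> \<le> (1 - \<delta>) * (300 * x / \<delta>)"
  proof -
    have "(11/12) * (300 * x / \<delta>) \<le> (1 - \<delta>) * (300 * x / \<delta>)"
      using \<delta> x by (intro mult_right_mono) auto
    moreover have "270 * x / \<delta> \<le> (11/12) * (300 * x / \<delta>)" using \<delta> x by (simp add: field_simps)
    ultimately show ?thesis by linarith
  qed
  have "(1 - \<delta>) * e w \<le> (1 - \<delta>) * ((1 + 4 * \<delta>) / (1 - 6 * \<delta>)) * e w0 + (1 - \<delta>) * (300 * x / \<delta>)"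
    using main mult_right_mono[OF r1 e0[of w0]] r2 by linarith
  also have "\<dots> = (1 - \<delta>) * ((1 + 4 * \<delta>) / (1 - 6 * \<delta>) * e w0 + 300 * x / \<delta>)"
    by (simp add: algebra_simps)
  finally show ?thesis using \<delta> by (simp add: mult_le_cancel_left_pos)
qed

text \<open>The second identity isolates a residual that does not depend on \<open>\<alpha>\<close>,
  so comparing two combinations with the same target reduces to comparing coefficients. Bessel's
  inequality is the case where \<open>\<alpha>\<close> consists of the coefficients of
  \<open>f\<close>.\<close>

lemma
  fixes e :: "nat \<Rightarrow> nat \<Rightarrow> real" and c :: real
  assumes fin: "finite I"
    and orth: "\<And>i j. i \<in> I \<Longrightarrow> j \<in> I \<Longrightarrow> c * (\<Sum>l\<in>K. e i l * e j l) = of_bool (i = j)"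
  shows orthonormal_norm_combination:
      "c * (\<Sum>l\<in>K. (\<Sum>j\<in>I. \<alpha> j * e j l)\<^sup>2) = (\<Sum>j\<in>I. (\<alpha> j)\<^sup>2)"
    and orthonormal_pythagoras:
      "c * (\<Sum>l\<in>K. ((\<Sum>j\<in>I. \<alpha> j * e j l) - f l)\<^sup>2) = (\<Sum>j\<in>I. (\<alpha> j - c * (\<Sum>l\<in>K. f l * e j l))\<^sup>2)
        + (c * (\<Sum>l\<in>K. (f l)\<^sup>2) - (\<Sum>j\<in>I. (c * (\<Sum>l\<in>K. f l * e j l))\<^sup>2))"
    and orthonormal_bessel:
      "0 \<le> c \<Longrightarrow> (\<Sum>j\<in>I. (c * (\<Sum>l\<in>K. f l * e j l))\<^sup>2) \<le> c * (\<Sum>l\<in>K. (f l)\<^sup>2)"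
proof -
  have norm: "c * (\<Sum>l\<in>K. (\<Sum>j\<in>I. \<alpha> j * e j l)\<^sup>2) = (\<Sum>j\<in>I. (\<alpha> j)\<^sup>2)" for \<alpha>
  proof -
    have "(\<Sum>l\<in>K. (\<Sum>j\<in>I. \<alpha> j * e j l)\<^sup>2) = (\<Sum>l\<in>K. \<Sum>i\<in>I. \<Sum>j\<in>I. \<alpha> i * \<alpha> j * (e i l * e j l))"
      by (simp add: power2_eq_square sum_product algebra_simps)
    also have "\<dots> = (\<Sum>i\<in>I. \<Sum>l\<in>K. \<Sum>j\<in>I. \<alpha> i * \<alpha> j * (e i l * e j l))" by (rule sum.swap)
    also have "\<dots> = (\<Sum>i\<in>I. \<Sum>j\<in>I. \<alpha> i * \<alpha> j * (\<Sum>l\<in>K. e i l * e j l))"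
      by (subst sum.swap) (simp add: sum_distrib_left)
    finally have "c * (\<Sum>l\<in>K. (\<Sum>j\<in>I. \<alpha> j * e j l)\<^sup>2)
        = (\<Sum>i\<in>I. \<Sum>j\<in>I. \<alpha> i * \<alpha> j * (c * (\<Sum>l\<in>K. e i l * e j l)))"
      by (simp add: sum_distrib_left mult.left_commute)
    also have "\<dots> = (\<Sum>i\<in>I. \<Sum>j\<in>I. if i = j then \<alpha> i * \<alpha> j else 0)"
      by (intro sum.cong refl) (simp add: orth)
    finally show ?thesis using fin by (simp add: power2_eq_square)
  qed
  have pyth: "c * (\<Sum>l\<in>K. ((\<Sum>j\<in>I. \<alpha> j * e j l) - f l)\<^sup>2) = (\<Sum>j\<in>I. (\<alpha> j - c * (\<Sum>l\<in>K. f l * e j l))\<^sup>2)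
        + (c * (\<Sum>l\<in>K. (f l)\<^sup>2) - (\<Sum>j\<in>I. (c * (\<Sum>l\<in>K. f l * e j l))\<^sup>2))" for \<alpha>
  proof -
    have "(\<Sum>l\<in>K. (\<Sum>j\<in>I. \<alpha> j * e j l) * f l) = (\<Sum>j\<in>I. \<alpha> j * (\<Sum>l\<in>K. f l * e j l))"
      unfolding sum_distrib_right sum_distrib_left by (subst sum.swap) (simp add: algebra_simps)
    then have "c * (\<Sum>l\<in>K. ((\<Sum>j\<in>I. \<alpha> j * e j l) - f l)\<^sup>2)
        = c * (\<Sum>l\<in>K. (\<Sum>j\<in>I. \<alpha> j * e j l)\<^sup>2) - 2 * (\<Sum>j\<in>I. \<alpha> j * (c * (\<Sum>l\<in>K. f l * e j l)))
          + c * (\<Sum>l\<in>K. (f l)\<^sup>2)"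
      by (simp add: power2_diff sum.distrib sum_subtractf mult.assoc right_diff_distrib
          distrib_left mult.left_commute[of _ c] flip: sum_distrib_left)
    moreover have "(\<Sum>j\<in>I. (\<alpha> j - c * (\<Sum>l\<in>K. f l * e j l))\<^sup>2) = (\<Sum>j\<in>I. (\<alpha> j)\<^sup>2)
        - 2 * (\<Sum>j\<in>I. \<alpha> j * (c * (\<Sum>l\<in>K. f l * e j l))) + (\<Sum>j\<in>I. (c * (\<Sum>l\<in>K. f l * e j l))\<^sup>2)"
      by (simp add: power2_diff sum.distrib sum_subtractf sum_distrib_left mult.assoc)
    ultimately show ?thesis unfolding norm by simp
  qed
  show "c * (\<Sum>l\<in>K. (\<Sum>j\<in>I. \<alpha> j * e j l)\<^sup>2) = (\<Sum>j\<in>I. (\<alpha> j)\<^sup>2)" by (fact norm)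
  show "c * (\<Sum>l\<in>K. ((\<Sum>j\<in>I. \<alpha> j * e j l) - f l)\<^sup>2) = (\<Sum>j\<in>I. (\<alpha> j - c * (\<Sum>l\<in>K. f l * e j l))\<^sup>2)
        + (c * (\<Sum>l\<in>K. (f l)\<^sup>2) - (\<Sum>j\<in>I. (c * (\<Sum>l\<in>K. f l * e j l))\<^sup>2))" by (fact pyth)
  show "(\<Sum>j\<in>I. (c * (\<Sum>l\<in>K. f l * e j l))\<^sup>2) \<le> c * (\<Sum>l\<in>K. (f l)\<^sup>2)" if "0 \<le> c"
  proof -
    have "0 \<le> c * (\<Sum>l\<in>K. ((\<Sum>j\<in>I. (c * (\<Sum>l\<in>K. f l * e j l)) * e j l) - f l)\<^sup>2)"
      using that by (simp add: sum_nonneg)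
    then show ?thesis unfolding pyth by simp
  qed
qed

section \<open>Quadratic forms in martingales with predictable weights\<close>

declare One_nat_def [simp del]

lemma sum_mult_update:
  fixes x y :: "'a \<Rightarrow> real"
  assumes "finite K" "L \<in> K"
  shows "(\<Sum>m\<in>K. y m * (x m + (if m = L then s else 0))) = (\<Sum>m\<in>K. y m * x m) + y L * s"
proof -
  have "(\<Sum>m\<in>K. y m * (x m + (if m = L then s else 0)))
      = (\<Sum>m\<in>K. y m * x m + (if m = L then y L * s else 0))"
    by (intro sum.cong refl) (auto simp: algebra_simps)
  then show ?thesis using assms by (simp add: sum.distrib)
qed

locale standardized_noise = prob_space M for M :: "real measure" +
  fixes m4 :: real
  assumes sets_M [measurable_cong, simp]: "sets M = sets borel"
    and noise_mean: "has_bochner_integral M (\<lambda>t. t) 0"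
    and noise_variance: "has_bochner_integral M (\<lambda>t. t\<^sup>2) 1"
    and noise_fourth_moment: "has_bochner_integral M (\<lambda>t. t ^ 4) m4"
begin

sublocale product: product_sigma_finite "\<lambda>_::nat. M"
  by unfold_locales

lemma space_M [simp]: "space M = UNIV"
  using sets_eq_imp_space_eq[OF sets_M] by simp

lemma m4_nonneg: "0 \<le> m4"
  using has_bochner_integral_integral_eq[OF noise_fourth_moment]
    Bochner_Integration.integral_nonneg[of M "\<lambda>t. t ^ 4"] by simp

text \<open>There is no cubic term because nothing is prescribed about the third moment. Steps that
  would produce one have to remove it by completing a square.\<close>

lemma nn_integral_polynomial:
  assumes "\<And>t. 0 \<le> c0 + c1 * t + c2 * t\<^sup>2 + c4 * t ^ 4"
  shows "(\<integral>\<^sup>+t. ennreal (c0 + c1 * t + c2 * t\<^sup>2 + c4 * t ^ 4) \<partial>M) = ennreal (c0 + c2 + c4 * m4)"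
proof -
  have "has_bochner_integral M (\<lambda>t. c0) c0"
    using prob_space by (simp add: has_bochner_integral_iff)
  then have "has_bochner_integral M (\<lambda>t. c0 + c1 * t + c2 * t\<^sup>2 + c4 * t ^ 4) (c0 + c1 * 0 + c2 * 1 + c4 * m4)"
    by (intro has_bochner_integral_add has_bochner_integral_mult_right
        noise_mean noise_variance noise_fourth_moment)
  then have "has_bochner_integral M (\<lambda>t. c0 + c1 * t + c2 * t\<^sup>2 + c4 * t ^ 4) (c0 + c2 + c4 * m4)"
    by simp
  then show ?thesis
    using nn_integral_eq_integral[of M "\<lambda>t. c0 + c1 * t + c2 * t\<^sup>2 + c4 * t ^ 4"] assms
    by (simp add: has_bochner_integral_iff)
qed

text \<open>A conditional expectation given all other coordinates, in the form of Fubini's theorem.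
  As \<open>G\<close> ignores coordinate \<open>k\<close> and \<open>M\<close> has mass one, that
  coordinate can be put back after it has been integrated out.\<close>

lemma nn_integral_PiM_step:
  fixes F G :: "(nat \<Rightarrow> real) \<Rightarrow> ennreal"
  assumes I: "finite I" "k \<in> I"
    and [measurable]: "F \<in> borel_measurable (\<Pi>\<^sub>M i\<in>I. M)" "G \<in> borel_measurable (\<Pi>\<^sub>M i\<in>I. M)"
    and G: "\<And>x t. G (x(k := t)) = G x"
    and FG: "\<And>x. (\<integral>\<^sup>+t. F (x(k := t)) \<partial>M) \<le> G x"
  shows "(\<integral>\<^sup>+x. F x \<partial>(\<Pi>\<^sub>M i\<in>I. M)) \<le> (\<integral>\<^sup>+x. G x \<partial>(\<Pi>\<^sub>M i\<in>I. M))"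
proof -
  have ins: "I = insert k (I - {k})" using I by auto
  have [measurable]: "F \<in> borel_measurable (\<Pi>\<^sub>M i\<in>insert k (I - {k}). M)"
    "G \<in> borel_measurable (\<Pi>\<^sub>M i\<in>insert k (I - {k}). M)"
    unfolding ins[symmetric] by measurable
  have "(\<integral>\<^sup>+x. F x \<partial>(\<Pi>\<^sub>M i\<in>insert k (I - {k}). M))
      = (\<integral>\<^sup>+x. (\<integral>\<^sup>+t. F (x(k := t)) \<partial>M) \<partial>(\<Pi>\<^sub>M i\<in>I - {k}. M))"
    using I by (intro product.product_nn_integral_insert) measurable
  also have "\<dots> \<le> (\<integral>\<^sup>+x. G x \<partial>(\<Pi>\<^sub>M i\<in>I - {k}. M))"
    by (intro nn_integral_mono FG)
  also have "\<dots> = (\<integral>\<^sup>+x. (\<integral>\<^sup>+t. G (x(k := t)) \<partial>M) \<partial>(\<Pi>\<^sub>M i\<in>I - {k}. M))"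
    using emeasure_space_1 by (simp add: G)
  also have "\<dots> = (\<integral>\<^sup>+x. G x \<partial>(\<Pi>\<^sub>M i\<in>insert k (I - {k}). M))"
    using I by (intro product.product_nn_integral_insert[symmetric]) measurable
  finally show ?thesis using ins by simp
qed

text \<open>A supermartingale inequality stated pointwise. It suffices that \<open>\<Phi> k\<close>
  ignores coordinate \<open>Suc k\<close>, since each step integrates out that coordinate
  alone.\<close>

lemma nn_integral_PiM_supermartingale:
  fixes \<Phi> :: "nat \<Rightarrow> (nat \<Rightarrow> real) \<Rightarrow> ennreal"
  assumes [measurable]: "\<And>k. k \<le> n \<Longrightarrow> \<Phi> k \<in> borel_measurable (\<Pi>\<^sub>M i\<in>{1..n}. M)"
    and indep: "\<And>k x t. k < n \<Longrightarrow> \<Phi> k (x(Suc k := t)) = \<Phi> k x"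
    and step: "\<And>k x. k < n \<Longrightarrow> (\<integral>\<^sup>+t. \<Phi> (Suc k) (x(Suc k := t)) \<partial>M) \<le> \<Phi> k x"
  shows "(\<integral>\<^sup>+x. \<Phi> n x \<partial>(\<Pi>\<^sub>M i\<in>{1..n}. M)) \<le> (\<integral>\<^sup>+x. \<Phi> 0 x \<partial>(\<Pi>\<^sub>M i\<in>{1..n}. M))"
proof -
  have "(\<integral>\<^sup>+x. \<Phi> k x \<partial>(\<Pi>\<^sub>M i\<in>{1..n}. M)) \<le> (\<integral>\<^sup>+x. \<Phi> 0 x \<partial>(\<Pi>\<^sub>M i\<in>{1..n}. M))" if "k \<le> n" for k
    using that
  proof (induction k)
    case (Suc k)
    have "(\<integral>\<^sup>+x. \<Phi> (Suc k) x \<partial>(\<Pi>\<^sub>M i\<in>{1..n}. M)) \<le> (\<integral>\<^sup>+x. \<Phi> k x \<partial>(\<Pi>\<^sub>M i\<in>{1..n}. M))"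
      using Suc.prems by (intro nn_integral_PiM_step[of "{1..n}" "Suc k"] indep step assms(1)) auto
    with Suc show ?case by simp
  qed simp
  then show ?thesis by simp
qed

end

text \<open>A change of one coordinate contributes a cross term, doubled by symmetry, and a diagonal
  term. It is applied to the kernel \<open>W\<close> with a noise increment, and to the squared
  kernel with a decrement of the variance budget.\<close>

lemma bilinear_form_update:
  fixes G :: "'a \<Rightarrow> 'a \<Rightarrow> real"
  assumes K: "finite K" "L \<in> K" and sym: "\<And>l m. G l m = G m l"
  shows "(\<Sum>l\<in>K. (x l + (if l = L then s else 0)) * (\<Sum>m\<in>K. G l m * (x m + (if m = L then s else 0))))
    = (\<Sum>l\<in>K. x l * (\<Sum>m\<in>K. G l m * x m)) + 2 * s * (\<Sum>m\<in>K. G L m * x m) + s\<^sup>2 * G L L"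
proof -
  define B where "B l = (\<Sum>m\<in>K. G l m * x m) + G l L * s" for l
  have "(\<Sum>l\<in>K. (x l + (if l = L then s else 0)) * (\<Sum>m\<in>K. G l m * (x m + (if m = L then s else 0))))
      = (\<Sum>l\<in>K. (x l + (if l = L then s else 0)) * B l)"
    unfolding sum_mult_update[OF K] B_def ..
  also have "\<dots> = (\<Sum>l\<in>K. x l * B l) + s * B L"
    using sum_mult_update[OF K, of B x s] by (simp only: mult.commute[of "B _"])
  also have "(\<Sum>l\<in>K. x l * B l) = (\<Sum>l\<in>K. x l * (\<Sum>m\<in>K. G l m * x m)) + s * (\<Sum>l\<in>K. G L l * x l)"
    by (simp add: B_def distrib_left sum.distrib sum_distrib_left sym[of _ L] mult_ac)
  finally show ?thesis by (simp add: B_def power2_eq_square algebra_simps)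
qed

text \<open>A vector martingale indexed by \<open>K\<close> in which noise variable \<open>k\<close>
  drives only the coordinate \<open>owner k\<close>. Predictability is insensitivity to changes at
  positions \<open>j \<ge> k\<close>, which replaces a filtration. \<open>V\<close> is a constant
  because in the application the total variance of a coordinate is itself random.\<close>

locale predictable_weights = standardized_noise +
  fixes n :: nat and K :: "'l set" and owner :: "nat \<Rightarrow> 'l"
    and u :: "'l \<Rightarrow> nat \<Rightarrow> (nat \<Rightarrow> real) \<Rightarrow> real" and V :: real
  assumes finite_K: "finite K"
    and owner: "\<And>k. k \<in> {1..n} \<Longrightarrow> owner k \<in> K"
    and disjoint: "\<And>l k x. l \<in> K \<Longrightarrow> k \<in> {1..n} \<Longrightarrow> l \<noteq> owner k \<Longrightarrow> u l k x = 0"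
    and predictable: "\<And>l k j x t. l \<in> K \<Longrightarrow> k \<in> {1..n} \<Longrightarrow> k \<le> j \<Longrightarrow> u l k (x(j := t)) = u l k x"
    and u_measurable: "\<And>l k. l \<in> K \<Longrightarrow> k \<in> {1..n} \<Longrightarrow> u l k \<in> borel_measurable (\<Pi>\<^sub>M i\<in>{1..n}. M)"
    and variance_le: "\<And>l x. l \<in> K \<Longrightarrow> (\<Sum>k=1..n. (u l k x)\<^sup>2) \<le> V"
begin

definition mart :: "'l \<Rightarrow> nat \<Rightarrow> (nat \<Rightarrow> real) \<Rightarrow> real" where
  "mart l k x = (\<Sum>i=1..k. u l i x * x i)"

text \<open>Measured from the constant \<open>V\<close> and not from the actual total, so that it is
  known one step ahead of the noise.\<close>

definition rest :: "'l \<Rightarrow> nat \<Rightarrow> (nat \<Rightarrow> real) \<Rightarrow> real" where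
  "rest l k x = V - (\<Sum>i=1..k. (u l i x)\<^sup>2)"

lemma rest_nonneg: "l \<in> K \<Longrightarrow> k \<le> n \<Longrightarrow> 0 \<le> rest l k x"
  using variance_le[of l x] sum_mono2[of "{1..n}" "{1..k}" "\<lambda>i. (u l i x)\<^sup>2"]
  by (simp add: rest_def)

lemma mart_measurable [measurable]:
  "l \<in> K \<Longrightarrow> k \<le> n \<Longrightarrow> mart l k \<in> borel_measurable (\<Pi>\<^sub>M i\<in>{1..n}. M)"
proof -
  assume *: "l \<in> K" "k \<le> n"
  have [measurable]: "(\<lambda>x. x i) \<in> borel_measurable (\<Pi>\<^sub>M i\<in>{1..n}. M)" if "i \<in> {1..k}" for i
    using measurable_component_singleton[of i "{1..n}" "\<lambda>_. M"] that * by simp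
  show ?thesis
    unfolding mart_def using * by (intro borel_measurable_sum borel_measurable_times u_measurable) auto
qed

lemma rest_measurable [measurable]:
  "l \<in> K \<Longrightarrow> k \<le> n \<Longrightarrow> rest l k \<in> borel_measurable (\<Pi>\<^sub>M i\<in>{1..n}. M)"
  unfolding rest_def
  by (intro borel_measurable_diff borel_measurable_sum borel_measurable_power u_measurable borel_measurable_const) auto

lemma mart_past: "l \<in> K \<Longrightarrow> k < n \<Longrightarrow> mart l k (x(Suc k := t)) = mart l k x"
  unfolding mart_def by (intro sum.cong refl) (simp add: predictable)

lemma rest_past: "l \<in> K \<Longrightarrow> k < n \<Longrightarrow> rest l k (x(Suc k := t)) = rest l k x"
  unfolding rest_def by (intro arg_cong2[of _ _ _ _ "(-)"] sum.cong refl) (simp add: predictable)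

lemma mart_Suc:
  assumes "l \<in> K" "k < n"
  shows "mart l (Suc k) (x(Suc k := t))
    = mart l k x + (if l = owner (Suc k) then u (owner (Suc k)) (Suc k) x * t else 0)"
proof -
  have "mart l (Suc k) (x(Suc k := t)) = mart l k (x(Suc k := t)) + u l (Suc k) (x(Suc k := t)) * t"
    by (simp add: mart_def)
  then show ?thesis using assms disjoint[of l "Suc k"] by (auto simp: mart_past predictable)
qed

lemma rest_Suc:
  assumes "l \<in> K" "k < n"
  shows "rest l (Suc k) (x(Suc k := t))
    = rest l k x + (if l = owner (Suc k) then - (u (owner (Suc k)) (Suc k) x)\<^sup>2 else 0)"
proof -
  have "rest l (Suc k) (x(Suc k := t)) = rest l k (x(Suc k := t)) - (u l (Suc k) (x(Suc k := t)))\<^sup>2"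
    by (simp add: rest_def)
  then show ?thesis using assms disjoint[of l "Suc k"] by (auto simp: rest_past predictable)
qed

text \<open>In one step the squared sum gains on average exactly what the weighted sum of the
  budgets \<open>rest\<close> loses, because the noise is centred with unit variance.\<close>

lemma nn_integral_linear_mart_le:
  "(\<integral>\<^sup>+x. ennreal ((\<Sum>l\<in>K. c l * mart l n x)\<^sup>2) \<partial>(\<Pi>\<^sub>M i\<in>{1..n}. M)) \<le> ennreal (V * (\<Sum>l\<in>K. (c l)\<^sup>2))"
proof -
  define \<Phi> where "\<Phi> k x = ennreal ((\<Sum>l\<in>K. c l * mart l k x)\<^sup>2 + (\<Sum>l\<in>K. (c l)\<^sup>2 * rest l k x))" for k x
  interpret PiM: prob_space "\<Pi>\<^sub>M i\<in>{1..n}. M"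
    by (intro prob_space_PiM) unfold_locales
  have "(\<integral>\<^sup>+x. \<Phi> n x \<partial>(\<Pi>\<^sub>M i\<in>{1..n}. M)) \<le> (\<integral>\<^sup>+x. \<Phi> 0 x \<partial>(\<Pi>\<^sub>M i\<in>{1..n}. M))"
  proof (rule nn_integral_PiM_supermartingale)
    show "\<Phi> k \<in> borel_measurable (\<Pi>\<^sub>M i\<in>{1..n}. M)" if "k \<le> n" for k
      unfolding \<Phi>_def using that by measurable
    show "\<Phi> k (x(Suc k := t)) = \<Phi> k x" if "k < n" for k x t
      unfolding \<Phi>_def using that by (simp add: mart_past rest_past cong: sum.cong)
    show "(\<integral>\<^sup>+t. \<Phi> (Suc k) (x(Suc k := t)) \<partial>M) \<le> \<Phi> k x" if k: "k < n" for k x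
    proof -
      define L where "L = owner (Suc k)"
      define v where "v = u L (Suc k) x"
      have L: "L \<in> K" using owner k by (simp add: L_def)
      have mS: "mart l (Suc k) (x(Suc k := t)) = mart l k x + (if l = L then v * t else 0)"
        and rS: "rest l (Suc k) (x(Suc k := t)) = rest l k x + (if l = L then - v\<^sup>2 else 0)"
        if "l \<in> K" for l t
        using that k by (simp_all only: mart_Suc rest_Suc v_def L_def)
      define N where "N = (\<Sum>l\<in>K. c l * mart l k x)"
      define R where "R = (\<Sum>l\<in>K. (c l)\<^sup>2 * rest l k x)"
      have 1: "(\<Sum>l\<in>K. c l * mart l (Suc k) (x(Suc k := t))) = N + c L * v * t" for t
        using sum_mult_update[OF finite_K L, of c "\<lambda>l. mart l k x" "v * t"] k unfolding N_def
        by (simp add: mS mult.assoc cong: sum.cong)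
      have 2: "(\<Sum>l\<in>K. (c l)\<^sup>2 * rest l (Suc k) (x(Suc k := t))) = R - (c L * v)\<^sup>2" for t
        using sum_mult_update[OF finite_K L, of "\<lambda>l. (c l)\<^sup>2" "\<lambda>l. rest l k x" "- v\<^sup>2"] k unfolding R_def
        by (simp add: rS power_mult_distrib cong: sum.cong)
      have R': "0 \<le> R - (c L * v)\<^sup>2"
        unfolding 2[of 0, symmetric] using k by (intro sum_nonneg mult_nonneg_nonneg rest_nonneg) auto
      have "(\<integral>\<^sup>+t. \<Phi> (Suc k) (x(Suc k := t)) \<partial>M)
          = (\<integral>\<^sup>+t. ennreal ((N\<^sup>2 + R - (c L * v)\<^sup>2) + (2 * N * (c L * v)) * t + (c L * v)\<^sup>2 * t\<^sup>2 + 0 * t ^ 4) \<partial>M)"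
        unfolding \<Phi>_def 1 2
        by (intro nn_integral_cong arg_cong[where f=ennreal]) (simp add: power2_eq_square algebra_simps)
      also have "\<dots> = ennreal ((N\<^sup>2 + R - (c L * v)\<^sup>2) + (c L * v)\<^sup>2 + 0 * m4)"
      proof (rule nn_integral_polynomial)
        fix t
        have "0 \<le> (N + c L * v * t)\<^sup>2 + (R - (c L * v)\<^sup>2)" using R' by simp
        then show "0 \<le> (N\<^sup>2 + R - (c L * v)\<^sup>2) + (2 * N * (c L * v)) * t + (c L * v)\<^sup>2 * t\<^sup>2 + 0 * t ^ 4"
          by (simp add: power2_eq_square algebra_simps)
      qed
      finally show ?thesis by (simp add: \<Phi>_def N_def R_def)
    qed
  qed
  also have "(\<integral>\<^sup>+x. \<Phi> 0 x \<partial>(\<Pi>\<^sub>M i\<in>{1..n}. M)) = ennreal (V * (\<Sum>l\<in>K. (c l)\<^sup>2))"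
    using PiM.emeasure_space_1 by (simp add: \<Phi>_def mart_def rest_def sum_distrib_left mult.commute)
  finally have "(\<integral>\<^sup>+x. \<Phi> n x \<partial>(\<Pi>\<^sub>M i\<in>{1..n}. M)) \<le> ennreal (V * (\<Sum>l\<in>K. (c l)\<^sup>2))" .
  moreover have "(\<integral>\<^sup>+x. ennreal ((\<Sum>l\<in>K. c l * mart l n x)\<^sup>2) \<partial>(\<Pi>\<^sub>M i\<in>{1..n}. M))
      \<le> (\<integral>\<^sup>+x. \<Phi> n x \<partial>(\<Pi>\<^sub>M i\<in>{1..n}. M))"
    by (intro nn_integral_mono) (auto simp: \<Phi>_def rest_nonneg intro!: ennreal_leI sum_nonneg mult_nonneg_nonneg)
  ultimately show ?thesis by order
qed

text \<open>The subtracted sum is the compensator of the quadratic form, so the difference is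
  centred. The bound involves \<open>W\<close> only through its Frobenius norm; for the kernels used
  later this norm becomes the squared norm of the weight vector, which the penalty
  dominates.\<close>

lemma nn_integral_quadratic_mart_le:
  fixes W :: "'l \<Rightarrow> 'l \<Rightarrow> real"
  assumes sym: "\<And>l m. W l m = W m l"
  shows "(\<integral>\<^sup>+x. ennreal (((\<Sum>l\<in>K. mart l n x * (\<Sum>m\<in>K. W l m * mart m n x))
        - (\<Sum>l\<in>K. W l l * (\<Sum>k=1..n. (u l k x)\<^sup>2)))\<^sup>2) \<partial>(\<Pi>\<^sub>M i\<in>{1..n}. M))
    \<le> ennreal ((8 + 2 * m4) * V\<^sup>2 * (\<Sum>l\<in>K. \<Sum>m\<in>K. (W l m)\<^sup>2))"
proof -
  define q where "q k x = (\<Sum>l\<in>K. mart l k x * (\<Sum>m\<in>K. W l m * mart m k x))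
        - (\<Sum>l\<in>K. W l l * (V - rest l k x))" for k x
  define \<psi> where "\<psi> k x = (\<Sum>m\<in>K. rest m k x * (\<Sum>l\<in>K. W m l * mart l k x)\<^sup>2)" for k x
  define \<eta> where "\<eta> k x = (\<Sum>l\<in>K. rest l k x * (\<Sum>m\<in>K. (W l m)\<^sup>2 * rest m k x))" for k x
  (* A step in coordinate l with weight u raises the expectation of q^2 by at most
     8 u^2 (W mart)_l^2 + 2 m4 u^4 (W l l)^2. The loss of psi pays for the first summand,
     the loss of eta for the second one and for the growth of (W mart)^2 inside psi. *)
  define \<Phi> where "\<Phi> k x = ennreal ((q k x)\<^sup>2 + 8 * \<psi> k x + (8 + 2 * m4) * \<eta> k x)" for k x
  interpret PiM: prob_space "\<Pi>\<^sub>M i\<in>{1..n}. M"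
    by (intro prob_space_PiM) unfold_locales
  have \<psi>0: "0 \<le> \<psi> k x" and \<eta>0: "0 \<le> \<eta> k x" if "k \<le> n" for k x
    using that by (auto simp: \<psi>_def \<eta>_def intro!: sum_nonneg mult_nonneg_nonneg rest_nonneg)
  have "(\<integral>\<^sup>+x. \<Phi> n x \<partial>(\<Pi>\<^sub>M i\<in>{1..n}. M)) \<le> (\<integral>\<^sup>+x. \<Phi> 0 x \<partial>(\<Pi>\<^sub>M i\<in>{1..n}. M))"
  proof (rule nn_integral_PiM_supermartingale)
    show "\<Phi> k \<in> borel_measurable (\<Pi>\<^sub>M i\<in>{1..n}. M)" if "k \<le> n" for k
      unfolding \<Phi>_def q_def \<psi>_def \<eta>_def using that by measurable
    show "\<Phi> k (x(Suc k := t)) = \<Phi> k x" if "k < n" for k x t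
      unfolding \<Phi>_def q_def \<psi>_def \<eta>_def using that by (simp add: mart_past rest_past cong: sum.cong)
    show "(\<integral>\<^sup>+t. \<Phi> (Suc k) (x(Suc k := t)) \<partial>M) \<le> \<Phi> k x" if k: "k < n" for k x
    proof -
      define L where "L = owner (Suc k)"
      define v where "v = u L (Suc k) x"
      have L: "L \<in> K" using owner k by (simp add: L_def)
      have mS: "mart l (Suc k) (x(Suc k := t)) = mart l k x + (if l = L then v * t else 0)"
        and rS: "rest l (Suc k) (x(Suc k := t)) = rest l k x + (if l = L then - v\<^sup>2 else 0)"
        if "l \<in> K" for l t
        using that k by (simp_all only: mart_Suc rest_Suc v_def L_def)
      define a where "a m = (\<Sum>l\<in>K. W m l * mart l k x)" for m
      define r where "r m = rest m k x + (if m = L then - v\<^sup>2 else 0)" for m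
      define T where "T = (\<Sum>m\<in>K. (W L m)\<^sup>2 * rest m k x)"
      have q': "q (Suc k) (x(Suc k := t)) = q k x + (2 * v * t * a L + W L L * v\<^sup>2 * (t\<^sup>2 - 1))" for t
      proof -
        have "(\<Sum>l\<in>K. mart l (Suc k) (x(Suc k := t)) * (\<Sum>m\<in>K. W l m * mart m (Suc k) (x(Suc k := t))))
          = (\<Sum>l\<in>K. mart l k x * (\<Sum>m\<in>K. W l m * mart m k x)) + 2 * (v * t) * a L + (v * t)\<^sup>2 * W L L"
          using bilinear_form_update[OF finite_K L, of W "\<lambda>l. mart l k x" "v * t"] sym k
          by (simp add: mS a_def cong: sum.cong)
        moreover have "(\<Sum>l\<in>K. W l l * (V - rest l (Suc k) (x(Suc k := t))))
          = (\<Sum>l\<in>K. W l l * (V - rest l k x)) + W L L * v\<^sup>2"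
        proof -
          have "(\<Sum>l\<in>K. W l l * (V - rest l (Suc k) (x(Suc k := t))))
            = (\<Sum>l\<in>K. W l l * (V - rest l k x) + (if l = L then W L L * v\<^sup>2 else 0))"
            using k by (intro sum.cong refl) (auto simp: rS algebra_simps)
          then show ?thesis using L finite_K by (simp add: sum.distrib)
        qed
        ultimately show ?thesis
          by (simp add: q_def power_mult_distrib algebra_simps)
      qed
      have r: "rest m (Suc k) (x(Suc k := t)) = r m" if "m \<in> K" for m t
        using that by (simp add: rS r_def)
      have r0: "0 \<le> r m" if "m \<in> K" for m
        using rest_nonneg[OF that, of "Suc k" "x(Suc k := 0)"] r[OF that] k by simp
      have v_le: "v\<^sup>2 \<le> rest L k x" using r0[OF L] by (simp add: r_def)
      have a': "(\<Sum>l\<in>K. W m l * mart l (Suc k) (x(Suc k := t))) = a m + W m L * v * t" for m t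
        using sum_mult_update[OF finite_K L, of "W m" "\<lambda>l. mart l k x" "v * t"] k unfolding a_def
        by (simp add: mS mult.assoc cong: sum.cong)
      have \<psi>': "\<psi> (Suc k) (x(Suc k := t)) = (\<Sum>m\<in>K. r m * (a m)\<^sup>2)
          + 2 * t * v * (\<Sum>m\<in>K. r m * a m * W m L) + t\<^sup>2 * (v\<^sup>2 * (\<Sum>m\<in>K. r m * (W m L)\<^sup>2))" for t
      proof -
        have "\<psi> (Suc k) (x(Suc k := t)) = (\<Sum>m\<in>K. r m * (a m + W m L * v * t)\<^sup>2)"
          unfolding \<psi>_def a' by (simp add: r cong: sum.cong)
        also have "\<dots> = (\<Sum>m\<in>K. r m * (a m)\<^sup>2 + 2 * t * v * (r m * a m * W m L) + t\<^sup>2 * (v\<^sup>2 * (r m * (W m L)\<^sup>2)))"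
          by (intro sum.cong refl) (simp add: power2_eq_square algebra_simps)
        finally show ?thesis by (simp add: sum.distrib sum_distrib_left)
      qed
      have ra: "(\<Sum>m\<in>K. r m * (a m)\<^sup>2) = \<psi> k x - v\<^sup>2 * (a L)\<^sup>2"
        using sum_mult_update[OF finite_K L, of "\<lambda>m. (a m)\<^sup>2" "\<lambda>m. rest m k x" "- v\<^sup>2"]
        by (simp add: r_def \<psi>_def mult.commute flip: a_def)
      have rW: "(\<Sum>m\<in>K. r m * (W m L)\<^sup>2) \<le> T"
        unfolding T_def
      proof (rule sum_mono)
        fix m
        have "r m * (W m L)\<^sup>2 \<le> rest m k x * (W m L)\<^sup>2"
          by (intro mult_right_mono) (auto simp: r_def)
        then show "r m * (W m L)\<^sup>2 \<le> (W L m)\<^sup>2 * rest m k x"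
          by (simp only: sym[of m L] mult.commute)
      qed
      have WT: "(W L L)\<^sup>2 * v\<^sup>2 \<le> T"
      proof -
        have "(W L L)\<^sup>2 * v\<^sup>2 \<le> (W L L)\<^sup>2 * rest L k x" using v_le by (intro mult_left_mono) auto
        also have "\<dots> \<le> T" unfolding T_def
          using L finite_K k by (intro member_le_sum[where f="\<lambda>m. (W L m)\<^sup>2 * rest m k x"]) (auto simp: rest_nonneg)
        finally show ?thesis .
      qed
      define X where "X = (\<Sum>l\<in>K. r l * (\<Sum>m\<in>K. (W l m)\<^sup>2 * r m))"
      have \<eta>': "\<eta> (Suc k) (x(Suc k := t)) = X" for t
        unfolding \<eta>_def X_def by (simp add: r cong: sum.cong)
      \<comment> \<open>Lowering one entry of the budget in both slots loses
        \<open>2 * v^2 * T\<close> and restores a diagonal term, which by \<open>WT\<close> is at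
        most \<open>v^2 * T\<close>. A net loss of \<open>v^2 * T\<close> remains.\<close>
      have X: "X = \<eta> k x - 2 * v\<^sup>2 * T + v ^ 4 * (W L L)\<^sup>2"
        using bilinear_form_update[OF finite_K L, of "\<lambda>l m. (W l m)\<^sup>2" "\<lambda>l. rest l k x" "- v\<^sup>2"] sym
        by (simp add: X_def r_def \<eta>_def T_def flip: power_mult)
      have X_le: "X \<le> \<eta> k x - v\<^sup>2 * T"
        using mult_left_mono[OF WT, of "v\<^sup>2"] unfolding X by (simp add: power2_eq_square power4_eq_xxxx algebra_simps)
      have \<eta>_pos: "0 \<le> X" unfolding X_def
        by (intro sum_nonneg mult_nonneg_nonneg r0) auto
      define p where "p t = ((q k x)\<^sup>2 - 2 * q k x * W L L * v\<^sup>2 + 2 * (W L L)\<^sup>2 * v ^ 4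
            + 8 * (\<Sum>m\<in>K. r m * (a m)\<^sup>2) + (8 + 2 * m4) * X)
          + (4 * q k x * v * a L + 16 * v * (\<Sum>m\<in>K. r m * a m * W m L)) * t
          + (2 * q k x * W L L * v\<^sup>2 + 8 * v\<^sup>2 * (a L)\<^sup>2 - 4 * (W L L)\<^sup>2 * v ^ 4
              + 8 * (v\<^sup>2 * (\<Sum>m\<in>K. r m * (W m L)\<^sup>2))) * t\<^sup>2
          + (2 * (W L L)\<^sup>2 * v ^ 4) * t ^ 4" for t
      \<comment> \<open>The increment of \<open>q\<close> is a part linear in \<open>t\<close> plus
        a part with \<open>t^2 - 1\<close>; their product is cubic. Bounding twice the product by
        the sum of the squares removes it, and doubles both squares.\<close>
      have p_ge: "(q (Suc k) (x(Suc k := t)))\<^sup>2 + 8 * \<psi> (Suc k) (x(Suc k := t))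
          + (8 + 2 * m4) * \<eta> (Suc k) (x(Suc k := t)) \<le> p t" for t
      proof -
        have "0 \<le> (2 * v * t * a L - W L L * v\<^sup>2 * (t\<^sup>2 - 1))\<^sup>2" by simp
        then show ?thesis
          unfolding q' \<psi>' \<eta>' p_def by (simp add: power2_eq_square power4_eq_xxxx algebra_simps)
      qed
      have p0: "0 \<le> p t" for t
        using \<psi>0[of "Suc k" "x(Suc k := t)"] \<eta>0[of "Suc k" "x(Suc k := t)"] k m4_nonneg
        by (intro order_trans[OF _ p_ge]) simp
      have "(\<integral>\<^sup>+t. \<Phi> (Suc k) (x(Suc k := t)) \<partial>M) \<le> (\<integral>\<^sup>+t. ennreal (p t) \<partial>M)"
        unfolding \<Phi>_def by (intro nn_integral_mono ennreal_leI p_ge)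
      also have "\<dots> = ennreal (((q k x)\<^sup>2 - 2 * q k x * W L L * v\<^sup>2 + 2 * (W L L)\<^sup>2 * v ^ 4
            + 8 * (\<Sum>m\<in>K. r m * (a m)\<^sup>2) + (8 + 2 * m4) * X)
          + (2 * q k x * W L L * v\<^sup>2 + 8 * v\<^sup>2 * (a L)\<^sup>2 - 4 * (W L L)\<^sup>2 * v ^ 4
              + 8 * (v\<^sup>2 * (\<Sum>m\<in>K. r m * (W m L)\<^sup>2)))
          + (2 * (W L L)\<^sup>2 * v ^ 4) * m4)"
        unfolding p_def by (rule nn_integral_polynomial) (use p0 in \<open>simp add: p_def\<close>)
      also have "\<dots> \<le> \<Phi> k x"
        unfolding \<Phi>_def ra
      \<comment> \<open>The growth of \<open>8 * \<psi>\<close> costs at most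
        \<open>8 * v^2 * T\<close> and the fourth moment at most \<open>2 * m4 * v^2 * T\<close>.
        Together this is the loss of \<open>\<eta>\<close> times \<open>8 + 2 * m4\<close>, which
        explains that weight.\<close>
      proof (rule ennreal_leI)
        have "8 * (v\<^sup>2 * (\<Sum>m\<in>K. r m * (W m L)\<^sup>2)) \<le> 8 * (v\<^sup>2 * T)"
          using rW by (simp add: mult_left_mono)
        moreover have "(2 * (W L L)\<^sup>2 * v ^ 4) * m4 \<le> 2 * (v\<^sup>2 * T) * m4"
          using mult_left_mono[OF WT, of "v\<^sup>2"] m4_nonneg
          by (intro mult_right_mono) (auto simp: power2_eq_square power4_eq_xxxx algebra_simps)
        moreover have "(8 + 2 * m4) * X \<le> (8 + 2 * m4) * (\<eta> k x - v\<^sup>2 * T)"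
          using X_le m4_nonneg by (intro mult_left_mono) auto
        ultimately have "(q k x)\<^sup>2 - 2 * q k x * W L L * v\<^sup>2 + 2 * (W L L)\<^sup>2 * v ^ 4
              + 8 * (\<psi> k x - v\<^sup>2 * (a L)\<^sup>2) + (8 + 2 * m4) * X
            + (2 * q k x * W L L * v\<^sup>2 + 8 * v\<^sup>2 * (a L)\<^sup>2 - 4 * (W L L)\<^sup>2 * v ^ 4
                + 8 * (v\<^sup>2 * (\<Sum>m\<in>K. r m * (W m L)\<^sup>2)))
            + 2 * (W L L)\<^sup>2 * v ^ 4 * m4
              + 2 * ((W L L)\<^sup>2 * v ^ 4)
            \<le> (q k x)\<^sup>2 + 8 * \<psi> k x + (8 + 2 * m4) * \<eta> k x"
          by (simp add: algebra_simps)
        moreover have "0 \<le> (W L L)\<^sup>2 * v ^ 4" by simp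
        ultimately show "(q k x)\<^sup>2 - 2 * q k x * W L L * v\<^sup>2 + 2 * (W L L)\<^sup>2 * v ^ 4
              + 8 * (\<psi> k x - v\<^sup>2 * (a L)\<^sup>2) + (8 + 2 * m4) * X
            + (2 * q k x * W L L * v\<^sup>2 + 8 * v\<^sup>2 * (a L)\<^sup>2 - 4 * (W L L)\<^sup>2 * v ^ 4
                + 8 * (v\<^sup>2 * (\<Sum>m\<in>K. r m * (W m L)\<^sup>2)))
            + 2 * (W L L)\<^sup>2 * v ^ 4 * m4
            \<le> (q k x)\<^sup>2 + 8 * \<psi> k x + (8 + 2 * m4) * \<eta> k x"
          by linarith
      qed
      finally show ?thesis .
    qed
  qed
  also have "(\<integral>\<^sup>+x. \<Phi> 0 x \<partial>(\<Pi>\<^sub>M i\<in>{1..n}. M)) = ennreal ((8 + 2 * m4) * V\<^sup>2 * (\<Sum>l\<in>K. \<Sum>m\<in>K. (W l m)\<^sup>2))"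
    using PiM.emeasure_space_1
    by (simp add: \<Phi>_def q_def \<psi>_def \<eta>_def mart_def rest_def sum_distrib_left sum_distrib_right power2_eq_square mult_ac)
  finally have "(\<integral>\<^sup>+x. \<Phi> n x \<partial>(\<Pi>\<^sub>M i\<in>{1..n}. M))
    \<le> ennreal ((8 + 2 * m4) * V\<^sup>2 * (\<Sum>l\<in>K. \<Sum>m\<in>K. (W l m)\<^sup>2))" .
  moreover have "(\<integral>\<^sup>+x. ennreal (((\<Sum>l\<in>K. mart l n x * (\<Sum>m\<in>K. W l m * mart m n x))
        - (\<Sum>l\<in>K. W l l * (\<Sum>k=1..n. (u l k x)\<^sup>2)))\<^sup>2) \<partial>(\<Pi>\<^sub>M i\<in>{1..n}. M))
      \<le> (\<integral>\<^sup>+x. \<Phi> n x \<partial>(\<Pi>\<^sub>M i\<in>{1..n}. M))"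
    using \<psi>0[of n] \<eta>0[of n] m4_nonneg
    by (intro nn_integral_mono) (auto simp: \<Phi>_def q_def rest_def intro!: ennreal_leI)
  ultimately show ?thesis by order
qed

end

section \<open>The sequential estimators\<close>

locale admissible_ar_procedure = ar_procedure +
  assumes ab: "a < b" and n_ge: "3 \<le> n" and pos: thresholds_positive
begin

section \<open>Block geometry and bounds for the thresholds\<close>

lemma d_pos: "0 < d"
proof -
  have "1 \<le> sqrt (real n)" using n_ge by simp
  then show ?thesis by (simp add: d_def)
qed

lemma d_le: "real d \<le> sqrt (real n)"
  by (simp add: d_def)

lemma d_ge: "sqrt (real n) \<le> 2 * real d"
proof -
  have "real d = of_int \<lfloor>sqrt (real n)\<rfloor>" by (simp add: d_def)
  moreover have "1 \<le> real d" using d_pos by simp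
  ultimately show ?thesis by linarith
qed

lemma z_tilde_eq: "z_tilde l = real l / real d"
  using ab by (simp add: z_tilde_def z_def)

lemma h_tilde_eq: "h_tilde = 1 / (2 * real d)"
  using ab by (simp add: h_tilde_def h_def)

lemma h_pos: "0 < h"
  using ab d_pos by (simp add: h_def)

lemma eps_tilde_bounds: "0 < eps_tilde" "eps_tilde \<le> 1 / 2"
proof -
  have "0 \<le> ln (real n)" using n_ge by simp
  then show "0 < eps_tilde" "eps_tilde \<le> 1 / 2" by (simp_all add: eps_tilde_def field_simps)
qed

lemma \<gamma>_tilde_bounds: "eps_tilde \<le> \<gamma>_tilde l y" "\<gamma>_tilde l y \<le> 1"
proof -
  have "\<bar>S_trunc l y\<bar> \<le> 1 - eps_tilde"
    using eps_tilde_bounds by (auto simp: S_trunc_def abs_le_iff)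
  then have "(S_trunc l y)\<^sup>2 \<le> (1 - eps_tilde)\<^sup>2"
    by (metis abs_ge_zero power2_abs power_mono)
  also have "\<dots> \<le> 1 - eps_tilde"
    using eps_tilde_bounds by (simp add: power2_eq_square mult_left_le)
  finally show "eps_tilde \<le> \<gamma>_tilde l y" "\<gamma>_tilde l y \<le> 1" by (simp_all add: \<gamma>_tilde_def)
qed

definition gap :: "nat \<Rightarrow> real" where "gap l = real (k2 l) - real (\<iota> l) - 1"

lemma H_pos: "l \<in> {1..d} \<Longrightarrow> 0 < H l y"
  using pos by (simp add: thresholds_positive_def)

lemma gap_pos: assumes "l \<in> {1..d}" shows "0 < gap l"
proof -
  have "0 < (1 - eps_tilde) / \<gamma>_tilde l y * gap l" for y
    using H_pos[OF assms, of y] by (simp add: H_def gap_def)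
  moreover have "0 < (1 - eps_tilde) / \<gamma>_tilde l y" for y
    using \<gamma>_tilde_bounds[of l y] eps_tilde_bounds by simp
  ultimately show ?thesis by (blast intro: zero_less_mult_pos)
qed

lemma block_nonempty: "l \<in> {1..d} \<Longrightarrow> \<iota> l + 2 \<le> k2 l"
  using gap_pos[of l] by (simp add: gap_def)

lemma k2_le_n: "k2 l \<le> n"
  by (simp add: k2_def)

lemma k2_le: "real (k2 l) \<le> real n * (real l + 1 / 2) / real d"
proof -
  have "real (k2 l) \<le> real (nat \<lfloor>real n * z_tilde l + real n * h_tilde\<rfloor>)" by (simp add: k2_def)
  also have "\<dots> \<le> real n * z_tilde l + real n * h_tilde"
    by (intro of_nat_floor) (simp add: z_tilde_eq h_tilde_eq)
  also have "\<dots> = real n * (real l + 1 / 2) / real d"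
    using d_pos by (simp add: z_tilde_eq h_tilde_eq field_simps)
  finally show ?thesis .
qed

lemma k1_ge: "real n * (real l - 1 / 2) / real d \<le> real (k1 l)"
proof -
  have "real n * (real l - 1 / 2) / real d = real n * z_tilde l - real n * h_tilde"
    using d_pos by (simp add: z_tilde_eq h_tilde_eq field_simps)
  also have "\<dots> \<le> real (k1 l)"
    unfolding k1_def by linarith
  finally show ?thesis .
qed

lemma gap_le: "gap l \<le> real n / real d"
proof -
  have "gap l \<le> real (k2 l) - real (k1 l)" by (simp add: gap_def \<iota>_def)
  also have "\<dots> \<le> real n * (real l + 1 / 2) / real d - real n * (real l - 1 / 2) / real d"
    using k2_le k1_ge by (intro diff_mono)
  also have "\<dots> = real n / real d" using d_pos by (simp add: field_simps)
  finally show ?thesis .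
qed

text \<open>Neighbouring windows can meet only at n (l + 1/2) / d; there \<open>k2\<close> rounds
  down, while \<open>k1\<close> is a floor plus one. Hence no noise variable is used for two
  different knots.\<close>

lemma blocks_disjoint:
  assumes "l < m" shows "k2 l \<le> \<iota> m"
proof -
  have "real (k2 l) \<le> real n * (real l + 1 / 2) / real d" by (rule k2_le)
  also have "\<dots> \<le> real n * (real m - 1 / 2) / real d"
    using assms d_pos by (intro divide_right_mono mult_left_mono) auto
  also have "\<dots> \<le> real (k1 m)" by (rule k1_ge)
  finally show ?thesis by (simp add: \<iota>_def)
qed

lemma H_ge: assumes "l \<in> {1..d}" shows "gap l / 2 \<le> H l y"
proof -
  have "1 / 2 \<le> (1 - eps_tilde) / \<gamma>_tilde l y"
    using \<gamma>_tilde_bounds[of l y] eps_tilde_bounds by (simp add: field_simps)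
  from mult_right_mono[OF this less_imp_le[OF gap_pos[OF assms]]] show ?thesis
    by (simp add: H_def gap_def)
qed

text \<open>The factor \<open>2 + ln n\<close> is \<open>1 / eps_tilde\<close>: the truncated pilot
  keeps \<open>\<gamma>_tilde\<close> at least \<open>eps_tilde\<close>. It is the source of the
  logarithm in the final remainder.\<close>

lemma H_le: assumes "l \<in> {1..d}" shows "H l y \<le> (2 + ln (real n)) * (real n / real d)"
proof -
  have "(1 - eps_tilde) / \<gamma>_tilde l y \<le> 1 / eps_tilde"
    using \<gamma>_tilde_bounds[of l y] eps_tilde_bounds by (intro frac_le) auto
  then have "H l y \<le> 1 / eps_tilde * gap l"
    unfolding H_def gap_def[symmetric] using gap_pos[OF assms] by (intro mult_right_mono) auto
  also have "\<dots> \<le> 1 / eps_tilde * (real n / real d)"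
    using gap_le eps_tilde_bounds by (intro mult_left_mono) auto
  finally show ?thesis by (simp add: eps_tilde_def)
qed

lemma \<sigma>_square: "l \<in> {1..d} \<Longrightarrow> (\<sigma> l y)\<^sup>2 = 1 / H l y"
  using H_pos[of l y] powr_add[of "H l y" "- 1 / 2" "- 1 / 2"]
  by (simp add: \<sigma>_def power2_eq_square powr_minus_divide)

text \<open>
  The predictable weights \<open>u l k\<close> of the noise in \<open>S_seq l\<close>. The last index \<open>k2 l\<close>, which the stopping rule does
  not reach on \<open>Gamma\<close>, absorbs the variance not yet spent, so that the squares of
  the weights always add up to \<open>1 / H l\<close>, on and off \<open>Gamma\<close>.
\<close>

definition R :: "nat \<Rightarrow> (nat \<Rightarrow> real) \<Rightarrow> nat \<Rightarrow> real" where
  "R l y j = max 0 ((H l y - A l y (\<iota> l) j) / (H l y)\<^sup>2)"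

definition u :: "nat \<Rightarrow> nat \<Rightarrow> (nat \<Rightarrow> real) \<Rightarrow> real" where
  "u l k y = (if \<iota> l < k \<and> k < k2 l
      then (if 0 \<le> y (k - 1) then 1 else - 1) * sqrt (R l y (k - 1) - R l y k)
      else if k = k2 l then sqrt (R l y (k2 l - 1)) else 0)"

lemma Q_nonneg: "0 \<le> Q l j"
  by (simp add: Q_def)

lemma A_Suc: "m \<le> k \<Longrightarrow> A l y m (Suc k) = A l y m k + Q l (Suc k) * (y k)\<^sup>2"
  by (simp add: A_def)

lemma A_self: "A l y m m = 0"
  by (simp add: A_def)

lemma A_mono: "j \<le> k \<Longrightarrow> A l y m j \<le> A l y m k"
  unfolding A_def by (intro sum_mono2) (auto simp: Q_nonneg)

lemma R_antimono: "j \<le> k \<Longrightarrow> R l y k \<le> R l y j"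
  unfolding R_def using A_mono[of j k l y "\<iota> l"] by (intro max.mono divide_right_mono) auto

lemma u_square: "\<iota> l < k \<Longrightarrow> k < k2 l \<Longrightarrow> (u l k y)\<^sup>2 = R l y (k - 1) - R l y k"
  using R_antimono[of "k - 1" k l y] by (simp add: u_def power_mult_distrib)

lemma u_outside: "l \<in> {1..d} \<Longrightarrow> \<not> (\<iota> l < k \<and> k \<le> k2 l) \<Longrightarrow> u l k y = 0"
  using block_nonempty[of l] by (auto simp: u_def)

lemma sum_u_square:
  assumes l: "l \<in> {1..d}"
  shows "(\<Sum>k=1..n. (u l k y)\<^sup>2) = 1 / H l y"
proof -
  have tel: "(\<Sum>k=\<iota> l + 1..m. R l y (k - 1) - R l y k) = R l y (\<iota> l) - R l y m" if "\<iota> l \<le> m" for m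
    using that by (induction m rule: dec_induct) auto
  have "(\<Sum>k=1..n. (u l k y)\<^sup>2) = (\<Sum>k=\<iota> l + 1..k2 l. (u l k y)\<^sup>2)"
    using k2_le_n[of l] u_outside[OF l] by (intro sum.mono_neutral_right) auto
  also have "{\<iota> l + 1..k2 l} = insert (k2 l) {\<iota> l + 1..k2 l - 1}"
    using block_nonempty[OF l] by auto
  also have "(\<Sum>k\<in>insert (k2 l) {\<iota> l + 1..k2 l - 1}. (u l k y)\<^sup>2)
      = (u l (k2 l) y)\<^sup>2 + (\<Sum>k=\<iota> l + 1..k2 l - 1. (u l k y)\<^sup>2)"
    using block_nonempty[OF l] by (subst sum.insert) auto
  also have "(\<Sum>k=\<iota> l + 1..k2 l - 1. (u l k y)\<^sup>2) = (\<Sum>k=\<iota> l + 1..k2 l - 1. R l y (k - 1) - R l y k)"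
    using block_nonempty[OF l] by (intro sum.cong refl u_square) auto
  also have "\<dots> = R l y (\<iota> l) - R l y (k2 l - 1)"
    using block_nonempty[OF l] by (intro tel) auto
  also have "(u l (k2 l) y)\<^sup>2 = R l y (k2 l - 1)"
    by (simp add: u_def R_def)
  also have "R l y (\<iota> l) = 1 / H l y"
    using H_pos[OF l, of y] by (simp add: R_def A_self power2_eq_square)
  finally show ?thesis by simp
qed

lemma A_cong: "(\<And>j. j < k \<Longrightarrow> y j = y' j) \<Longrightarrow> A l y m k = A l y' m k"
  unfolding A_def by (intro sum.cong refl) auto

lemma H_cong:
  assumes "\<And>j. j \<le> \<iota> l \<Longrightarrow> y j = y' j" shows "H l y = H l y'"
proof -
  have "(\<Sum>j=1..\<iota> l. Q l j * y (j - 1) * y j) = (\<Sum>j=1..\<iota> l. Q l j * y' (j - 1) * y' j)"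
    using assms by (intro sum.cong refl) auto
  moreover have "A l y 0 (\<iota> l) = A l y' 0 (\<iota> l)" using assms by (intro A_cong) auto
  ultimately show ?thesis by (simp add: H_def \<gamma>_tilde_def S_trunc_def S_pilot_def)
qed

lemma R_cong: "\<iota> l < k \<Longrightarrow> j \<le> k \<Longrightarrow> (\<And>i. i < k \<Longrightarrow> y i = y' i) \<Longrightarrow> R l y j = R l y' j"
  unfolding R_def using H_cong[of l y y'] A_cong[of j y y'] by auto

text \<open>Inside a block \<open>k\<close> exceeds \<open>\<iota> l\<close>, so the threshold, a
  function of the observations up to \<open>\<iota> l\<close>, is already known. Outside the block
  the weight is zero. This is the predictability of the weights.\<close>

lemma u_cong:
  assumes "l \<in> {1..d}" "\<And>i. i < k \<Longrightarrow> y i = y' i"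
  shows "u l k y = u l k y'"
proof (cases "\<iota> l < k")
  case True
  then show ?thesis using assms(2) R_cong[OF True _ assms(2)] by (auto simp: u_def)
next
  case False
  then show ?thesis using u_outside[OF assms(1)] by simp
qed

lemma
  assumes "\<And>j. (\<lambda>x. f x j) \<in> borel_measurable N"
  shows A_measurable: "(\<lambda>x. A l (f x) m k) \<in> borel_measurable N"
    and H_measurable: "(\<lambda>x. H l (f x)) \<in> borel_measurable N"
    and u_measurable: "(\<lambda>x. u l k (f x)) \<in> borel_measurable N"
proof -
  note [measurable] = assms
  show [measurable]: "(\<lambda>x. A l (f x) m k) \<in> borel_measurable N" for m k
    unfolding A_def by measurable
  show [measurable]: "(\<lambda>x. H l (f x)) \<in> borel_measurable N"
    unfolding H_def \<gamma>_tilde_def S_trunc_def S_pilot_def by measurable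
  show "(\<lambda>x. u l k (f x)) \<in> borel_measurable N"
    unfolding u_def R_def by measurable
qed

text \<open>\<open>Gamma_at\<close> tests the sum at \<open>k2 l - 1\<close>, so stopping happens
  strictly before \<open>k2 l\<close>, and that index stays free for the unspent variance.
  Minimality at the first admissible index uses that an empty sum lies below the positive
  threshold.\<close>

lemma stopping:
  assumes l: "l \<in> {1..d}" and G: "Gamma_at l y"
  shows "\<iota> l < \<tau> l y" "\<tau> l y < k2 l" "H l y \<le> A l y (\<iota> l) (\<tau> l y)" "A l y (\<iota> l) (\<tau> l y - 1) < H l y"
proof -
  let ?P = "\<lambda>k. k \<in> {\<iota> l + 1..k2 l} \<and> A l y (\<iota> l) k \<ge> H l y"
  have P: "?P (k2 l - 1)" using G block_nonempty[OF l] by (auto simp: Gamma_at_def)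
  then have \<tau>: "\<tau> l y = (LEAST k. ?P k)" by (auto simp: \<tau>_def)
  have P\<tau>: "?P (\<tau> l y)" unfolding \<tau> using P by (rule LeastI)
  then show "\<iota> l < \<tau> l y" "H l y \<le> A l y (\<iota> l) (\<tau> l y)" by auto
  have "\<tau> l y \<le> k2 l - 1" unfolding \<tau> using P by (rule Least_le)
  then show "\<tau> l y < k2 l" using block_nonempty[OF l] by auto
  show "A l y (\<iota> l) (\<tau> l y - 1) < H l y"
  proof (cases "\<tau> l y - 1 = \<iota> l")
    case True
    then show ?thesis using H_pos[OF l] by (simp add: A_self)
  next
    case False
    have "\<tau> l y - 1 < \<tau> l y" using P\<tau> by auto
    then have "\<tau> l y - 1 < (LEAST k. ?P k)" by (simp only: \<tau>[symmetric])
    then have "\<not> ?P (\<tau> l y - 1)" by (rule not_less_Least)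
    then show ?thesis using P\<tau> False by auto
  qed
qed

text \<open>What is missing to the threshold before the last summand is positive and at most that
  summand. Its quotient by the summand therefore lies in (0, 1] and has exactly one positive square
  root.\<close>

lemma \<kappa>_properties:
  assumes l: "l \<in> {1..d}" and G: "Gamma_at l y"
  shows "0 < \<kappa> l y" "\<kappa> l y \<le> 1"
    "A l y (\<iota> l) (\<tau> l y - 1) + (\<kappa> l y)\<^sup>2 * Q l (\<tau> l y) * (y (\<tau> l y - 1))\<^sup>2 = H l y"
proof -
  note st = stopping[OF l G]
  define B where "B = Q l (\<tau> l y) * (y (\<tau> l y - 1))\<^sup>2"
  define r where "r = H l y - A l y (\<iota> l) (\<tau> l y - 1)"
  have "A l y (\<iota> l) (\<tau> l y) = A l y (\<iota> l) (\<tau> l y - 1) + B"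
    using A_Suc[of "\<iota> l" "\<tau> l y - 1" l y] st(1) by (simp add: B_def)
  then have r: "0 < r" "r \<le> B" using st by (auto simp: r_def)
  let ?P = "\<lambda>c. 0 < c \<and> c \<le> 1 \<and>
     A l y (\<iota> l) (\<tau> l y - 1) + c\<^sup>2 * Q l (\<tau> l y) * (y (\<tau> l y - 1))\<^sup>2 = H l y"
  have eq: "?P c \<longleftrightarrow> 0 < c \<and> c \<le> 1 \<and> c\<^sup>2 * B = r" for c
    by (auto simp: B_def r_def mult.assoc)
  have "?P (sqrt (r / B))" unfolding eq using r by simp
  moreover have "c = sqrt (r / B)" if "?P c" for c
    using that r unfolding eq by (intro real_sqrt_unique[symmetric]) (auto simp: field_simps)
  ultimately have "?P (\<kappa> l y)" unfolding \<kappa>_def by (rule theI)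
  then show "0 < \<kappa> l y" "\<kappa> l y \<le> 1"
    "A l y (\<iota> l) (\<tau> l y - 1) + (\<kappa> l y)\<^sup>2 * Q l (\<tau> l y) * (y (\<tau> l y - 1))\<^sup>2 = H l y" by auto
qed

text \<open>Before stopping, \<open>R\<close> falls by \<open>Q * y^2 / H^2\<close>; at
  \<open>\<tau>\<close> it falls to zero by \<open>\<kappa>^2 * Q * y^2 / H^2\<close>. Square roots
  with the sign of the observation recover the weights of the estimator. As \<open>u\<close> is
  defined without \<open>\<tau>\<close> and \<open>\<kappa>\<close>, its measurability follows
  directly from that of \<open>A\<close> and \<open>H\<close>.\<close>

lemma u_on_Gamma:
  assumes l: "l \<in> {1..d}" and G: "Gamma_at l y"
  shows "\<iota> l < k \<Longrightarrow> k < \<tau> l y \<Longrightarrow> u l k y = Q l k * y (k - 1) / H l y"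
    and "u l (\<tau> l y) y = \<kappa> l y * Q l (\<tau> l y) * y (\<tau> l y - 1) / H l y"
    and "\<not> (\<iota> l < k \<and> k \<le> \<tau> l y) \<Longrightarrow> u l k y = 0"
proof -
  note st = stopping[OF l G] and \<kappa> = \<kappa>_properties[OF l G]
  have Hp: "0 < H l y" by (rule H_pos[OF l])
  have sq: "sqrt (c\<^sup>2 * Q l k * (y (k - 1))\<^sup>2 / (H l y)\<^sup>2) = c * Q l k * \<bar>y (k - 1)\<bar> / H l y" if "0 \<le> c" for c k
    using that Hp by (simp add: real_sqrt_divide real_sqrt_mult Q_def)
  have R0: "R l y k = 0" if "\<tau> l y \<le> k" for k
    using st(3) A_mono[OF that, of l y "\<iota> l"] by (auto simp: R_def max_def divide_simps zero_le_mult_iff)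
  show "u l k y = Q l k * y (k - 1) / H l y" if k: "\<iota> l < k" "k < \<tau> l y"
  proof -
    have "A l y (\<iota> l) k = A l y (\<iota> l) (k - 1) + Q l k * (y (k - 1))\<^sup>2"
      using A_Suc[of "\<iota> l" "k - 1" l y] k by simp
    moreover have "A l y (\<iota> l) k < H l y" "A l y (\<iota> l) (k - 1) < H l y"
      using k by (auto intro!: le_less_trans[OF A_mono st(4)])
    ultimately have "R l y (k - 1) - R l y k = 1\<^sup>2 * Q l k * (y (k - 1))\<^sup>2 / (H l y)\<^sup>2"
      using Hp by (simp add: R_def max_def divide_simps) 
    then have "sqrt (R l y (k - 1) - R l y k) = 1 * Q l k * \<bar>y (k - 1)\<bar> / H l y"
      by (simp only: sq[of 1 k])
    then show ?thesis using k st(2) by (simp add: u_def)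
  qed
  show "u l (\<tau> l y) y = \<kappa> l y * Q l (\<tau> l y) * y (\<tau> l y - 1) / H l y"
  proof -
    have "R l y (\<tau> l y - 1) = (\<kappa> l y)\<^sup>2 * Q l (\<tau> l y) * (y (\<tau> l y - 1))\<^sup>2 / (H l y)\<^sup>2"
      using st(4) \<kappa>(3) Hp by (simp add: R_def max_def divide_simps)
    then have "sqrt (R l y (\<tau> l y - 1) - R l y (\<tau> l y)) = \<kappa> l y * Q l (\<tau> l y) * \<bar>y (\<tau> l y - 1)\<bar> / H l y"
      using sq[of "\<kappa> l y" "\<tau> l y"] \<kappa>(1) R0[of "\<tau> l y"] by simp
    then show ?thesis using st(1,2) by (simp add: u_def)
  qed
  show "u l k y = 0" if "\<not> (\<iota> l < k \<and> k \<le> \<tau> l y)"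
  proof (cases "\<iota> l < k")
    case True
    then have "\<tau> l y \<le> k - 1" using that by simp
    then have "R l y (k - 1) = 0" "R l y k = 0" by (auto intro: R0)
    then show ?thesis by (auto simp: u_def)
  next
    case False
    then show ?thesis using block_nonempty[OF l] by (auto simp: u_def)
  qed
qed

text \<open>Inserting the recursion splits the estimator into the noise sum and a combination of
  values \<open>sx k\<close> with non-negative weights. Weights with nonzero \<open>Q\<close> sit at
  grid points within the window, so each value there is within \<open>\<omega>\<close> of
  \<open>sz\<close>; the rest of the bias is the excess of the total weight over 1.\<close>

lemma S_seq_decomposition:
  fixes sx xi :: "nat \<Rightarrow> real" and sz m \<omega> :: real
  assumes l: "l \<in> {1..d}" and G: "Gamma_at l y"
    and y: "\<And>j. j \<in> {1..n} \<Longrightarrow> y j = sx j * y (j - 1) + xi j"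
    and sx: "\<And>j. j \<in> {1..n} \<Longrightarrow> \<bar>grid a b n j - z l\<bar> \<le> h \<Longrightarrow> \<bar>sx j - sz\<bar> \<le> \<omega>"
    and sz: "\<bar>sz\<bar> \<le> 1" and \<omega>: "0 \<le> \<omega>"
    and m: "\<And>j. j \<le> n \<Longrightarrow> (y j)\<^sup>2 \<le> m"
  shows "\<bar>S_seq l y - (sz + (\<Sum>k=1..n. u l k y * xi k))\<bar> \<le> \<omega> * (1 + m / H l y) + m / H l y"
proof -
  note st = stopping[OF l G] and \<kappa> = \<kappa>_properties[OF l G] and uu = u_on_Gamma[OF l G]
  define T where "T = \<tau> l y"
  define B where "B = Q l T * (y (T - 1))\<^sup>2"
  have Hp: "0 < H l y" by (rule H_pos[OF l])
  have T: "\<iota> l < T" "T \<le> n" using st k2_le_n[of l] by (auto simp: T_def)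
  have split: "(\<Sum>k=\<iota> l + 1..T. f k) = (\<Sum>k=\<iota> l + 1..T - 1. f k) + f T" for f :: "nat \<Rightarrow> real"
    using T(1) by (cases T) auto
  have sub: "(\<Sum>k=\<iota> l + 1..T. u l k y * xi k) = (\<Sum>k=1..n. u l k y * xi k)"
    using T uu(3) by (intro sum.mono_neutral_left) (auto simp: T_def)
  have "S_seq l y = (\<Sum>k=\<iota> l + 1..T. u l k y * y k)"
  proof -
    have "(\<Sum>k=\<iota> l + 1..T - 1. u l k y * y k) = (\<Sum>k=\<iota> l + 1..T - 1. 1 / H l y * (Q l k * y (k - 1) * y k))"
      by (intro sum.cong refl) (auto simp: uu(1) T_def)
    moreover have "u l T y * y T = 1 / H l y * (\<kappa> l y * Q l T * y (T - 1) * y T)"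
      by (simp add: uu(2) T_def)
    ultimately show ?thesis
      unfolding split using G by (simp add: S_seq_def T_def sum_distrib_left distrib_left)
  qed
  also have "\<dots> = (\<Sum>k=\<iota> l + 1..T. (u l k y * y (k - 1)) * sx k + u l k y * xi k)"
  proof (intro sum.cong refl)
    fix k assume "k \<in> {\<iota> l + 1..T}"
    then have "k \<in> {1..n}" using T by auto
    then show "u l k y * y k = (u l k y * y (k - 1)) * sx k + u l k y * xi k"
      using y[of k] by (simp add: algebra_simps)
  qed
  also have "\<dots> = (\<Sum>k=\<iota> l + 1..T. (u l k y * y (k - 1)) * sx k) + (\<Sum>k=1..n. u l k y * xi k)"
    unfolding sum.distrib sub ..
  finally have S: "S_seq l y = (\<Sum>k=\<iota> l + 1..T. (u l k y * y (k - 1)) * sx k) + (\<Sum>k=1..n. u l k y * xi k)" .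
  define w where "w k = u l k y * y (k - 1)" for k
  have w: "w k = Q l k * (y (k - 1))\<^sup>2 / H l y" if "\<iota> l < k" "k < T" for k
    using that uu(1)[of k] by (simp add: w_def T_def power2_eq_square)
  have wT: "w T = \<kappa> l y * B / H l y"
    using uu(2) by (simp add: w_def T_def B_def power2_eq_square)
  have B: "0 \<le> B" "B \<le> m"
    using m[of "T - 1"] T order_trans[OF zero_le_power2 m[of 0]] by (auto simp: B_def Q_def)
  have w0: "0 \<le> w k" if "k \<in> {\<iota> l + 1..T}" for k
    using w[of k] wT that Hp \<kappa>(1) B(1) Q_nonneg[of l k] by (cases "k = T") auto
  \<comment> \<open>The threshold is met with \<open>\<kappa>^2\<close> on the last summand, but the
    estimator carries \<open>\<kappa>\<close> there. This mismatch is the excess over 1.\<close>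
  have sum_w: "(\<Sum>k=\<iota> l + 1..T. w k) = 1 + (\<kappa> l y - (\<kappa> l y)\<^sup>2) * B / H l y"
  proof -
    have "(\<Sum>k=\<iota> l + 1..T - 1. w k) = A l y (\<iota> l) (T - 1) / H l y"
      unfolding A_def sum_divide_distrib by (intro sum.cong refl) (auto simp: w)
    moreover have "A l y (\<iota> l) (T - 1) = H l y - (\<kappa> l y)\<^sup>2 * B"
      using \<kappa>(3) by (simp add: T_def B_def)
    ultimately show ?thesis unfolding split wT using Hp by (simp add: field_simps)
  qed
  have \<kappa>2: "0 \<le> \<kappa> l y - (\<kappa> l y)\<^sup>2" "\<kappa> l y - (\<kappa> l y)\<^sup>2 \<le> 1"
    using \<kappa>(1,2) mult_left_le[of "\<kappa> l y" "\<kappa> l y"] by (auto simp: power2_eq_square intro: order_trans[of _ "\<kappa> l y"])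
  define e where "e = (\<kappa> l y - (\<kappa> l y)\<^sup>2) * B / H l y"
  have e: "0 \<le> e" "e \<le> m / H l y"
    using \<kappa>2 B Hp mult_mono[of "\<kappa> l y - (\<kappa> l y)\<^sup>2" 1 B m] by (auto simp: e_def intro!: divide_right_mono)
  have "\<bar>\<Sum>k=\<iota> l + 1..T. w k * (sx k - sz)\<bar> \<le> (\<Sum>k=\<iota> l + 1..T. w k * \<omega>)"
  proof (intro order_trans[OF sum_abs] sum_mono)
    fix k assume k: "k \<in> {\<iota> l + 1..T}"
    show "\<bar>w k * (sx k - sz)\<bar> \<le> w k * \<omega>"
    proof (cases "Q l k = 0")
      case True
      then have "w k = 0" using w[of k] wT k by (cases "k = T") (auto simp: B_def)
      then show ?thesis by simp
    next
      case False
      then have "\<bar>sx k - sz\<bar> \<le> \<omega>" using sx[of k] k T by (auto simp: Q_def split: if_splits)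
      then show ?thesis using w0[OF k] by (simp add: abs_mult mult_left_mono)
    qed
  qed
  also have "\<dots> = (1 + e) * \<omega>" by (simp add: sum_w e_def flip: sum_distrib_right)
  also have "\<dots> \<le> \<omega> * (1 + m / H l y)" using e \<omega> by (simp add: mult.commute mult_left_mono)
  finally have 1: "\<bar>\<Sum>k=\<iota> l + 1..T. w k * (sx k - sz)\<bar> \<le> \<omega> * (1 + m / H l y)" .
  have 2: "\<bar>sz * e\<bar> \<le> m / H l y"
    using e sz mult_mono[of "\<bar>sz\<bar>" 1 e "m / H l y"] by (simp add: abs_mult)
  have "(\<Sum>k=\<iota> l + 1..T. w k * sx k) = (\<Sum>k=\<iota> l + 1..T. w k * (sx k - sz)) + sz * (1 + e)"
    unfolding sum_w[folded e_def, symmetric] sum_distrib_left sum.distrib[symmetric]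
    by (intro sum.cong refl) (simp add: algebra_simps)
  then have "S_seq l y - (sz + (\<Sum>k=1..n. u l k y * xi k)) = (\<Sum>k=\<iota> l + 1..T. w k * (sx k - sz)) + sz * e"
    using S by (simp add: w_def algebra_simps)
  then show ?thesis using 1 2 by linarith
qed

end

section \<open>Integrated and discrete errors\<close>

text \<open>
  \<open>f\<close> need not be measurable. It stands for the loss of an estimator as a function of the noise, so
  that the measurability of \<open>\<kappa>\<close>, \<open>\<tau>\<close> and of the selector plays no role.
\<close>

lemma nn_integral_affine_le:
  fixes f g :: "'a \<Rightarrow> ennreal"
  assumes [measurable]: "g \<in> borel_measurable M" and c: "0 < c"
  shows "(\<integral>\<^sup>+x. ennreal c * f x + g x \<partial>M) \<le> ennreal c * (\<integral>\<^sup>+x. f x \<partial>M) + (\<integral>\<^sup>+x. g x \<partial>M)"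
  unfolding nn_integral_def_finite[of M "\<lambda>x. ennreal c * f x + g x"]
proof (safe intro!: SUP_least)
  fix \<phi> assume [measurable_dest]: "simple_function M \<phi>" and le: "\<phi> \<le> (\<lambda>x. ennreal c * f x + g x)"
    and fin: "\<forall>x. \<phi> x < top"
  have [measurable]: "\<phi> \<in> borel_measurable M" by (rule borel_measurable_simple_function) fact
  \<comment> \<open>A measurable minorant of \<open>f\<close>, found by solving the inequality for
    \<open>f\<close>. Finiteness of \<open>\<phi>\<close> excludes the difference of two
    infinities.\<close>
  define \<psi> where "\<psi> x = ennreal (1 / c) * (\<phi> x - g x)" for x
  have [measurable]: "\<psi> \<in> borel_measurable M" unfolding \<psi>_def by measurable
  have c1: "ennreal c * (ennreal (1 / c) * t) = t" for t
    using c by (simp flip: mult.assoc ennreal_mult)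
  have c2: "ennreal (1 / c) * (ennreal c * t) = t" for t
    using c by (simp flip: mult.assoc ennreal_mult)
  have "\<psi> x \<le> f x" for x
  proof -
    have "\<phi> x \<noteq> \<top>" using fin by (metis less_irrefl)
    then have "\<phi> x - g x \<le> ennreal c * f x"
      using le by (auto simp: ennreal_minus_le_iff le_fun_def add.commute)
    then have "\<psi> x \<le> ennreal (1 / c) * (ennreal c * f x)" unfolding \<psi>_def by (rule mult_left_mono) simp
    then show ?thesis by (simp add: c2)
  qed
  moreover have "\<phi> x \<le> ennreal c * \<psi> x + g x" for x
    unfolding \<psi>_def c1 using ennreal_minus_le_iff[of "\<phi> x" "g x" "\<phi> x - g x"]
    by (auto simp: add.commute)
  moreover have "integral\<^sup>S M \<phi> = (\<integral>\<^sup>+x. \<phi> x \<partial>M)"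
    by (rule nn_integral_eq_simple_integral[symmetric]) fact
  moreover have "(\<integral>\<^sup>+x. ennreal c * \<psi> x + g x \<partial>M) = ennreal c * (\<integral>\<^sup>+x. \<psi> x \<partial>M) + (\<integral>\<^sup>+x. g x \<partial>M)"
    by (simp add: nn_integral_add nn_integral_cmult)
  ultimately show "integral\<^sup>S M \<phi> \<le> ennreal c * (\<integral>\<^sup>+x. f x \<partial>M) + (\<integral>\<^sup>+x. g x \<partial>M)"
    by (metis (no_types, lifting) add_right_mono mult_left_mono nn_integral_mono order_trans zero_le)
qed

lemma power2_diff_le_weighted:
  fixes u v w t :: real
  assumes "0 < t"
  shows "(u - w)\<^sup>2 \<le> (1 + t) * (u - v)\<^sup>2 + (1 + 1 / t) * (v - w)\<^sup>2"
proof -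
  have "(u - w)\<^sup>2 = (u - v)\<^sup>2 + 2 * ((u - v) * (v - w)) + (v - w)\<^sup>2"
    by (simp add: power2_eq_square algebra_simps)
  also have "2 * ((u - v) * (v - w)) \<le> t * (u - v)\<^sup>2 + (v - w)\<^sup>2 / t"
    using abs_mult_le_weighted[OF assms, of "u - v" "v - w"] by linarith
  finally show ?thesis by (simp add: algebra_simps)
qed

section \<open>Step functions on the cells between the knots\<close>

context admissible_ar_procedure
begin

definition cell :: "nat \<Rightarrow> real set" where
  "cell l = (if l = 1 then {a..z 1} else {z (l - 1)<..z l})"

definition step :: "(nat \<Rightarrow> real) \<Rightarrow> real \<Rightarrow> real" where
  "step t x = (\<Sum>l=1..d. t l * indicator (cell l) x)"

definition mesh :: real where "mesh = (b - a) / real d"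

lemma mesh_pos: "0 < mesh"
  using ab d_pos by (simp add: mesh_def)

lemma S_weight_eq_step: "S_weight w y = step (S_knot w y)"
proof
  fix x
  have "{1..d} = insert 1 {2..d}" using d_pos by auto
  then have "step (S_knot w y) x = (\<Sum>l\<in>insert 1 {2..d}. S_knot w y l * indicator (cell l) x)"
    by (simp only: step_def)
  also have "\<dots> = S_knot w y 1 * indicator (cell 1) x + (\<Sum>l=2..d. S_knot w y l * indicator (cell l) x)"
    by (rule sum.insert) auto
  also have "(\<Sum>l=2..d. S_knot w y l * indicator (cell l) x)
      = (\<Sum>l=2..d. S_knot w y l * indicator {z (l - 1)<..z l} x)"
    by (intro sum.cong refl) (auto simp: cell_def)
  finally show "S_weight w y x = step (S_knot w y) x"
    by (simp add: S_weight_def cell_def)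
qed

lemma z_mono: "l \<le> m \<Longrightarrow> z l \<le> z m"
  using ab by (auto simp: z_def intro!: mult_right_mono divide_right_mono)

lemma z_0: "z 0 = a" and z_d: "z d = b"
  using d_pos by (simp_all add: z_def)

lemma z_diff: "0 < l \<Longrightarrow> z l - z (l - 1) = mesh"
  by (cases l) (simp_all add: z_def mesh_def field_simps add_divide_distrib)

lemma z_in: "l \<le> d \<Longrightarrow> z l \<in> {a..b}"
  using z_mono[of 0 l] z_mono[of l d] by (simp add: z_0 z_d)

lemma obtain_cell:
  assumes "x \<in> {a..b}"
  obtains l where "l \<in> {1..d}" "\<And>t. step t x = t l" "\<bar>x - z l\<bar> \<le> mesh"
proof -
  define l where "l = (LEAST k. 1 \<le> k \<and> x \<le> z k)"
  have Pd: "1 \<le> d \<and> x \<le> z d" using assms d_pos by (simp add: z_d)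
  then have l: "1 \<le> l" "x \<le> z l" unfolding l_def by (metis (mono_tags, lifting) LeastI)+
  have ld: "l \<le> d" unfolding l_def using Pd by (rule Least_le)
  have low: "z k < x" if "1 \<le> k" "k < l" for k
    using not_less_Least[of k "\<lambda>k. 1 \<le> k \<and> x \<le> z k"] that by (auto simp: l_def)
  have zl: "l = 1 \<or> z (l - 1) < x" using l low[of "l - 1"] by (cases "l = 1") auto
  have mem: "x \<in> cell k \<longleftrightarrow> k = l" if k: "k \<in> {1..d}" for k
  proof
    assume "k = l" then show "x \<in> cell k" using zl l assms by (auto simp: cell_def)
  next
    assume xk: "x \<in> cell k"
    show "k = l"
    proof (rule ccontr)
      assume "k \<noteq> l"
      then consider "k < l" | "l < k" by linarith
      then show False
      proof cases
        case 1
        then show False using low[of k] k xk by (auto simp: cell_def split: if_splits)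
      next
        case 2
        then have "z l \<le> z (k - 1)" by (intro z_mono) auto
        then show False using xk 2 l by (auto simp: cell_def split: if_splits)
      qed
    qed
  qed
  have "step t x = t l" for t
  proof -
    have "step t x = (\<Sum>k=1..d. if k = l then t l else 0)"
      unfolding step_def by (intro sum.cong refl) (auto simp: mem indicator_def)
    then show ?thesis using l ld by simp
  qed
  moreover have "z (l - 1) \<le> x" using zl assms by (auto simp: z_0)
  then have "\<bar>x - z l\<bar> \<le> mesh" using z_diff[of l] l by auto
  ultimately show ?thesis using that[of l] l ld by auto
qed

lemma nn_integral_step:
  assumes t: "\<And>l. l \<in> {1..d} \<Longrightarrow> 0 \<le> t l"
  shows "(\<integral>\<^sup>+x\<in>{a..b}. ennreal (step t x) \<partial>lborel) = ennreal (mesh * (\<Sum>l=1..d. t l))"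
proof -
  have sub: "cell l \<subseteq> {a..b}" if "l \<in> {1..d}" for l
  proof -
    have "l \<le> d" "l - 1 \<le> d" using that by auto
    then have "z l \<in> {a..b}" "z (l - 1) \<in> {a..b}" by (simp_all only: z_in)
    then show ?thesis by (auto simp: cell_def)
  qed
  have em: "emeasure lborel (cell l) = ennreal mesh" if "l \<in> {1..d}" for l
    using z_diff[of l] z_mono[of "l - 1" l] that by (auto simp: cell_def z_0)
  have [measurable]: "cell l \<in> sets borel" for l by (simp add: cell_def)
  have "(\<integral>\<^sup>+x\<in>{a..b}. ennreal (step t x) \<partial>lborel)
      = (\<integral>\<^sup>+x. (\<Sum>l=1..d. ennreal (t l) * indicator (cell l) x) \<partial>lborel)"
  proof (intro nn_integral_cong)
    fix x
    have "ennreal (step t x) = (\<Sum>l=1..d. ennreal (t l * indicator (cell l) x))"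
      unfolding step_def using t by (intro sum_ennreal[symmetric]) auto
    also have "\<dots> = (\<Sum>l=1..d. ennreal (t l) * indicator (cell l) x)"
      by (intro sum.cong refl) (auto simp: indicator_def)
    finally have e: "ennreal (step t x) = (\<Sum>l=1..d. ennreal (t l) * indicator (cell l) x)" .
    show "ennreal (step t x) * indicator {a..b} x = (\<Sum>l=1..d. ennreal (t l) * indicator (cell l) x)"
    proof (cases "x \<in> {a..b}")
      case False
      then have "\<forall>l\<in>{1..d}. x \<notin> cell l" using sub by blast
      with False show ?thesis by simp
    qed (simp add: e)
  qed
  also have "\<dots> = (\<Sum>l=1..d. ennreal (t l) * emeasure lborel (cell l))"
    by (subst nn_integral_sum) (auto simp: nn_integral_cmult_indicator)
  also have "\<dots> = (\<Sum>l=1..d. ennreal (mesh * t l))"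
    using mesh_pos t by (intro sum.cong refl) (simp add: em ennreal_mult mult.commute)
  also have "\<dots> = ennreal (mesh * (\<Sum>l=1..d. t l))"
    using mesh_pos t by (subst sum_ennreal) (auto simp: sum_distrib_left)
  finally show ?thesis .
qed

definition knot_error :: "(real \<Rightarrow> real) \<Rightarrow> (nat \<Rightarrow> real) \<Rightarrow> real" where
  "knot_error S t = mesh * (\<Sum>l=1..d. (t l - S (z l))\<^sup>2)"

context
  fixes S :: "real \<Rightarrow> real" and L \<delta> :: real
  assumes lip: "\<And>x x'. x \<in> {a..b} \<Longrightarrow> x' \<in> {a..b} \<Longrightarrow> \<bar>S x - S x'\<bar> \<le> L * \<bar>x - x'\<bar>"
    and L: "0 \<le> L" and \<delta>: "0 < \<delta>"
begin

lemma lip_cell: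
  assumes "x \<in> {a..b}" "l \<in> {1..d}" "\<bar>x - z l\<bar> \<le> mesh"
  shows "(S (z l) - S x)\<^sup>2 \<le> (L * mesh)\<^sup>2"
proof -
  have "\<bar>S (z l) - S x\<bar> \<le> L * \<bar>z l - x\<bar>" using z_in assms by (intro lip) auto
  also have "\<dots> \<le> L * mesh" using assms L by (intro mult_left_mono) auto
  finally show ?thesis using L mesh_pos by (metis abs_ge_zero power2_abs power_mono)
qed

text \<open>On a cell the target differs from its knot value by at most \<open>L * mesh\<close>.
  Splitting the square with parameter \<open>\<delta>\<close> gives one factor
  \<open>1 + \<delta>\<close>; the reverse comparison gives the second one of the oracle
  constant.\<close>

lemma integrated_error_le_knot_error:
  "(\<integral>\<^sup>+x\<in>{a..b}. ennreal ((step t x - S x)\<^sup>2) \<partial>lborel)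
    \<le> ennreal ((1 + \<delta>) * knot_error S t + (1 + 1 / \<delta>) * ((b - a) * (L * mesh)\<^sup>2))"
proof -
  define r where "r l = (1 + \<delta>) * (t l - S (z l))\<^sup>2 + (1 + 1 / \<delta>) * (L * mesh)\<^sup>2" for l
  have "(\<integral>\<^sup>+x\<in>{a..b}. ennreal ((step t x - S x)\<^sup>2) \<partial>lborel) \<le> (\<integral>\<^sup>+x\<in>{a..b}. ennreal (step r x) \<partial>lborel)"
  proof (intro nn_integral_mono)
    fix x
    show "ennreal ((step t x - S x)\<^sup>2) * indicator {a..b} x \<le> ennreal (step r x) * indicator {a..b} x"
    proof (cases "x \<in> {a..b}")
      case True
      then obtain l where l: "l \<in> {1..d}" "\<And>t. step t x = t l" "\<bar>x - z l\<bar> \<le> mesh"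
        using obtain_cell by blast
      have "(t l - S x)\<^sup>2 \<le> (1 + \<delta>) * (t l - S (z l))\<^sup>2 + (1 + 1 / \<delta>) * (S (z l) - S x)\<^sup>2"
        by (rule power2_diff_le_weighted[OF \<delta>])
      also have "(1 + 1 / \<delta>) * (S (z l) - S x)\<^sup>2 \<le> (1 + 1 / \<delta>) * (L * mesh)\<^sup>2"
        using \<delta> by (intro mult_left_mono lip_cell[OF True l(1,3)]) auto
      finally have "(step t x - S x)\<^sup>2 \<le> step r x" unfolding l(2) r_def by simp
      then show ?thesis by (intro mult_right_mono ennreal_leI) auto
    qed simp
  qed
  also have "\<dots> = ennreal (mesh * (\<Sum>l=1..d. r l))"
    using \<delta> by (intro nn_integral_step) (simp add: r_def)
  also have "mesh * (\<Sum>l=1..d. r l)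
      = (1 + \<delta>) * knot_error S t + (1 + 1 / \<delta>) * ((real d * mesh) * (L * mesh)\<^sup>2)"
    by (simp add: r_def knot_error_def sum.distrib algebra_simps flip: sum_distrib_left)
  also have "real d * mesh = b - a" using d_pos by (simp add: mesh_def)
  finally show ?thesis .
qed

text \<open>The same splitting with the roles exchanged. The integrated error now stands on the
  larger side, and splitting its integral relies on \<open>nn_integral_affine_le\<close>, as
  \<open>S\<close> has not been shown to be measurable.\<close>

lemma knot_error_le_integrated_error:
  "ennreal (knot_error S t)
    \<le> ennreal (1 + \<delta>) * (\<integral>\<^sup>+x\<in>{a..b}. ennreal ((step t x - S x)\<^sup>2) \<partial>lborel)
      + ennreal ((1 + 1 / \<delta>) * ((b - a) * (L * mesh)\<^sup>2))"
proof -
  define r where "r l = (t l - S (z l))\<^sup>2" for l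
  have "ennreal (knot_error S t) = (\<integral>\<^sup>+x\<in>{a..b}. ennreal (step r x) \<partial>lborel)"
    by (subst nn_integral_step) (auto simp: r_def knot_error_def)
  also have "\<dots> \<le> (\<integral>\<^sup>+x. ennreal (1 + \<delta>) * (ennreal ((step t x - S x)\<^sup>2) * indicator {a..b} x)
      + ennreal ((1 + 1 / \<delta>) * (L * mesh)\<^sup>2) * indicator {a..b} x \<partial>lborel)"
  proof (intro nn_integral_mono)
    fix x
    show "ennreal (step r x) * indicator {a..b} x
        \<le> ennreal (1 + \<delta>) * (ennreal ((step t x - S x)\<^sup>2) * indicator {a..b} x)
          + ennreal ((1 + 1 / \<delta>) * (L * mesh)\<^sup>2) * indicator {a..b} x"
    proof (cases "x \<in> {a..b}")
      case True
      then obtain l where l: "l \<in> {1..d}" "\<And>t. step t x = t l" "\<bar>x - z l\<bar> \<le> mesh"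
        using obtain_cell by blast
      have "(t l - S (z l))\<^sup>2 \<le> (1 + \<delta>) * (t l - S x)\<^sup>2 + (1 + 1 / \<delta>) * (S x - S (z l))\<^sup>2"
        by (rule power2_diff_le_weighted[OF \<delta>])
      also have "(1 + 1 / \<delta>) * (S x - S (z l))\<^sup>2 \<le> (1 + 1 / \<delta>) * (L * mesh)\<^sup>2"
        using \<delta> by (subst power2_commute) (intro mult_left_mono lip_cell[OF True l(1,3)], auto)
      finally have "ennreal (step r x) \<le> ennreal ((1 + \<delta>) * (step t x - S x)\<^sup>2 + (1 + 1 / \<delta>) * (L * mesh)\<^sup>2)"
        unfolding l(2) r_def by (intro ennreal_leI) simp
      then show ?thesis using True \<delta> by (simp add: ennreal_mult)
    qed simp
  qed
  also have "\<dots> \<le> ennreal (1 + \<delta>) * (\<integral>\<^sup>+x\<in>{a..b}. ennreal ((step t x - S x)\<^sup>2) \<partial>lborel)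
      + (\<integral>\<^sup>+x. ennreal ((1 + 1 / \<delta>) * (L * mesh)\<^sup>2) * indicator {a..b} x \<partial>lborel)"
    using \<delta> by (intro nn_integral_affine_le) auto
  also have "(\<integral>\<^sup>+x. ennreal ((1 + 1 / \<delta>) * (L * mesh)\<^sup>2) * indicator {a..b} x \<partial>lborel)
      = ennreal ((1 + 1 / \<delta>) * ((b - a) * (L * mesh)\<^sup>2))"
    using ab \<delta> by (subst nn_integral_cmult_indicator) (auto simp: mult_ac simp flip: ennreal_mult)
  finally show ?thesis .
qed

end

section \<open>Transfer to coefficients at the knots\<close>

definition coef :: "(nat \<Rightarrow> real) \<Rightarrow> nat \<Rightarrow> real" where
  "coef f j = mesh * (\<Sum>l=1..d. f l * \<phi> j (z l))"

lemma coef_add: "coef (\<lambda>l. f l + g l) j = coef f j + coef g j"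
  by (simp add: coef_def distrib_right sum.distrib distrib_left)

text \<open>On \<open>Gamma\<close> the estimated coefficients are those of the target plus those of
  noise and bias. By Pythagoras the knot error of any weight vector is the coefficient error plus
  one common residual; Bessel's inequality carries the bound on \<open>\<beta>\<close> over to its
  coefficients.\<close>

lemma knot_error_oracle_on_Gamma:
  fixes S :: "real \<Rightarrow> real" and \<eta> \<beta> y w w0 :: "nat \<Rightarrow> real" and x \<delta> :: real
  defines "\<theta> \<equiv> coef (\<lambda>l. S (z l))"
  defines "U \<equiv> \<lambda>v. \<Sum>j=1..d. v j * ((coef \<eta> j)\<^sup>2 - mesh * s j y)"
    and "N \<equiv> \<lambda>v. \<Sum>j=1..d. v j * \<theta> j * coef \<eta> j"
  assumes orth: orthonormal_system
    and G: "Gamma y"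
    and S_seq: "\<And>l. l \<in> {1..d} \<Longrightarrow> S_seq l y = S (z l) + \<eta> l + \<beta> l"
    and w: "w \<in> weight_vectors" "w0 \<in> weight_vectors"
    and x: "0 \<le> x"
    and \<delta>: "0 < \<delta>" "\<delta> \<le> 1 / 12"
    and U1: "\<And>v. v \<in> {w, w0} \<Longrightarrow> (U v)\<^sup>2 \<le> x * (\<Sum>j=1..d. (v j)\<^sup>2 * (mesh * s j y))"
    and U2: "\<And>v. v \<in> {w, w0} \<Longrightarrow> (U (\<lambda>j. (v j)\<^sup>2))\<^sup>2 \<le> x * (\<Sum>j=1..d. (v j)\<^sup>2 * (mesh * s j y))"
    and N1: "(N (\<lambda>j. w j - w0 j))\<^sup>2 \<le> x * (\<Sum>j=1..d. ((w j - w0 j) * \<theta> j)\<^sup>2)"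
    and N2: "\<And>v. v \<in> {w, w0} \<Longrightarrow>
      (N (\<lambda>j. v j * (1 - v j)))\<^sup>2 \<le> x * (\<Sum>j=1..d. ((1 - v j) * \<theta> j)\<^sup>2)"
    and \<beta>: "mesh * (\<Sum>l=1..d. (\<beta> l)\<^sup>2) \<le> x"
    and J: "J \<delta> y w \<le> J \<delta> y w0"
  shows "knot_error S (S_knot w y)
      \<le> (1 + 4 * \<delta>) / (1 - 6 * \<delta>) * knot_error S (S_knot w0 y) + 300 * x / \<delta>"
proof -
  define e where "e v = (\<Sum>j=1..d. (v j * (\<theta> j + coef \<eta> j + coef \<beta> j) - \<theta> j)\<^sup>2)" for v :: "nat \<Rightarrow> real"
  define \<rho> where "\<rho> = mesh * (\<Sum>l=1..d. (S (z l))\<^sup>2) - (\<Sum>j=1..d. (\<theta> j)\<^sup>2)"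
  have orth': "mesh * (\<Sum>l\<in>{1..d}. \<phi> i (z l) * \<phi> j (z l)) = of_bool (i = j)"
    if "i \<in> {1..d}" "j \<in> {1..d}" for i j
    using orth that unfolding orthonormal_system_def mesh_def by blast
  have \<theta>_hat: "\<theta>_hat j y = \<theta> j + coef \<eta> j + coef \<beta> j" for j
  proof -
    have "\<theta>_hat j y = coef (\<lambda>l. S (z l) + \<eta> l + \<beta> l) j"
      unfolding \<theta>_hat_def coef_def mesh_def using G
      by (intro arg_cong2[where f="(*)"] sum.cong refl) (simp add: Y_def S_seq)
    then show ?thesis by (simp add: coef_add \<theta>_def)
  qed
  have E: "knot_error S (S_knot v y) = e v + \<rho>" for v
  proof -
    have "knot_error S (S_knot v y)
        = mesh * (\<Sum>l\<in>{1..d}. ((\<Sum>j\<in>{1..d}. (v j * \<theta>_hat j y) * \<phi> j (z l)) - S (z l))\<^sup>2)"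
      using G by (simp add: knot_error_def S_knot_def mult.assoc)
    also have "\<dots> = (\<Sum>j\<in>{1..d}. (v j * \<theta>_hat j y - mesh * (\<Sum>l\<in>{1..d}. S (z l) * \<phi> j (z l)))\<^sup>2)
        + (mesh * (\<Sum>l\<in>{1..d}. (S (z l))\<^sup>2) - (\<Sum>j\<in>{1..d}. (mesh * (\<Sum>l\<in>{1..d}. S (z l) * \<phi> j (z l)))\<^sup>2))"
      by (rule orthonormal_pythagoras[OF _ orth']) auto
    finally show ?thesis
      by (simp add: e_def \<rho>_def \<theta>_hat \<theta>_def coef_def)
  qed
  have \<rho>: "0 \<le> \<rho>"
    using orthonormal_bessel[OF _ orth', of "{1..d}" "\<lambda>l. S (z l)"] mesh_pos
    by (simp add: \<rho>_def \<theta>_def coef_def)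
  have \<beta>': "(\<Sum>j=1..d. (coef \<beta> j)\<^sup>2) \<le> x"
    using orthonormal_bessel[OF _ orth', of "{1..d}" \<beta>] mesh_pos \<beta> by (simp add: coef_def)
  have s0: "0 \<le> mesh * s j y" if "j \<in> {1..d}" for j
    using mesh_pos by (simp add: s_def mesh_def[symmetric] sum_nonneg)
  have pen: "penalty y v = (\<Sum>j=1..d. (v j)\<^sup>2 * (mesh * s j y))" for v
    by (simp add: penalty_def mesh_def[symmetric] sum_distrib_left mult.left_commute)
  have J': "J \<delta> y v = (\<Sum>j=1..d. (v j)\<^sup>2 * (\<theta> j + coef \<eta> j + coef \<beta> j)\<^sup>2)
        - 2 * (\<Sum>j=1..d. v j * ((\<theta> j + coef \<eta> j + coef \<beta> j)\<^sup>2 - mesh * s j y))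
        + \<delta> * (\<Sum>j=1..d. (v j)\<^sup>2 * (mesh * s j y))" for v
    by (simp add: J_def \<theta>_tilde_def mesh_def[symmetric] \<theta>_hat pen)
  have w01: "0 \<le> v j \<and> v j \<le> 1" if "v \<in> {w, w0}" "j \<in> {1..d}" for v j
    using w that by (auto simp: weight_vectors_def PiE_iff)
  have "e w \<le> (1 + 4 * \<delta>) / (1 - 6 * \<delta>) * e w0 + 300 * x / \<delta>"
    unfolding e_def
    by (rule oracle_inequality_coefficients[where I="{1..d}" and w=w and ?w0.0=w0 and s="\<lambda>j. mesh * s j y"
          and \<theta>=\<theta> and \<xi>="coef \<eta>" and \<beta>="coef \<beta>"])
      (fact w01 s0 x \<delta> U1[unfolded U_def] U2[unfolded U_def] N1[unfolded N_def] N2[unfolded N_def]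
        \<beta>' J[unfolded J'])+
  \<comment> \<open>The common residual occurs once on the left and may be multiplied by the oracle
    factor on the right, because that factor is at least 1.\<close>
  moreover have "1 * \<rho> \<le> (1 + 4 * \<delta>) / (1 - 6 * \<delta>) * \<rho>"
    using \<rho> \<delta> by (intro mult_right_mono) auto
  ultimately show ?thesis unfolding E by (simp add: distrib_left)
qed

end

section \<open>Block lengths, moments and subpolynomial sequences\<close>

context admissible_ar_procedure
begin

lemma gap_ge_1: "l \<in> {1..d} \<Longrightarrow> 1 \<le> gap l"
  using block_nonempty[of l] by (simp add: gap_def)

text \<open>\<open>X\<close> is half the length of a full window. For \<open>l = d\<close> the right
  half is cut off at \<open>n\<close>, so only the left half is counted; the pilot takes
  \<open>X powr \<mu>0\<close>, and 3 covers both roundings and the final 1.\<close>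

lemma gap_ge:
  fixes X :: real
  defines "X \<equiv> real n / (2 * real d)"
  assumes l: "l \<in> {1..d}"
  shows "X - X powr \<mu>0 - 3 \<le> gap l"
proof -
  have X: "real n * h_tilde = X" by (simp add: h_tilde_eq X_def)
  have l1: "1 \<le> real l" "real l \<le> real d" using l by auto
  have "real n * real l / real d - 1 \<le> real (k2 l)"
  proof -
    have "real n * z_tilde l + real n * h_tilde - 1 \<le> real (nat \<lfloor>real n * z_tilde l + real n * h_tilde\<rfloor>)"
      by linarith
    moreover have "real n * real l / real d \<le> real n * z_tilde l + real n * h_tilde"
      by (simp add: z_tilde_eq h_tilde_eq)
    moreover have "real n * real l / real d \<le> real n"
      using mult_left_mono[OF l1(2), of "real n"] d_pos by (simp add: field_simps)
    ultimately show ?thesis by (simp add: k2_def min_def)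
  qed
  moreover have "real (k1 l) \<le> real n * real l / real d - X + 1"
  proof -
    have eq: "real n * z_tilde l - real n * h_tilde = real n * real l / real d - X"
      unfolding X by (simp add: z_tilde_eq)
    have "0 \<le> real n * (real l - 1 / 2) / real d" using l1 by simp
    also have "\<dots> = real n * real l / real d - X"
      using d_pos by (simp add: X_def field_simps)
    finally have "real (nat \<lfloor>real n * real l / real d - X\<rfloor>) \<le> real n * real l / real d - X"
      by (rule of_nat_floor)
    then show ?thesis by (simp add: k1_def eq)
  qed
  moreover have "real q \<le> X powr \<mu>0"
    unfolding q_def X by (intro of_nat_floor) simp
  ultimately show ?thesis by (simp add: gap_def \<iota>_def)
qed

lemma block_half_length_ge: "sqrt (real n) / 2 \<le> real n / (2 * real d)"
proof -
  have "sqrt (real n) * real d \<le> sqrt (real n) * sqrt (real n)"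
    using d_le by (intro mult_left_mono) auto
  then show ?thesis using d_pos by (simp add: field_simps)
qed

end

text \<open>One constant must serve all n with positive thresholds. For long blocks the pilot is of
  lower order since \<open>\<mu> < 1\<close>; for short ones sqrt n is bounded and the gap, being a
  positive integer, is at least 1.\<close>

lemma exists_gap_bound:
  fixes \<mu> :: real
  assumes "\<mu> < 1"
  shows "\<exists>g>0. \<forall>a b n l. admissible_ar_procedure a b \<mu> n \<longrightarrow> l \<in> {1..ar_procedure.d n} \<longrightarrow>
    g * sqrt (real n) \<le> admissible_ar_procedure.gap a b \<mu> n l"
proof -
  have "((\<lambda>X::real. X powr (\<mu> - 1)) \<longlongrightarrow> 0) at_top"
    using assms by (intro tendsto_neg_powr filterlim_ident) auto
  then have "\<forall>\<^sub>F X::real in at_top. X powr (\<mu> - 1) < 1 / 4"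
    by (rule order_tendstoD) simp
  moreover have "\<forall>\<^sub>F X::real in at_top. 12 \<le> X" by (rule eventually_ge_at_top)
  ultimately have "\<forall>\<^sub>F X::real in at_top. X / 2 \<le> X - X powr \<mu> - 3"
  proof eventually_elim
    case (elim X)
    have "X powr \<mu> = X * X powr (\<mu> - 1)" using elim by (simp add: powr_diff)
    also have "\<dots> \<le> X * (1 / 4)" using elim by (intro mult_left_mono) auto
    finally show ?case using elim by simp
  qed
  then obtain X0 where X0: "\<And>X. X0 \<le> X \<Longrightarrow> X / 2 \<le> X - X powr \<mu> - 3"
    unfolding eventually_at_top_linorder by blast
  \<comment> \<open>The first entry serves \<open>X \<ge> X0\<close>, where the gap is at least
    \<open>X / 2\<close> and \<open>X\<close> at least sqrt n / 2. The second serves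
    \<open>X < X0\<close>, where sqrt n is at most \<open>2 * max X0 1\<close>.\<close>
  define g where "g = min (1 / 4) (1 / (2 * max X0 1))"
  have "0 < g" by (simp add: g_def)
  moreover have "g * sqrt (real n) \<le> admissible_ar_procedure.gap a b \<mu> n l"
    if adm: "admissible_ar_procedure a b \<mu> n" and l: "l \<in> {1..ar_procedure.d n}" for a b n l
  proof -
    interpret admissible_ar_procedure a b \<mu> n by (fact adm)
    define X where "X = real n / (2 * real d)"
    have Xn: "sqrt (real n) / 2 \<le> X" unfolding X_def by (rule block_half_length_ge)
    show ?thesis
    proof (cases "X0 \<le> X")
      case True
      have "g * sqrt (real n) \<le> 1 / 4 * sqrt (real n)" by (intro mult_right_mono) (auto simp: g_def)
      also have "\<dots> \<le> gap l" using gap_ge[OF l] X0[OF True] Xn by (simp add: X_def)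
      finally show ?thesis .
    next
      case False
      have "g * sqrt (real n) \<le> 1 / (2 * max X0 1) * (2 * max X0 1)"
        using False Xn by (intro mult_mono) (auto simp: g_def)
      also have "\<dots> \<le> gap l" using gap_ge_1[OF l] by simp
      finally show ?thesis .
    qed
  qed
  ultimately show ?thesis by blast
qed

section \<open>Closure properties of subpolynomial sequences\<close>

lemma subpolynomial_add: "subpolynomial f \<Longrightarrow> subpolynomial g \<Longrightarrow> subpolynomial (\<lambda>n. f n + g n)"
  unfolding subpolynomial_def add_divide_distrib by (auto intro: tendsto_add_zero)

lemma subpolynomial_mult:
  assumes "subpolynomial f" "subpolynomial g"
  shows "subpolynomial (\<lambda>n. f n * g n)"
  unfolding subpolynomial_def
proof safe
  fix c :: real assume "0 < c"
  then have "(\<lambda>n. (f n / real n powr (c / 2)) * (g n / real n powr (c / 2))) \<longlonglongrightarrow> 0"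
    using assms by (intro tendsto_mult_zero) (auto simp: subpolynomial_def)
  then show "(\<lambda>n. f n * g n / real n powr c) \<longlonglongrightarrow> 0"
    by (simp flip: powr_add)
qed

lemma subpolynomial_const: "subpolynomial (\<lambda>_. C)"
  unfolding subpolynomial_def
proof safe
  fix c :: real assume "0 < c"
  then have "(\<lambda>n. C * real n powr - c) \<longlonglongrightarrow> C * 0"
    by (intro tendsto_mult tendsto_const tendsto_neg_powr filterlim_real_sequentially) auto
  then show "(\<lambda>n. C / real n powr c) \<longlonglongrightarrow> 0" by (simp add: powr_minus divide_inverse)
qed

lemma subpolynomial_of_powr_bound:
  assumes "\<And>c. 0 < c \<Longrightarrow> \<exists>C. \<forall>\<^sub>F n in sequentially. \<bar>f n\<bar> \<le> C * real n powr c"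
  shows "subpolynomial f"
  unfolding subpolynomial_def
proof safe
  fix c :: real assume c: "0 < c"
  then obtain C where C: "\<forall>\<^sub>F n in sequentially. \<bar>f n\<bar> \<le> C * real n powr (c / 2)"
    using assms[of "c / 2"] by auto
  have "(\<lambda>n. C * real n powr - (c / 2)) \<longlonglongrightarrow> C * 0"
    using c by (intro tendsto_mult tendsto_const tendsto_neg_powr filterlim_real_sequentially) auto
  then have lim: "(\<lambda>n. C * real n powr - (c / 2)) \<longlonglongrightarrow> 0" by simp
  show "(\<lambda>n. f n / real n powr c) \<longlonglongrightarrow> 0"
  proof (rule Lim_null_comparison[OF _ lim])
    show "\<forall>\<^sub>F n in sequentially. norm (f n / real n powr c) \<le> C * real n powr - (c / 2)"
      using C eventually_gt_at_top[of 0]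
    proof eventually_elim
      case (elim n)
      have "norm (f n / real n powr c) \<le> C * real n powr (c / 2) / real n powr c"
        using elim by (simp add: divide_right_mono)
      also have "\<dots> = C * real n powr - (c / 2)"
        using powr_diff[of "real n" "c / 2" c] by simp
      finally show ?case .
    qed
  qed
qed

lemma subpolynomial_ln: "subpolynomial (\<lambda>n. ln (real n))"
proof (rule subpolynomial_of_powr_bound)
  fix c :: real assume c: "0 < c"
  have "\<bar>ln (real n)\<bar> \<le> (1 / c) * real n powr c" if "1 \<le> n" for n
    using ln_powr_bound[of "real n" c] that c by simp
  then show "\<exists>C. \<forall>\<^sub>F n in sequentially. \<bar>ln (real n)\<bar> \<le> C * real n powr c"
    unfolding eventually_sequentially by blast
qed

section \<open>Moments of the largest noise variable\<close>

context standardized_noise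
begin

text \<open>Fourth powers, because the squared bias involves squares of squared observations.
  \<open>enn2real\<close> sends infinity to 0, so the value is meaningful only together with the
  finiteness contained in \<open>nn_integral_Max_eq\<close>.\<close>

definition max_moment :: "nat \<Rightarrow> real" where
  "max_moment n = enn2real (\<integral>\<^sup>+x. ennreal (Max ((\<lambda>k. x k ^ 4) ` {1..n})) \<partial>(\<Pi>\<^sub>M i\<in>{1..n}. M))"

lemma coordinate_measurable:
  "k \<in> I \<Longrightarrow> (\<lambda>x. x k) \<in> borel_measurable (\<Pi>\<^sub>M i\<in>I. M)"
  using measurable_component_singleton[of k I "\<lambda>_. M"] measurable_cong_sets[OF refl sets_M] by blast

lemma nn_integral_coordinate_le:
  fixes I :: "nat set"
  assumes "finite I" "k \<in> I" and [measurable]: "f \<in> borel_measurable borel"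
  shows "(\<integral>\<^sup>+x. f (x k) \<partial>(\<Pi>\<^sub>M i\<in>I. M)) \<le> (\<integral>\<^sup>+t. f t \<partial>M)"
proof -
  interpret PiM: prob_space "\<Pi>\<^sub>M i\<in>I. M" by (intro prob_space_PiM) unfold_locales
  note [measurable] = coordinate_measurable[OF assms(2)]
  have "(\<integral>\<^sup>+x. f (x k) \<partial>(\<Pi>\<^sub>M i\<in>I. M)) \<le> (\<integral>\<^sup>+x. (\<integral>\<^sup>+t. f t \<partial>M) \<partial>(\<Pi>\<^sub>M i\<in>I. M))"
    by (rule nn_integral_PiM_step[OF assms(1,2), of "\<lambda>x. f (x k)" "\<lambda>_. \<integral>\<^sup>+t. f t \<partial>M"]) auto
  also have "\<dots> = (\<integral>\<^sup>+t. f t \<partial>M)" using PiM.emeasure_space_1 by simp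
  finally show ?thesis .
qed

lemma Max_measurable:
  fixes n :: nat
  shows "(\<lambda>x. Max ((\<lambda>k. x k ^ 4) ` {1..n})) \<in> borel_measurable (\<Pi>\<^sub>M i\<in>{1..n}. M)"
  by (rule borel_measurable_Max) (auto intro!: borel_measurable_power coordinate_measurable)

text \<open>Truncation at level \<open>T\<close>: a fourth power above \<open>T\<close> is at most
  the power of order 4 (i + 1) divided by \<open>T ^ i\<close>, and the maximum of these is at most
  their sum.\<close>

lemma nn_integral_Max_le:
  assumes n: "1 \<le> n" and T: "0 < T"
    and C: "(\<integral>\<^sup>+t. ennreal (t ^ (4 * (i + 1))) \<partial>M) \<le> ennreal C" "0 \<le> C"
  shows "(\<integral>\<^sup>+x. ennreal (Max ((\<lambda>k. x k ^ 4) ` {1..n})) \<partial>(\<Pi>\<^sub>M i\<in>{1..n}. M))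
    \<le> ennreal (T + real n * C / T ^ i)"
proof -
  interpret PiM: prob_space "\<Pi>\<^sub>M i\<in>{1..n}. M" by (intro prob_space_PiM) unfold_locales
  note [measurable] = coordinate_measurable
  have "(\<integral>\<^sup>+x. ennreal (Max ((\<lambda>k. x k ^ 4) ` {1..n})) \<partial>(\<Pi>\<^sub>M i\<in>{1..n}. M))
      \<le> (\<integral>\<^sup>+x. ennreal T + ennreal (1 / T ^ i) * (\<Sum>k=1..n. ennreal (x k ^ (4 * (i + 1)))) \<partial>(\<Pi>\<^sub>M i\<in>{1..n}. M))"
  proof (intro nn_integral_mono)
    fix x :: "nat \<Rightarrow> real"
    have ev: "0 \<le> y ^ (4 * (i + 1))" for y :: real by (rule zero_le_even_power) simp
    have "x k ^ 4 \<le> T + (\<Sum>k=1..n. x k ^ (4 * (i + 1))) / T ^ i" if k: "k \<in> {1..n}" for k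
    proof (cases "x k ^ 4 \<le> T")
      case True
      then show ?thesis using ev T by (intro add_increasing2) (auto intro!: sum_nonneg divide_nonneg_nonneg)
    next
      case False
      have "x k ^ 4 * T ^ i \<le> x k ^ 4 * (x k ^ 4) ^ i"
        using False T by (intro mult_left_mono power_mono) auto
      also have "\<dots> = x k ^ (4 * (i + 1))" by (simp add: power_mult[symmetric] power_add[symmetric] add.commute)
      also have "\<dots> \<le> (\<Sum>k=1..n. x k ^ (4 * (i + 1)))"
        using k ev by (intro member_le_sum[where f="\<lambda>k. x k ^ (4 * (i + 1))"]) auto
      finally have "x k ^ 4 \<le> (\<Sum>k=1..n. x k ^ (4 * (i + 1))) / T ^ i"
        using T by (simp add: field_simps)
      then show ?thesis using T by simp
    qed
    then have "Max ((\<lambda>k. x k ^ 4) ` {1..n}) \<le> T + (\<Sum>k=1..n. x k ^ (4 * (i + 1))) / T ^ i"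
      using n by (subst Max_le_iff) auto
    then have "ennreal (Max ((\<lambda>k. x k ^ 4) ` {1..n})) \<le> ennreal (T + (1 / T ^ i) * (\<Sum>k=1..n. x k ^ (4 * (i + 1))))"
      by (intro ennreal_leI) simp
    also have "\<dots> = ennreal T + ennreal (1 / T ^ i) * ennreal (\<Sum>k=1..n. x k ^ (4 * (i + 1)))"
    proof -
      have "0 \<le> 1 / T ^ i" "0 \<le> (\<Sum>k=1..n. x k ^ (4 * (i + 1)))"
        using T ev by (auto intro!: sum_nonneg)
      then show ?thesis using T by (simp only: ennreal_plus ennreal_mult mult_nonneg_nonneg less_imp_le)
    qed
    also have "ennreal (\<Sum>k=1..n. x k ^ (4 * (i + 1))) = (\<Sum>k=1..n. ennreal (x k ^ (4 * (i + 1))))"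
      using ev by (intro sum_ennreal[symmetric]) auto
    finally show "ennreal (Max ((\<lambda>k. x k ^ 4) ` {1..n}))
      \<le> ennreal T + ennreal (1 / T ^ i) * (\<Sum>k=1..n. ennreal (x k ^ (4 * (i + 1))))" .
  qed
  also have "\<dots> = ennreal T + ennreal (1 / T ^ i) * (\<Sum>k=1..n. \<integral>\<^sup>+x. ennreal (x k ^ (4 * (i + 1))) \<partial>(\<Pi>\<^sub>M i\<in>{1..n}. M))"
    using PiM.emeasure_space_1
    by (subst nn_integral_add) (auto simp: nn_integral_cmult nn_integral_sum)
  also have "\<dots> \<le> ennreal T + ennreal (1 / T ^ i) * (\<Sum>k=1..n. ennreal C)"
    by (intro add_mono mult_left_mono sum_mono order_trans[OF nn_integral_coordinate_le C(1)]) auto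
  also have "(\<Sum>k=1..n. ennreal C) = ennreal (real n * C)"
    using C(2) by (simp add: ennreal_mult ennreal_of_nat_eq_real_of_nat)
  also have "ennreal T + ennreal (1 / T ^ i) * ennreal (real n * C) = ennreal (T + real n * C / T ^ i)"
    using T C(2) by (simp flip: ennreal_plus ennreal_mult)
  finally show ?thesis .
qed

lemma
  assumes moments: "\<And>i. \<exists>C\<ge>0. (\<integral>\<^sup>+t. ennreal (t ^ (4 * (i + 1))) \<partial>M) \<le> ennreal C"
  shows nn_integral_Max_eq: "1 \<le> n \<Longrightarrow>
      (\<integral>\<^sup>+x. ennreal (Max ((\<lambda>k. x k ^ 4) ` {1..n})) \<partial>(\<Pi>\<^sub>M i\<in>{1..n}. M)) = ennreal (max_moment n)"
    and subpolynomial_max_moment: "subpolynomial max_moment"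
proof -
  have fin: "(\<integral>\<^sup>+x. ennreal (Max ((\<lambda>k. x k ^ 4) ` {1..n})) \<partial>(\<Pi>\<^sub>M i\<in>{1..n}. M)) = ennreal (max_moment n)"
    if n: "1 \<le> n" for n
  proof -
    from moments[of 0] obtain C where C: "0 \<le> C" "(\<integral>\<^sup>+t. ennreal (t ^ (4 * (0 + 1))) \<partial>M) \<le> ennreal C" by auto
    have "(\<integral>\<^sup>+x. ennreal (Max ((\<lambda>k. x k ^ 4) ` {1..n})) \<partial>(\<Pi>\<^sub>M i\<in>{1..n}. M)) < \<top>"
      using nn_integral_Max_le[OF n zero_less_one C(2,1)] le_less_trans ennreal_less_top by blast
    then show ?thesis by (simp add: max_moment_def)
  qed
  show "1 \<le> n \<Longrightarrow>
      (\<integral>\<^sup>+x. ennreal (Max ((\<lambda>k. x k ^ 4) ` {1..n})) \<partial>(\<Pi>\<^sub>M i\<in>{1..n}. M)) = ennreal (max_moment n)"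
    by (rule fin)
  show "subpolynomial max_moment"
  proof (rule subpolynomial_of_powr_bound)
    fix c :: real assume c: "0 < c"
    \<comment> \<open>With \<open>T = n powr c\<close> this choice gives
      \<open>n \<le> T ^ i\<close>, so the factor n from the sum over the coordinates is
      cancelled.\<close>
    obtain i :: nat where i: "1 / c \<le> real i" using real_arch_simple by blast
    from moments[of i] obtain C where C: "0 \<le> C" "(\<integral>\<^sup>+t. ennreal (t ^ (4 * (i + 1))) \<partial>M) \<le> ennreal C" by auto
    have "\<bar>max_moment n\<bar> \<le> (1 + C) * real n powr c" if n: "1 \<le> n" for n
    proof -
      have T: "0 < real n powr c" using n by simp
      have "ennreal (max_moment n) \<le> ennreal (real n powr c + real n * C / (real n powr c) ^ i)"
        unfolding fin[OF n, symmetric] by (rule nn_integral_Max_le[OF n T C(2,1)])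
      then have "max_moment n \<le> real n powr c + real n * C / (real n powr c) ^ i"
        using C by (subst (asm) ennreal_le_iff) auto
      also have "\<dots> \<le> real n powr c + C * real n powr c"
      proof -
        have "1 \<le> c * real i" using i c by (simp add: field_simps)
        then have "real n powr 1 \<le> real n powr (c * real i)" using n by (intro powr_mono) auto
        also have "\<dots> = (real n powr c) ^ i" using n by (simp add: powr_powr[symmetric] powr_realpow)
        finally have "real n * C / (real n powr c) ^ i \<le> (real n powr c) ^ i * C / (real n powr c) ^ i"
          using C n by (intro divide_right_mono mult_right_mono) auto
        also have "\<dots> = C * 1" using T by simp
        also have "\<dots> \<le> C * real n powr c" using C n c by (intro mult_left_mono ge_one_powr_ge_zero) auto
        finally show ?thesis by simp
      qed
      finally show ?thesis by (simp add: max_moment_def algebra_simps)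
    qed
    then show "\<exists>C. \<forall>\<^sub>F n in sequentially. \<bar>max_moment n\<bar> \<le> C * real n powr c"
      unfolding eventually_sequentially by blast
  qed
qed

end

section \<open>From the class of densities to standardized noise\<close>

lemma noise_densities_moment_le:
  assumes p: "p \<in> noise_densities s" and s: "1 \<le> s" and k: "1 \<le> k"
  shows "(\<integral>\<^sup>+x. ennreal (x ^ (2 * k)) \<partial>density lborel (\<lambda>x. ennreal (p x)))
    \<le> ennreal (s ^ k * (\<Prod>i=1..k. 2 * real i - 1))"
proof -
  define c where "c = s ^ k * (\<Prod>i=1..k. 2 * real i - 1)"
  have c: "0 < c" unfolding c_def using s by (intro mult_pos_pos prod_pos) auto
  have [measurable]: "p \<in> borel_measurable borel" and p0: "0 \<le> p x" for x
    using p by (auto simp: noise_densities_def)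
  define A where "A = (\<integral>\<^sup>+x. ennreal (\<bar>x\<bar> ^ (2 * k) * p x) \<partial>lborel)"
  have "(SUP k\<in>{1::nat..}. (\<integral>\<^sup>+x. ennreal (\<bar>x\<bar> ^ (2 * k) * p x) \<partial>lborel)
            / ennreal (s ^ k * (\<Prod>i=1..k. 2 * real i - 1))) \<le> 1"
    using p by (simp add: noise_densities_def)
  then have "A / ennreal c \<le> 1"
    using k unfolding A_def c_def by (subst (asm) SUP_le_iff) auto
  then have "ennreal c * (A / ennreal c) \<le> ennreal c * 1" by (intro mult_left_mono) auto
  also have "ennreal c * (A / ennreal c) = A"
    using c by (simp add: ennreal_times_divide mult_divide_eq_ennreal mult.commute)
  finally have "A \<le> ennreal c" by simp
  moreover have "(\<integral>\<^sup>+x. ennreal (x ^ (2 * k)) \<partial>density lborel (\<lambda>x. ennreal (p x))) = A"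
    unfolding A_def
    by (subst nn_integral_density) (auto simp: p0 power_even_abs mult.commute zero_le_even_power ennreal_mult intro!: nn_integral_cong)
  ultimately show ?thesis by (simp add: c_def)
qed

lemma standardized_noise_of_density:
  assumes p: "p \<in> noise_densities s" and s: "1 \<le> s"
  shows "\<exists>m4. standardized_noise (density lborel (\<lambda>x. ennreal (p x))) m4"
    and "\<exists>C\<ge>0. (\<integral>\<^sup>+t. ennreal (t ^ (4 * (i + 1))) \<partial>density lborel (\<lambda>x. ennreal (p x))) \<le> ennreal C"
proof -
  let ?M = "density lborel (\<lambda>x. ennreal (p x))"
  have [measurable]: "p \<in> borel_measurable borel" and p0: "0 \<le> p x" for x
    using p by (auto simp: noise_densities_def)
  have bd: "\<exists>C\<ge>0. (\<integral>\<^sup>+t. ennreal (t ^ (4 * (i + 1))) \<partial>?M) \<le> ennreal C" for i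
  proof -
    have "0 \<le> s ^ (2 * (i + 1)) * (\<Prod>i=1..2 * (i + 1). 2 * real i - 1)"
      using s by (intro mult_nonneg_nonneg prod_nonneg) auto
    moreover have "4 * (i + 1) = 2 * (2 * (i + 1))" by simp
    then have "(\<integral>\<^sup>+t. ennreal (t ^ (4 * (i + 1))) \<partial>?M)
        \<le> ennreal (s ^ (2 * (i + 1)) * (\<Prod>i=1..2 * (i + 1). 2 * real i - 1))"
      by (simp only:) (rule noise_densities_moment_le[OF p s], simp)
    ultimately show ?thesis by blast
  qed
  then show "\<exists>C\<ge>0. (\<integral>\<^sup>+t. ennreal (t ^ (4 * (i + 1))) \<partial>?M) \<le> ennreal C" .
  have 1: "has_bochner_integral ?M (\<lambda>t. t) 0" "has_bochner_integral ?M (\<lambda>t. t\<^sup>2) 1"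
    using p by (auto simp: noise_densities_def mult.commute intro!: has_bochner_integral_density)
  have "emeasure ?M (space ?M) = 1"
    using p by (simp add: noise_densities_def emeasure_density)
  then have ps: "prob_space ?M" by (rule prob_spaceI)
  obtain C where "(\<integral>\<^sup>+t. ennreal (t ^ 4) \<partial>?M) \<le> ennreal C" using bd[of 0] by auto
  then have "(\<integral>\<^sup>+t. ennreal (norm (t ^ 4)) \<partial>?M) < \<infinity>"
    by (simp add: power_abs power_even_abs le_less_trans[OF _ ennreal_less_top])
  then have "integrable ?M (\<lambda>t. t ^ 4)" by (intro integrableI_bounded) auto
  then have "has_bochner_integral ?M (\<lambda>t. t ^ 4) (integral\<^sup>L ?M (\<lambda>t. t ^ 4))"
    by (rule has_bochner_integral_integrable)
  with 1 ps show "\<exists>m4. standardized_noise ?M m4"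
    by (intro exI[of _ "integral\<^sup>L ?M (\<lambda>t. t ^ 4)"])
      (auto simp: standardized_noise_def standardized_noise_axioms_def)
qed

section \<open>The remainder of the oracle inequality\<close>

text \<open>A quotient by 0 is 0 and bounds nothing, so a vanishing denominator must come with a
  vanishing numerator.\<close>

lemma square_le_of_quotient_le:
  fixes A B X :: real
  assumes "A\<^sup>2 / B \<le> X" "0 \<le> B" "B = 0 \<Longrightarrow> A = 0"
  shows "A\<^sup>2 \<le> X * B"
  using assms by (cases "B = 0") (auto simp: field_simps)

lemma nn_integral_square_quotient_le:
  fixes A :: "'a \<Rightarrow> real"
  assumes [measurable]: "A \<in> borel_measurable N"
    and le: "(\<integral>\<^sup>+x. ennreal ((A x)\<^sup>2) \<partial>N) \<le> ennreal (c * B)" and B: "0 \<le> B" and c: "0 \<le> c"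
  shows "(\<integral>\<^sup>+x. ennreal ((A x)\<^sup>2 / B) \<partial>N) \<le> ennreal c"
proof (cases "B = 0")
  case False
  then have B: "0 < B" using B by simp
  have "(\<integral>\<^sup>+x. ennreal ((A x)\<^sup>2 / B) \<partial>N) = (\<integral>\<^sup>+x. ennreal (1 / B) * ennreal ((A x)\<^sup>2) \<partial>N)"
    using B by (intro nn_integral_cong) (simp flip: ennreal_mult)
  also have "\<dots> = ennreal (1 / B) * (\<integral>\<^sup>+x. ennreal ((A x)\<^sup>2) \<partial>N)"
    by (rule nn_integral_cmult) measurable
  also have "\<dots> \<le> ennreal (1 / B) * ennreal (c * B)" by (intro mult_left_mono le) auto
  also have "\<dots> = ennreal c" using B c by (simp flip: ennreal_mult)
  finally show ?thesis .
qed simp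

text \<open>The bound is invariant: multiplied by \<open>1 - \<epsilon>\<close> and increased by
  \<open>M\<close>, it does not grow. It depends on neither \<open>S\<close> nor
  \<open>n\<close>.\<close>

lemma ar_seq_bound:
  fixes xi :: "nat \<Rightarrow> real"
  assumes S: "\<And>k. k \<in> {1..n} \<Longrightarrow> \<bar>S (grid a b n k)\<bar> \<le> 1 - \<epsilon>" and \<epsilon>: "0 < \<epsilon>" "\<epsilon> < 1"
    and xi: "\<And>k. k \<in> {1..n} \<Longrightarrow> \<bar>xi k\<bar> \<le> M" and M: "0 \<le> M" and j: "j \<le> n"
  shows "\<bar>ar_seq a b y0 n S xi j\<bar> \<le> \<bar>y0\<bar> + M / \<epsilon>"
  using j
proof (induction j)
  case 0
  then show ?case using M \<epsilon> by simp
next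
  case (Suc j)
  let ?m = "\<bar>y0\<bar> + M / \<epsilon>"
  have "\<bar>ar_seq a b y0 n S xi (Suc j)\<bar> \<le> \<bar>S (grid a b n (Suc j))\<bar> * \<bar>ar_seq a b y0 n S xi j\<bar> + \<bar>xi (Suc j)\<bar>"
    by (simp add: abs_triangle_ineq[THEN order_trans] abs_mult)
  also have "\<dots> \<le> (1 - \<epsilon>) * ?m + M"
    using Suc S[of "Suc j"] xi[of "Suc j"] \<epsilon> by (intro add_mono mult_mono) auto
  also have "\<dots> = ?m - \<epsilon> * \<bar>y0\<bar>" using \<epsilon> by (simp add: field_simps)
  also have "\<dots> \<le> ?m" using \<epsilon> by simp
  finally show ?case .
qed

section \<open>Linear and quadratic forms in the noise of the experiment\<close>

locale ar_experiment = admissible_ar_procedure a b \<mu>0 n \<phi> + standardized_noise M m4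
  for a b \<mu>0 :: real and n :: nat and \<phi> :: "nat \<Rightarrow> real \<Rightarrow> real" and M :: "real measure" and m4 :: real +
  fixes S :: "real \<Rightarrow> real" and \<epsilon> L y0 g :: real and \<Lambda> :: "(nat \<Rightarrow> real) set"
  assumes orth: orthonormal_system
    and \<epsilon>: "0 < \<epsilon>" "\<epsilon> < 1" and L: "0 \<le> L"
    and S_le: "\<And>x. x \<in> {a..b} \<Longrightarrow> \<bar>S x\<bar> \<le> 1 - \<epsilon>"
    and lip: "\<And>x x'. x \<in> {a..b} \<Longrightarrow> x' \<in> {a..b} \<Longrightarrow> \<bar>S x - S x'\<bar> \<le> L * \<bar>x - x'\<bar>"
    and g: "0 < g" and gap_ge_g: "\<And>l. l \<in> {1..d} \<Longrightarrow> g * sqrt (real n) \<le> gap l"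
    and \<Lambda>: "finite \<Lambda>" "\<Lambda> \<subseteq> weight_vectors"
    and moments: "\<And>i. \<exists>C\<ge>0. (\<integral>\<^sup>+t. ennreal (t ^ (4 * (i + 1))) \<partial>M) \<le> ennreal C"
begin

abbreviation noise :: "(nat \<Rightarrow> real) measure" where "noise \<equiv> \<Pi>\<^sub>M i\<in>{1..n}. M"

definition obs :: "(nat \<Rightarrow> real) \<Rightarrow> nat \<Rightarrow> real" where "obs = observation a b y0 n S"

definition V :: real where "V = 2 / (g * sqrt (real n))"

lemma n_pos: "0 < real n"
  using n_ge by simp

lemma obs_eq: "k \<le> n \<Longrightarrow> obs x k = ar_seq a b y0 n S x k"
  by (simp add: obs_def observation_def)

lemma obs_measurable [measurable]: "(\<lambda>x. obs x k) \<in> borel_measurable noise"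
proof (cases "k \<le> n")
  case True
  then have "(\<lambda>x. ar_seq a b y0 n S x k) \<in> borel_measurable noise"
    by (induction k) (auto intro!: borel_measurable_add borel_measurable_times coordinate_measurable)
  then show ?thesis using True by (simp add: obs_eq)
qed (simp add: obs_def observation_def)

lemma obs_past: "i < k \<Longrightarrow> obs (x(k := t)) i = obs x i"
proof -
  have "i < k \<Longrightarrow> ar_seq a b y0 n S (x(k := t)) i = ar_seq a b y0 n S x i"
    by (induction i) auto
  then show "i < k \<Longrightarrow> obs (x(k := t)) i = obs x i" by (simp add: obs_def observation_def)
qed

lemma H_ge_g: "l \<in> {1..d} \<Longrightarrow> g * sqrt (real n) / 2 \<le> H l y"
  using H_ge[of l y] gap_ge_g[of l] by simp

lemma V_nonneg: "0 \<le> V"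
  using g by (simp add: V_def)

text \<open>Indices outside all blocks, such as those of the pilot segments, receive the dummy owner
  1; there every weight vanishes.\<close>

definition owner :: "nat \<Rightarrow> nat" where
  "owner k = (if \<exists>l. l \<in> {1..d} \<and> \<iota> l < k \<and> k \<le> k2 l then SOME l. l \<in> {1..d} \<and> \<iota> l < k \<and> k \<le> k2 l else 1)"

lemma owner_block:
  assumes "\<exists>l. l \<in> {1..d} \<and> \<iota> l < k \<and> k \<le> k2 l"
  shows "owner k \<in> {1..d} \<and> \<iota> (owner k) < k \<and> k \<le> k2 (owner k)"
proof -
  have "owner k = (SOME l. l \<in> {1..d} \<and> \<iota> l < k \<and> k \<le> k2 l)"
    unfolding owner_def using assms by (rule if_P)
  then show ?thesis using someI_ex[OF assms] by (simp only:)
qed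

lemma owner_in: "owner k \<in> {1..d}"
proof (cases "\<exists>l. l \<in> {1..d} \<and> \<iota> l < k \<and> k \<le> k2 l")
  case True
  then show ?thesis using owner_block by blast
next
  case False
  then have "owner k = 1" unfolding owner_def by (rule if_not_P)
  then show ?thesis using d_pos by simp
qed

lemma owner_unique:
  assumes "l \<in> {1..d}" "\<iota> l < k" "k \<le> k2 l"
  shows "owner k = l"
proof -
  have "\<iota> (owner k) < k" "k \<le> k2 (owner k)" using owner_block assms by blast+
  then show ?thesis
    using blocks_disjoint[of l "owner k"] blocks_disjoint[of "owner k" l] assms
    by (cases l "owner k" rule: linorder_cases) auto
qed

sublocale weights: predictable_weights M m4 n "{1..d}" owner "\<lambda>l k x. u l k (obs x)" V
proof
  show "u l k (obs x) = 0" if "l \<in> {1..d}" "k \<in> {1..n}" "l \<noteq> owner k" for l k x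
    using that owner_unique[of l k] u_outside[of l k] by blast
  show "u l k (obs (x(j := t))) = u l k (obs x)" if "l \<in> {1..d}" "k \<in> {1..n}" "k \<le> j" for l k j x t
    using that by (intro u_cong obs_past) auto
  show "(\<lambda>x. u l k (obs x)) \<in> borel_measurable noise" for l k
    by (rule u_measurable) measurable
  show "(\<Sum>k=1..n. (u l k (obs x))\<^sup>2) \<le> V" if "l \<in> {1..d}" for l x
  proof -
    have "1 / H l (obs x) \<le> 1 / (g * sqrt (real n) / 2)"
      using H_ge_g[OF that] g n_pos by (intro divide_left_mono) (auto intro!: mult_pos_pos H_pos that)
    then show ?thesis by (simp add: sum_u_square[OF that] V_def)
  qed
qed (simp_all only: owner_in finite_atLeastAtMost)

definition noise_term :: "(nat \<Rightarrow> real) \<Rightarrow> nat \<Rightarrow> real" where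
  "noise_term x l = weights.mart l n x"

definition \<theta> :: "nat \<Rightarrow> real" where "\<theta> = coef (\<lambda>l. S (z l))"

definition U :: "(nat \<Rightarrow> real) \<Rightarrow> (nat \<Rightarrow> real) \<Rightarrow> real" where
  "U v x = (\<Sum>j=1..d. v j * ((coef (noise_term x) j)\<^sup>2 - mesh * s j (obs x)))"

definition N :: "(nat \<Rightarrow> real) \<Rightarrow> (nat \<Rightarrow> real) \<Rightarrow> real" where
  "N v x = (\<Sum>j=1..d. v j * \<theta> j * coef (noise_term x) j)"

lemma noise_term_measurable [measurable]:
  "l \<in> {1..d} \<Longrightarrow> (\<lambda>x. noise_term x l) \<in> borel_measurable noise"
  unfolding noise_term_def by (rule weights.mart_measurable) auto

lemma orth_mesh: "i \<in> {1..d} \<Longrightarrow> j \<in> {1..d} \<Longrightarrow>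
    mesh * (\<Sum>l\<in>{1..d}. \<phi> i (z l) * \<phi> j (z l)) = of_bool (i = j)"
  using orth unfolding orthonormal_system_def mesh_def by blast

lemma N_eq: "N v x = mesh * (\<Sum>l=1..d. (\<Sum>j=1..d. (v j * \<theta> j) * \<phi> j (z l)) * noise_term x l)"
proof -
  have "N v x = (\<Sum>j=1..d. \<Sum>l=1..d. mesh * ((v j * \<theta> j) * \<phi> j (z l) * noise_term x l))"
    by (simp add: N_def coef_def sum_distrib_left mult_ac)
  also have "\<dots> = (\<Sum>l=1..d. \<Sum>j=1..d. mesh * ((v j * \<theta> j) * \<phi> j (z l) * noise_term x l))"
    by (rule sum.swap)
  finally show ?thesis by (simp add: sum_distrib_left sum_distrib_right)
qed

lemma N_measurable [measurable]: "N v \<in> borel_measurable noise"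
  unfolding N_eq by measurable

lemma nn_integral_N_le:
  "(\<integral>\<^sup>+x. ennreal ((N v x)\<^sup>2) \<partial>noise) \<le> ennreal (mesh * V * (\<Sum>j=1..d. (v j * \<theta> j)\<^sup>2))"
proof -
  define c where "c l = mesh * (\<Sum>j=1..d. (v j * \<theta> j) * \<phi> j (z l))" for l
  have "N v x = (\<Sum>l=1..d. c l * weights.mart l n x)" for x
    unfolding N_eq c_def noise_term_def by (subst sum_distrib_left) (simp only: mult.assoc)
  moreover have "V * (\<Sum>l=1..d. (c l)\<^sup>2) = mesh * V * (\<Sum>j=1..d. (v j * \<theta> j)\<^sup>2)"
  proof -
    have "V * (\<Sum>l=1..d. (c l)\<^sup>2) = mesh * V * (mesh * (\<Sum>l\<in>{1..d}. (\<Sum>j\<in>{1..d}. (v j * \<theta> j) * \<phi> j (z l))\<^sup>2))"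
      by (simp add: c_def power_mult_distrib power2_eq_square sum_distrib_left mult_ac)
    also have "mesh * (\<Sum>l\<in>{1..d}. (\<Sum>j\<in>{1..d}. (v j * \<theta> j) * \<phi> j (z l))\<^sup>2) = (\<Sum>j=1..d. (v j * \<theta> j)\<^sup>2)"
      by (rule orthonormal_norm_combination[OF _ orth_mesh]) auto
    finally show ?thesis .
  qed
  ultimately show ?thesis using weights.nn_integral_linear_mart_le[of c] by (simp only:)
qed

text \<open>\<open>s j\<close> averages the \<open>1 / H l\<close>, which by
  \<open>sum_u_square\<close> are the totals of the squared weights at every sample point.
  Subtracting \<open>mesh * s j\<close> is therefore exactly the compensator of the form with kernel
  \<open>W\<close>; an upper bound for the variance would leave it uncentred.\<close>

lemma U_eq:
  fixes v :: "nat \<Rightarrow> real"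
  defines "W \<equiv> \<lambda>l m. \<Sum>j=1..d. v j * (\<phi> j (z l) * \<phi> j (z m))"
  shows "U v x = mesh\<^sup>2 * ((\<Sum>l\<in>{1..d}. noise_term x l * (\<Sum>m\<in>{1..d}. W l m * noise_term x m))
        - (\<Sum>l\<in>{1..d}. W l l * (\<Sum>k=1..n. (u l k (obs x))\<^sup>2)))"
proof -
  have 1: "(\<Sum>j=1..d. v j * (coef (noise_term x) j)\<^sup>2)
      = mesh\<^sup>2 * (\<Sum>l=1..d. noise_term x l * (\<Sum>m=1..d. W l m * noise_term x m))"
  proof -
    have "(\<Sum>j=1..d. v j * (coef (noise_term x) j)\<^sup>2)
        = (\<Sum>j=1..d. \<Sum>l=1..d. \<Sum>m=1..d. mesh\<^sup>2 * (noise_term x l * (v j * (\<phi> j (z l) * \<phi> j (z m)) * noise_term x m)))"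
      by (simp add: coef_def power2_eq_square sum_product sum_distrib_left mult_ac)
    also have "\<dots> = (\<Sum>l=1..d. \<Sum>j=1..d. \<Sum>m=1..d. mesh\<^sup>2 * (noise_term x l * (v j * (\<phi> j (z l) * \<phi> j (z m)) * noise_term x m)))"
      by (rule sum.swap)
    also have "\<dots> = (\<Sum>l=1..d. \<Sum>m=1..d. \<Sum>j=1..d. mesh\<^sup>2 * (noise_term x l * (v j * (\<phi> j (z l) * \<phi> j (z m)) * noise_term x m)))"
      by (intro sum.cong refl sum.swap)
    finally show ?thesis by (simp add: W_def sum_distrib_left sum_distrib_right)
  qed
  have 2: "(\<Sum>j=1..d. v j * (mesh * s j (obs x)))
      = mesh\<^sup>2 * (\<Sum>l=1..d. W l l * (\<Sum>k=1..n. (u l k (obs x))\<^sup>2))"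
  proof -
    have "(\<Sum>j=1..d. v j * (mesh * s j (obs x)))
        = (\<Sum>j=1..d. \<Sum>l=1..d. mesh\<^sup>2 * (v j * (\<phi> j (z l) * \<phi> j (z l)) * (1 / H l (obs x))))"
      unfolding s_def mesh_def[symmetric] sum_distrib_left
      by (intro sum.cong refl) (simp add: \<sigma>_square power2_eq_square[of mesh] power2_eq_square[of "\<phi> _ _"])
    also have "\<dots> = (\<Sum>l=1..d. \<Sum>j=1..d. mesh\<^sup>2 * (v j * (\<phi> j (z l) * \<phi> j (z l)) * (1 / H l (obs x))))"
      by (rule sum.swap)
    also have "\<dots> = mesh\<^sup>2 * (\<Sum>l=1..d. W l l * (1 / H l (obs x)))"
      by (simp add: W_def sum_distrib_left sum_distrib_right sum_divide_distrib)
    also have "(\<Sum>l=1..d. W l l * (1 / H l (obs x))) = (\<Sum>l=1..d. W l l * (\<Sum>k=1..n. (u l k (obs x))\<^sup>2))"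
      by (intro sum.cong refl) (simp add: sum_u_square)
    finally show ?thesis .
  qed
  have "U v x = (\<Sum>j=1..d. v j * (coef (noise_term x) j)\<^sup>2) - (\<Sum>j=1..d. v j * (mesh * s j (obs x)))"
    by (simp add: U_def right_diff_distrib sum_subtractf)
  then show ?thesis unfolding 1 2 by (simp add: right_diff_distrib)
qed

lemma U_measurable [measurable]: "U v \<in> borel_measurable noise"
proof -
  have [measurable]: "(\<lambda>x. u l k (obs x)) \<in> borel_measurable noise" for l k
    by (rule u_measurable) measurable
  show ?thesis unfolding U_eq by measurable
qed

lemma nn_integral_U_le:
  "(\<integral>\<^sup>+x. ennreal ((U v x)\<^sup>2) \<partial>noise) \<le> ennreal (mesh\<^sup>2 * (8 + 2 * m4) * V\<^sup>2 * (\<Sum>j=1..d. (v j)\<^sup>2))"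
proof -
  define W where "W l m = (\<Sum>j=1..d. v j * (\<phi> j (z l) * \<phi> j (z m)))" for l m
  define q where "q x = (\<Sum>l\<in>{1..d}. weights.mart l n x * (\<Sum>m\<in>{1..d}. W l m * weights.mart m n x))
        - (\<Sum>l\<in>{1..d}. W l l * (\<Sum>k=1..n. (u l k (obs x))\<^sup>2))" for x
  have U: "U v x = mesh\<^sup>2 * q x" for x
    by (simp add: U_eq q_def W_def noise_term_def)
  \<comment> \<open>Parseval in the second argument of \<open>W\<close>, then normalisation of
    \<open>\<phi> j\<close> in the first.\<close>
  have W: "mesh\<^sup>2 * (\<Sum>l\<in>{1..d}. \<Sum>m\<in>{1..d}. (W l m)\<^sup>2) = (\<Sum>j=1..d. (v j)\<^sup>2)"
  proof -
    have "mesh * (\<Sum>m\<in>{1..d}. (W l m)\<^sup>2) = (\<Sum>j\<in>{1..d}. (v j * \<phi> j (z l))\<^sup>2)" for l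
      using orthonormal_norm_combination[OF _ orth_mesh, of "{1..d}" "\<lambda>j. v j * \<phi> j (z l)"]
      by (simp add: W_def mult.assoc)
    note norm_W = this
    have "mesh\<^sup>2 * (\<Sum>l\<in>{1..d}. \<Sum>m\<in>{1..d}. (W l m)\<^sup>2) = mesh * (\<Sum>l\<in>{1..d}. mesh * (\<Sum>m\<in>{1..d}. (W l m)\<^sup>2))"
      by (simp only: power2_eq_square[of mesh] sum_distrib_left[of mesh, symmetric] mult.assoc)
    also have "\<dots> = mesh * (\<Sum>l\<in>{1..d}. \<Sum>j\<in>{1..d}. (v j * \<phi> j (z l))\<^sup>2)"
      by (simp only: norm_W)
    also have "(\<Sum>l\<in>{1..d}. \<Sum>j\<in>{1..d}. (v j * \<phi> j (z l))\<^sup>2) = (\<Sum>j\<in>{1..d}. \<Sum>l\<in>{1..d}. (v j * \<phi> j (z l))\<^sup>2)"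
      by (rule sum.swap)
    also have "mesh * \<dots> = (\<Sum>j\<in>{1..d}. (v j)\<^sup>2 * (mesh * (\<Sum>l\<in>{1..d}. \<phi> j (z l) * \<phi> j (z l))))"
      by (simp add: power_mult_distrib power2_eq_square sum_distrib_left mult_ac)
    also have "\<dots> = (\<Sum>j=1..d. (v j)\<^sup>2)"
      by (intro sum.cong refl) (simp only: orth_mesh, simp)
    finally show ?thesis .
  qed
  have [measurable]: "(\<lambda>x. u l k (obs x)) \<in> borel_measurable noise" for l k
    by (rule u_measurable) measurable
  have [measurable]: "q \<in> borel_measurable noise"
    unfolding q_def noise_term_def[symmetric] by measurable
  have sym: "W l m = W m l" for l m by (simp add: W_def mult_ac)
  have "(\<integral>\<^sup>+x. ennreal ((U v x)\<^sup>2) \<partial>noise) = (\<integral>\<^sup>+x. ennreal ((mesh\<^sup>2)\<^sup>2) * ennreal ((q x)\<^sup>2) \<partial>noise)"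
    by (intro nn_integral_cong) (simp add: U power_mult_distrib ennreal_mult)
  also have "\<dots> = ennreal ((mesh\<^sup>2)\<^sup>2) * (\<integral>\<^sup>+x. ennreal ((q x)\<^sup>2) \<partial>noise)"
    by (rule nn_integral_cmult) measurable
  also have "\<dots> \<le> ennreal ((mesh\<^sup>2)\<^sup>2) * ennreal ((8 + 2 * m4) * V\<^sup>2 * (\<Sum>l\<in>{1..d}. \<Sum>m\<in>{1..d}. (W l m)\<^sup>2))"
    unfolding q_def using sym by (intro mult_left_mono weights.nn_integral_quadratic_mart_le) auto
  also have "\<dots> = ennreal ((mesh\<^sup>2)\<^sup>2 * ((8 + 2 * m4) * V\<^sup>2 * (\<Sum>l\<in>{1..d}. \<Sum>m\<in>{1..d}. (W l m)\<^sup>2)))"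
    using m4_nonneg by (intro ennreal_mult[symmetric]) (auto intro!: sum_nonneg mult_nonneg_nonneg)
  also have "(mesh\<^sup>2)\<^sup>2 * ((8 + 2 * m4) * V\<^sup>2 * (\<Sum>l\<in>{1..d}. \<Sum>m\<in>{1..d}. (W l m)\<^sup>2))
      = mesh\<^sup>2 * (8 + 2 * m4) * V\<^sup>2 * (mesh\<^sup>2 * (\<Sum>l\<in>{1..d}. \<Sum>m\<in>{1..d}. (W l m)\<^sup>2))"
    by (simp add: power2_eq_square mult_ac)
  finally show ?thesis unfolding W .
qed

end

lemma affine_quotient:
  fixes P T' y t e m :: real
  assumes "e \<noteq> 0" "m \<noteq> 0"
  shows "P * (r + T' * (y + t / e)) / m = P * (r + T' * (y + 0 / e)) / m + P * T' / (e * m) * t"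
  using assms by (simp add: field_simps)

section \<open>The normalised remainder and its expectation\<close>

context ar_experiment
begin

text \<open>A deterministic lower bound for every \<open>mesh * s j\<close>, namely
  \<open>mesh\<close> divided by the upper bound of \<open>H_le\<close>. It replaces the random
  penalty in the denominators of the remainder.\<close>

definition pen_const :: real where "pen_const = (b - a) / (real n * (2 + ln (real n)))"

lemma ln_n_nonneg: "0 \<le> ln (real n)"
  using n_ge by simp

lemma two_plus_ln_pos: "0 < 2 + ln (real n)"
  using ln_n_nonneg by linarith

lemma pen_const_pos: "0 < pen_const"
  using ab n_pos two_plus_ln_pos by (simp add: pen_const_def)

lemma pen_const_le: "j \<in> {1..d} \<Longrightarrow> pen_const \<le> mesh * s j y"
proof -
  assume j: "j \<in> {1..d}"
  have K: "0 < (2 + ln (real n)) * (real n / real d)"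
    using n_pos d_pos two_plus_ln_pos by (intro mult_pos_pos) auto
  have one: "mesh * (\<Sum>l=1..d. (\<phi> j (z l))\<^sup>2) = 1"
    using orth_mesh[OF j j] by (simp add: power2_eq_square)
  have "pen_const = mesh * (1 / ((2 + ln (real n)) * (real n / real d)) * (mesh * (\<Sum>l=1..d. (\<phi> j (z l))\<^sup>2)))"
    unfolding one using d_pos by (simp add: pen_const_def mesh_def)
  also have "1 / ((2 + ln (real n)) * (real n / real d)) * (mesh * (\<Sum>l=1..d. (\<phi> j (z l))\<^sup>2))
      = mesh * (\<Sum>l=1..d. 1 / ((2 + ln (real n)) * (real n / real d)) * (\<phi> j (z l))\<^sup>2)"
    by (simp add: sum_distrib_left mult_ac)
  also have "\<dots> \<le> mesh * (\<Sum>l=1..d. (\<sigma> l y)\<^sup>2 * (\<phi> j (z l))\<^sup>2)"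
  proof (intro mult_left_mono sum_mono mult_right_mono)
    fix l assume l: "l \<in> {1..d}"
    show "1 / ((2 + ln (real n)) * (real n / real d)) \<le> (\<sigma> l y)\<^sup>2"
      unfolding \<sigma>_square[OF l]
      by (rule divide_left_mono[OF H_le[OF l] _ mult_pos_pos[OF K H_pos[OF l]]]) simp
  qed (use mesh_pos in auto)
  also have "mesh * (\<Sum>l=1..d. (\<sigma> l y)\<^sup>2 * (\<phi> j (z l))\<^sup>2) = s j y"
    by (simp add: s_def mesh_def)
  finally show ?thesis using mesh_pos by (simp add: mult_left_mono)
qed

definition sq_norm :: "(nat \<Rightarrow> real) \<Rightarrow> real" where "sq_norm v = (\<Sum>j=1..d. (v j)\<^sup>2)"

lemma sq_norm_nonneg: "0 \<le> sq_norm v"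
  by (simp add: sq_norm_def sum_nonneg)

lemma sq_norm_eq_0: "sq_norm v = 0 \<Longrightarrow> j \<in> {1..d} \<Longrightarrow> v j = 0"
  by (simp add: sq_norm_def sum_nonneg_eq_0_iff)

text \<open>\<open>t\<close> stands for the largest fourth power of the noise. The outer factor 2
  and the 8 come from squaring sums of two terms: once for the bias, twice for the fourth power of
  the bound on the observations.\<close>

definition bias_const :: "real \<Rightarrow> real" where
  "bias_const t = 2 * (b - a) * ((L * (b - a))\<^sup>2 + 8 * (2 * (L * (b - a) + 1) / g)\<^sup>2 * (y0 ^ 4 + t / \<epsilon> ^ 4))"

text \<open>The four quotients match the hypotheses on \<open>U\<close> and \<open>N\<close> in the
  oracle inequality, and the last summand bounds the bias. Summing over \<open>\<Lambda>\<close>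
  makes the bound valid at a data-dependent \<open>w\<close>, while \<open>w0\<close> is a fixed
  competitor. All denominators are deterministic.\<close>

definition remainder :: "(nat \<Rightarrow> real) \<Rightarrow> (nat \<Rightarrow> real) \<Rightarrow> real" where
  "remainder w0 x = (\<Sum>w\<in>\<Lambda>. (U w x)\<^sup>2 / (pen_const * sq_norm w) + (U (\<lambda>j. (w j)\<^sup>2) x)\<^sup>2 / (pen_const * sq_norm w)
      + (N (\<lambda>j. w j - w0 j) x)\<^sup>2 / sq_norm (\<lambda>j. (w j - w0 j) * \<theta> j)
      + (N (\<lambda>j. w j * (1 - w j)) x)\<^sup>2 / sq_norm (\<lambda>j. (1 - w j) * \<theta> j))
    + bias_const (Max ((\<lambda>k. x k ^ 4) ` {1..n})) / real n"

lemma Max_nonneg: "0 \<le> Max ((\<lambda>k. x k ^ 4) ` {1..n})" for x :: "nat \<Rightarrow> real"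
proof -
  have "x 1 ^ 4 \<le> Max ((\<lambda>k. x k ^ 4) ` {1..n})" using n_ge by (intro Max_ge) auto
  then show ?thesis by (rule order_trans[rotated]) simp
qed

lemma bias_const_nonneg: "0 \<le> t \<Longrightarrow> 0 \<le> bias_const t"
  using ab \<epsilon> by (simp add: bias_const_def)

lemma remainder_ge:
  shows "w \<in> \<Lambda> \<Longrightarrow> (U w x)\<^sup>2 / (pen_const * sq_norm w) \<le> remainder w0 x"
    and "w \<in> \<Lambda> \<Longrightarrow> (U (\<lambda>j. (w j)\<^sup>2) x)\<^sup>2 / (pen_const * sq_norm w) \<le> remainder w0 x"
    and "w \<in> \<Lambda> \<Longrightarrow> (N (\<lambda>j. w j - w0 j) x)\<^sup>2 / sq_norm (\<lambda>j. (w j - w0 j) * \<theta> j) \<le> remainder w0 x"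
    and "w \<in> \<Lambda> \<Longrightarrow> (N (\<lambda>j. w j * (1 - w j)) x)\<^sup>2 / sq_norm (\<lambda>j. (1 - w j) * \<theta> j) \<le> remainder w0 x"
    and "bias_const (Max ((\<lambda>k. x k ^ 4) ` {1..n})) / real n \<le> remainder w0 x"
    and "0 \<le> remainder w0 x"
proof -
  define f1 f2 f3 f4 where
    "f1 w = (U w x)\<^sup>2 / (pen_const * sq_norm w)"
    and "f2 w = (U (\<lambda>j. (w j)\<^sup>2) x)\<^sup>2 / (pen_const * sq_norm w)"
    and "f3 w = (N (\<lambda>j. w j - w0 j) x)\<^sup>2 / sq_norm (\<lambda>j. (w j - w0 j) * \<theta> j)"
    and "f4 w = (N (\<lambda>j. w j * (1 - w j)) x)\<^sup>2 / sq_norm (\<lambda>j. (1 - w j) * \<theta> j)" for w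
  define r where "r = bias_const (Max ((\<lambda>k. x k ^ 4) ` {1..n})) / real n"
  have f: "0 \<le> f1 w" "0 \<le> f2 w" "0 \<le> f3 w" "0 \<le> f4 w" for w
    using pen_const_pos sq_norm_nonneg by (auto simp: f1_def f2_def f3_def f4_def)
  have r: "0 \<le> r" using n_pos by (simp add: r_def bias_const_nonneg Max_nonneg)
  have X: "remainder w0 x = (\<Sum>w\<in>\<Lambda>. f1 w + f2 w + f3 w + f4 w) + r"
    by (simp only: remainder_def f1_def f2_def f3_def f4_def r_def)
  have s0: "0 \<le> (\<Sum>w\<in>\<Lambda>. f1 w + f2 w + f3 w + f4 w)" using f by (intro sum_nonneg add_nonneg_nonneg) auto
  have mem: "f1 w + f2 w + f3 w + f4 w \<le> (\<Sum>w\<in>\<Lambda>. f1 w + f2 w + f3 w + f4 w)" if "w \<in> \<Lambda>"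
    using f \<Lambda>(1) that by (intro member_le_sum[where f="\<lambda>w. f1 w + f2 w + f3 w + f4 w"]) auto
  show "w \<in> \<Lambda> \<Longrightarrow> (U w x)\<^sup>2 / (pen_const * sq_norm w) \<le> remainder w0 x"
    unfolding X f1_def[symmetric] using mem f[of w] r by linarith
  show "w \<in> \<Lambda> \<Longrightarrow> (U (\<lambda>j. (w j)\<^sup>2) x)\<^sup>2 / (pen_const * sq_norm w) \<le> remainder w0 x"
    unfolding X f2_def[symmetric] using mem f[of w] r by linarith
  show "w \<in> \<Lambda> \<Longrightarrow> (N (\<lambda>j. w j - w0 j) x)\<^sup>2 / sq_norm (\<lambda>j. (w j - w0 j) * \<theta> j) \<le> remainder w0 x"
    unfolding X f3_def[symmetric] using mem f[of w] r by linarith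
  show "w \<in> \<Lambda> \<Longrightarrow> (N (\<lambda>j. w j * (1 - w j)) x)\<^sup>2 / sq_norm (\<lambda>j. (1 - w j) * \<theta> j) \<le> remainder w0 x"
    unfolding X f4_def[symmetric] using mem f[of w] r by linarith
  show "bias_const (Max ((\<lambda>k. x k ^ 4) ` {1..n})) / real n \<le> remainder w0 x"
    unfolding X r_def[symmetric] using s0 by linarith
  show "0 \<le> remainder w0 x" unfolding X using s0 r by linarith
qed

lemma mesh_le: "mesh \<le> 2 * (b - a) / sqrt (real n)"
proof -
  have "mesh = 2 * (b - a) / (2 * real d)" using d_pos by (simp add: mesh_def field_simps)
  also have "\<dots> \<le> 2 * (b - a) / sqrt (real n)"
    using ab n_pos d_pos d_ge by (intro divide_left_mono mult_pos_pos) auto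
  finally show ?thesis .
qed

lemma mesh_square_le: "mesh\<^sup>2 \<le> 4 * (b - a)\<^sup>2 / real n"
proof -
  have "mesh\<^sup>2 \<le> (2 * (b - a) / sqrt (real n))\<^sup>2"
    using mesh_le mesh_pos by (intro power_mono) auto
  then show ?thesis
    using n_pos by (simp add: power_divide power_mult_distrib del: right_diff_distrib_numeral)
qed

text \<open>The rates: \<open>mesh^2 * V^2\<close> is of order n^(-2), and division by
  \<open>pen_const\<close> leaves (2 + ln n) / n for the quadratic terms; \<open>mesh * V\<close> is
  of order 1 / n for the linear ones.\<close>

definition remainder_const :: "real \<Rightarrow> real" where
  "remainder_const t = real (card \<Lambda>) * (32 * (b - a) * (8 + 2 * m4) / g\<^sup>2 * (2 + ln (real n)) + 8 * (b - a) / g)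
    + bias_const t"

lemma
  shows remainder_measurable: "remainder w0 \<in> borel_measurable noise"
    and nn_integral_remainder_le: "(\<integral>\<^sup>+x. ennreal (remainder w0 x) \<partial>noise) \<le> ennreal (remainder_const (max_moment n) / real n)"
proof -
  interpret PiM: prob_space noise by (intro prob_space_PiM) unfold_locales
  have [measurable]: "(\<lambda>x. Max ((\<lambda>k. x k ^ 4) ` {1..n})) \<in> borel_measurable noise" by (rule Max_measurable)
  have [measurable]: "(\<lambda>x. bias_const (Max ((\<lambda>k. x k ^ 4) ` {1..n})) / real n) \<in> borel_measurable noise"
    unfolding bias_const_def by measurable
  show "remainder w0 \<in> borel_measurable noise" unfolding remainder_def by measurable
  define cU where "cU = mesh\<^sup>2 * (8 + 2 * m4) * V\<^sup>2 / pen_const"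
  define cN where "cN = mesh * V"
  have cU0: "0 \<le> cU" and cN0: "0 \<le> cN"
    using m4_nonneg pen_const_pos mesh_pos V_nonneg by (auto simp: cU_def cN_def)
  \<comment> \<open>Only the norms are compared, so one bound serves both \<open>w\<close> and its
    entrywise square over the same denominator; the square has the smaller norm because the entries
    lie in [0, 1].\<close>
  have u1: "(\<integral>\<^sup>+x. ennreal ((U v x)\<^sup>2 / (pen_const * sq_norm w)) \<partial>noise) \<le> ennreal cU"
    if "sq_norm v \<le> sq_norm w" for v w
  proof (rule nn_integral_square_quotient_le)
    have "(\<integral>\<^sup>+x. ennreal ((U v x)\<^sup>2) \<partial>noise) \<le> ennreal (mesh\<^sup>2 * (8 + 2 * m4) * V\<^sup>2 * sq_norm v)"
      unfolding sq_norm_def by (rule nn_integral_U_le)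
    also have "\<dots> \<le> ennreal (mesh\<^sup>2 * (8 + 2 * m4) * V\<^sup>2 * sq_norm w)"
      using that m4_nonneg by (intro ennreal_leI mult_left_mono) auto
    also have "mesh\<^sup>2 * (8 + 2 * m4) * V\<^sup>2 * sq_norm w = cU * (pen_const * sq_norm w)"
      using pen_const_pos by (simp add: cU_def)
    finally show "(\<integral>\<^sup>+x. ennreal ((U v x)\<^sup>2) \<partial>noise) \<le> ennreal (cU * (pen_const * sq_norm w))" .
  qed (use pen_const_pos sq_norm_nonneg cU0 in auto)
  have n1: "(\<integral>\<^sup>+x. ennreal ((N v x)\<^sup>2 / B) \<partial>noise) \<le> ennreal cN"
    if "sq_norm (\<lambda>j. v j * \<theta> j) \<le> B" for v B
  proof (rule nn_integral_square_quotient_le)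
    have "(\<integral>\<^sup>+x. ennreal ((N v x)\<^sup>2) \<partial>noise) \<le> ennreal (cN * sq_norm (\<lambda>j. v j * \<theta> j))"
      unfolding sq_norm_def cN_def by (rule nn_integral_N_le)
    also have "\<dots> \<le> ennreal (cN * B)"
      using that cN0 by (intro ennreal_leI mult_left_mono) auto
    finally show "(\<integral>\<^sup>+x. ennreal ((N v x)\<^sup>2) \<partial>noise) \<le> ennreal (cN * B)" .
    show "0 \<le> B" using that sq_norm_nonneg order_trans by blast
  qed (use cN0 in auto)
  define f1 f2 f3 f4 where
    "f1 w x = (U w x)\<^sup>2 / (pen_const * sq_norm w)"
    and "f2 w x = (U (\<lambda>j. (w j)\<^sup>2) x)\<^sup>2 / (pen_const * sq_norm w)"
    and "f3 w x = (N (\<lambda>j. w j - w0 j) x)\<^sup>2 / sq_norm (\<lambda>j. (w j - w0 j) * \<theta> j)"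
    and "f4 w x = (N (\<lambda>j. w j * (1 - w j)) x)\<^sup>2 / sq_norm (\<lambda>j. (1 - w j) * \<theta> j)" for w x
  have f0: "0 \<le> f1 w x" "0 \<le> f2 w x" "0 \<le> f3 w x" "0 \<le> f4 w x" for w x
    using pen_const_pos sq_norm_nonneg by (auto simp: f1_def f2_def f3_def f4_def)
  have [measurable]: "f1 w \<in> borel_measurable noise" "f2 w \<in> borel_measurable noise"
    "f3 w \<in> borel_measurable noise" "f4 w \<in> borel_measurable noise" for w
    unfolding f1_def f2_def f3_def f4_def by measurable
  have "(\<integral>\<^sup>+x. ennreal (f1 w x + f2 w x + f3 w x + f4 w x) \<partial>noise) \<le> ennreal (2 * cU + 2 * cN)"
    if w: "w \<in> \<Lambda>" for w
  proof -
    have w01: "0 \<le> w j" "w j \<le> 1" if "j \<in> {1..d}" for j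
      using w \<Lambda>(2) that by (auto simp: weight_vectors_def PiE_iff)
    have "(\<integral>\<^sup>+x. ennreal (f1 w x) \<partial>noise) \<le> ennreal cU"
      unfolding f1_def by (rule u1) simp
    moreover have "(\<integral>\<^sup>+x. ennreal (f2 w x) \<partial>noise) \<le> ennreal cU"
      unfolding f2_def
    proof (rule u1)
      show "sq_norm (\<lambda>j. (w j)\<^sup>2) \<le> sq_norm w"
        unfolding sq_norm_def
      proof (rule sum_mono)
        fix j assume "j \<in> {1..d}"
        then have "(w j)\<^sup>2 \<le> 1" using w01[of j] by (simp add: power_le_one)
        then show "((w j)\<^sup>2)\<^sup>2 \<le> (w j)\<^sup>2" using mult_left_le[of "(w j)\<^sup>2" "(w j)\<^sup>2"] by (simp add: power2_eq_square)
      qed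
    qed
    moreover have "(\<integral>\<^sup>+x. ennreal (f3 w x) \<partial>noise) \<le> ennreal cN"
      unfolding f3_def by (rule n1) simp
    moreover have "(\<integral>\<^sup>+x. ennreal (f4 w x) \<partial>noise) \<le> ennreal cN"
      unfolding f4_def
    proof (rule n1)
      show "sq_norm (\<lambda>j. w j * (1 - w j) * \<theta> j) \<le> sq_norm (\<lambda>j. (1 - w j) * \<theta> j)"
        unfolding sq_norm_def
      proof (rule sum_mono)
        fix j assume "j \<in> {1..d}"
        then have "(w j)\<^sup>2 \<le> 1" using w01[of j] by (simp add: power_le_one)
        then show "(w j * (1 - w j) * \<theta> j)\<^sup>2 \<le> ((1 - w j) * \<theta> j)\<^sup>2"
          using mult_left_le_one_le[of "((1 - w j) * \<theta> j)\<^sup>2" "(w j)\<^sup>2"]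
          by (simp add: power_mult_distrib mult.assoc)
      qed
    qed
    moreover have "(\<integral>\<^sup>+x. ennreal (f1 w x + f2 w x + f3 w x + f4 w x) \<partial>noise)
        = (\<integral>\<^sup>+x. ennreal (f1 w x) \<partial>noise) + (\<integral>\<^sup>+x. ennreal (f2 w x) \<partial>noise)
        + (\<integral>\<^sup>+x. ennreal (f3 w x) \<partial>noise) + (\<integral>\<^sup>+x. ennreal (f4 w x) \<partial>noise)"
      using f0 by (simp add: nn_integral_add)
    ultimately have "(\<integral>\<^sup>+x. ennreal (f1 w x + f2 w x + f3 w x + f4 w x) \<partial>noise)
        \<le> ennreal cU + ennreal cU + ennreal cN + ennreal cN"
      by (simp only: add_mono)
    also have "\<dots> = ennreal (2 * cU + 2 * cN)" using cU0 cN0 by (simp flip: ennreal_plus)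
    finally show ?thesis .
  qed
  then have "(\<Sum>w\<in>\<Lambda>. \<integral>\<^sup>+x. ennreal (f1 w x + f2 w x + f3 w x + f4 w x) \<partial>noise)
      \<le> (\<Sum>w\<in>\<Lambda>. ennreal (2 * cU + 2 * cN))"
    by (rule sum_mono)
  also have "\<dots> = ennreal (real (card \<Lambda>) * (2 * cU + 2 * cN))"
    using cU0 cN0 by (simp add: ennreal_mult ennreal_of_nat_eq_real_of_nat)
  finally have S: "(\<Sum>w\<in>\<Lambda>. \<integral>\<^sup>+x. ennreal (f1 w x + f2 w x + f3 w x + f4 w x) \<partial>noise)
      \<le> ennreal (real (card \<Lambda>) * (2 * cU + 2 * cN))" .
  define K where "K = 2 * (b - a) * (8 * (2 * (L * (b - a) + 1) / g)\<^sup>2) / (\<epsilon> ^ 4 * real n)"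
  have K0: "0 \<le> K" using ab \<epsilon> n_pos by (simp add: K_def)
  define b0 where "b0 = bias_const 0 / real n"
  \<comment> \<open>\<open>bias_const\<close> is affine in \<open>t\<close>, so its expectation at
    the maximum is its value at \<open>max_moment n\<close>.\<close>
  have bias: "bias_const t / real n = b0 + K * t" for t
    unfolding b0_def bias_const_def K_def using \<epsilon> n_pos by (intro affine_quotient) auto
  have mm: "0 \<le> max_moment n" by (simp add: max_moment_def)
  have B: "(\<integral>\<^sup>+x. ennreal (bias_const (Max ((\<lambda>k. x k ^ 4) ` {1..n})) / real n) \<partial>noise)
      = ennreal (bias_const (max_moment n) / real n)"
  proof -
    have b0: "0 \<le> b0" unfolding b0_def using n_pos by (simp add: bias_const_nonneg)
    have "(\<integral>\<^sup>+x. ennreal (bias_const (Max ((\<lambda>k. x k ^ 4) ` {1..n})) / real n) \<partial>noise)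
      = (\<integral>\<^sup>+x. ennreal b0 + ennreal K * ennreal (Max ((\<lambda>k. x k ^ 4) ` {1..n})) \<partial>noise)"
      unfolding bias using K0 b0 by (intro nn_integral_cong) (simp add: ennreal_mult Max_nonneg)
    also have "\<dots> = ennreal b0 + ennreal K * ennreal (max_moment n)"
      using PiM.emeasure_space_1 nn_integral_Max_eq[OF moments, of n] n_ge
      by (subst nn_integral_add) (auto simp: nn_integral_cmult)
    also have "\<dots> = ennreal (bias_const (max_moment n) / real n)"
      unfolding bias[of "max_moment n"] using K0 b0 mm by (simp add: ennreal_mult)
    finally show ?thesis .
  qed
  have "(\<integral>\<^sup>+x. ennreal (remainder w0 x) \<partial>noise)
      = (\<integral>\<^sup>+x. (\<Sum>w\<in>\<Lambda>. ennreal (f1 w x + f2 w x + f3 w x + f4 w x))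
          + ennreal (bias_const (Max ((\<lambda>k. x k ^ 4) ` {1..n})) / real n) \<partial>noise)"
  proof (intro nn_integral_cong)
    fix x
    have "remainder w0 x = (\<Sum>w\<in>\<Lambda>. f1 w x + f2 w x + f3 w x + f4 w x)
        + bias_const (Max ((\<lambda>k. x k ^ 4) ` {1..n})) / real n"
      by (simp only: remainder_def f1_def f2_def f3_def f4_def)
    moreover have "0 \<le> bias_const (Max ((\<lambda>k. x k ^ 4) ` {1..n})) / real n"
      using n_pos by (simp add: bias_const_nonneg Max_nonneg)
    moreover have "0 \<le> (\<Sum>w\<in>\<Lambda>. f1 w x + f2 w x + f3 w x + f4 w x)"
      using f0 by (intro sum_nonneg add_nonneg_nonneg)
    moreover have "(\<Sum>w\<in>\<Lambda>. ennreal (f1 w x + f2 w x + f3 w x + f4 w x))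
        = ennreal (\<Sum>w\<in>\<Lambda>. f1 w x + f2 w x + f3 w x + f4 w x)"
      using f0 by (intro sum_ennreal add_nonneg_nonneg)
    ultimately show "ennreal (remainder w0 x) = (\<Sum>w\<in>\<Lambda>. ennreal (f1 w x + f2 w x + f3 w x + f4 w x))
          + ennreal (bias_const (Max ((\<lambda>k. x k ^ 4) ` {1..n})) / real n)"
      by (simp only: ennreal_plus)
  qed
  also have "\<dots> = (\<Sum>w\<in>\<Lambda>. \<integral>\<^sup>+x. ennreal (f1 w x + f2 w x + f3 w x + f4 w x) \<partial>noise)
      + ennreal (bias_const (max_moment n) / real n)"
    unfolding B[symmetric] by (subst nn_integral_add) (measurable, simp add: nn_integral_sum)
  also have "\<dots> \<le> ennreal (real (card \<Lambda>) * (2 * cU + 2 * cN)) + ennreal (bias_const (max_moment n) / real n)"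
    by (intro add_right_mono S)
  also have "\<dots> = ennreal (real (card \<Lambda>) * (2 * cU + 2 * cN) + bias_const (max_moment n) / real n)"
    using cU0 cN0 n_pos bias_const_nonneg[OF mm] by (intro ennreal_plus[symmetric]) auto
  also have "\<dots> \<le> ennreal (remainder_const (max_moment n) / real n)"
  proof (rule ennreal_leI)
    have r: "0 < sqrt (real n)" "sqrt (real n) * sqrt (real n) = real n" using n_pos by auto
    have "cU \<le> 4 * (b - a)\<^sup>2 / real n * (8 + 2 * m4) * V\<^sup>2 / pen_const"
      unfolding cU_def using mesh_square_le m4_nonneg pen_const_pos
      by (intro divide_right_mono mult_right_mono) auto
    also have "\<dots> = 16 * (b - a) * (8 + 2 * m4) / g\<^sup>2 * (2 + ln (real n)) / real n"
    proof -
      have "V\<^sup>2 = 4 / (g\<^sup>2 * real n)" by (simp add: V_def power_divide power_mult_distrib)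
      moreover have "4 * D\<^sup>2 / m * E * (4 / (g\<^sup>2 * m)) / (D / (m * l)) = 16 * D * E / g\<^sup>2 * l / m"
        if "0 < D" "0 < m" "0 < l" for D m l E :: real
        using that g by (simp add: power2_eq_square field_simps)
      ultimately show ?thesis
        unfolding pen_const_def using ab n_pos two_plus_ln_pos by (simp only: diff_gt_0_iff_gt)
    qed
    finally have "2 * cU \<le> 2 * (16 * (b - a) * (8 + 2 * m4) / g\<^sup>2 * (2 + ln (real n)) / real n)"
      by (rule mult_left_mono) simp
    also have "\<dots> = 32 * (b - a) * (8 + 2 * m4) / g\<^sup>2 * (2 + ln (real n)) / real n"
    proof -
      have "2 * (16 * D * E / G * l / m) = 32 * D * E / G * l / m" for D E G l m :: real by simp
      then show ?thesis .
    qed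
    finally have 1: "2 * cU \<le> 32 * (b - a) * (8 + 2 * m4) / g\<^sup>2 * (2 + ln (real n)) / real n" .
    have "cN \<le> 2 * (b - a) / sqrt (real n) * V"
      unfolding cN_def using mesh_le V_nonneg by (intro mult_right_mono) auto
    also have "\<dots> = 4 * (b - a) / g / real n"
      using g r by (simp add: V_def)
    finally have "2 * cN \<le> 2 * (4 * (b - a) / g / real n)" by (rule mult_left_mono) simp
    also have "\<dots> = 8 * (b - a) / g / real n"
    proof -
      have "2 * (4 * D / G / m) = 8 * D / G / m" for D G m :: real by simp
      then show ?thesis .
    qed
    finally have 2: "2 * cN \<le> 8 * (b - a) / g / real n" .
    have "real (card \<Lambda>) * (2 * cU + 2 * cN)
        \<le> real (card \<Lambda>) * (32 * (b - a) * (8 + 2 * m4) / g\<^sup>2 * (2 + ln (real n)) / real n + 8 * (b - a) / g / real n)"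
      using 1 2 by (intro mult_left_mono add_mono) auto
    then show "real (card \<Lambda>) * (2 * cU + 2 * cN) + bias_const (max_moment n) / real n
        \<le> remainder_const (max_moment n) / real n"
      by (simp add: remainder_const_def add_divide_distrib distrib_left)
  qed
  finally show "(\<integral>\<^sup>+x. ennreal (remainder w0 x) \<partial>noise) \<le> ennreal (remainder_const (max_moment n) / real n)" .
qed

lemma grid_in: "k \<in> {1..n} \<Longrightarrow> grid a b n k \<in> {a..b}"
proof -
  assume k: "k \<in> {1..n}"
  have "real k * (b - a) \<le> real n * (b - a)" using k ab by (intro mult_right_mono) auto
  then have "real k * (b - a) / real n \<le> b - a" using n_pos by (simp add: divide_le_eq mult.commute)
  moreover have "0 \<le> real k * (b - a) / real n" using ab by simp
  ultimately show ?thesis by (simp add: grid_def)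
qed

text \<open>\<open>S_seq_decomposition\<close> is applied with \<open>\<omega> = L * h\<close>. Both
  \<open>h\<close> and \<open>1 / H l\<close> are of order 1 / sqrt n, and
  \<open>ar_seq_bound\<close> controls the squared observations through the fourth root of the
  largest fourth power of the noise.\<close>

lemma bias_le:
  assumes G: "Gamma (obs x)"
  shows "mesh * (\<Sum>l=1..d. (S_seq l (obs x) - (S (z l) + noise_term x l))\<^sup>2)
    \<le> bias_const (Max ((\<lambda>k. x k ^ 4) ` {1..n})) / real n"
proof -
  define B4 where "B4 = Max ((\<lambda>k. x k ^ 4) ` {1..n})"
  define M1 where "M1 = sqrt (sqrt B4)"
  define m where "m = (\<bar>y0\<bar> + M1 / \<epsilon>)\<^sup>2"
  define r where "r = sqrt (real n)"
  have r: "1 \<le> r" "r\<^sup>2 = real n" using n_ge by (auto simp: r_def)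
  have B4: "0 \<le> B4" unfolding B4_def by (rule Max_nonneg)
  have M1: "0 \<le> M1" "M1 ^ 4 = B4"
  proof -
    have "M1 ^ 4 = (M1\<^sup>2)\<^sup>2" by (simp flip: power_mult)
    then show "0 \<le> M1" "M1 ^ 4 = B4" using B4 by (simp_all add: M1_def)
  qed
  have x_le: "\<bar>x k\<bar> \<le> M1" if "k \<in> {1..n}" for k
  proof -
    have "\<bar>x k\<bar> ^ 4 \<le> M1 ^ 4"
      unfolding M1(2) B4_def using that by (auto intro!: Max_ge)
    then show ?thesis using M1(1) by (rule power_le_imp_le_base[of _ 3, simplified]) 
  qed
  have y_le: "(obs x j)\<^sup>2 \<le> m" if "j \<le> n" for j
  proof -
    have "\<bar>obs x j\<bar> \<le> \<bar>y0\<bar> + M1 / \<epsilon>"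
      unfolding obs_eq[OF that] using S_le grid_in x_le M1 \<epsilon> that by (intro ar_seq_bound) auto
    then show ?thesis unfolding m_def by (metis abs_ge_zero power2_abs power_mono)
  qed
  have m0: "0 \<le> m" by (simp add: m_def)
  have h_le: "h \<le> (b - a) / r"
  proof -
    have "h = mesh / 2" by (simp add: h_def mesh_def)
    moreover have "2 * (b - a) / sqrt (real n) = 2 * ((b - a) / r)" unfolding r_def by (rule times_divide_eq_right[symmetric])
    ultimately show ?thesis using mesh_le by linarith
  qed
  define K1 where "K1 = L * (b - a)"
  define K2 where "K2 = 2 * (K1 + 1) / g"
  have K: "0 \<le> K1" "0 \<le> K2" using L ab g by (auto simp: K1_def K2_def)
  have each: "(S_seq l (obs x) - (S (z l) + noise_term x l))\<^sup>2 \<le> 2 * (K1\<^sup>2 + K2\<^sup>2 * m\<^sup>2) / real n"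
    if l: "l \<in> {1..d}" for l
  proof -
    have zl: "z l \<in> {a..b}" using l by (intro z_in) auto
    have "\<bar>S_seq l (obs x) - (S (z l) + (\<Sum>k=1..n. u l k (obs x) * x k))\<bar>
        \<le> (L * h) * (1 + m / H l (obs x)) + m / H l (obs x)"
    proof (rule S_seq_decomposition[where sx="\<lambda>j. S (grid a b n j)"])
      show "Gamma_at l (obs x)" using G l by (simp add: Gamma_def)
      show "obs x j = S (grid a b n j) * obs x (j - 1) + x j" if "j \<in> {1..n}" for j
        using that by (cases j) (auto simp: obs_eq)
      show "\<bar>S (grid a b n j) - S (z l)\<bar> \<le> L * h" if "j \<in> {1..n}" "\<bar>grid a b n j - z l\<bar> \<le> h" for j
        using lip[OF grid_in[OF that(1)] zl] mult_left_mono[OF that(2) L] by linarith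
      show "\<bar>S (z l)\<bar> \<le> 1" using S_le[OF zl] \<epsilon> by simp
      show "0 \<le> L * h" using L h_pos by simp
    qed (use l y_le in auto)
    also have "(\<Sum>k=1..n. u l k (obs x) * x k) = noise_term x l"
      by (simp add: noise_term_def weights.mart_def)
    also have "(L * h) * (1 + m / H l (obs x)) + m / H l (obs x) \<le> (K1 / r) * (1 + 2 * m / g) + 2 * m / g / r"
    proof -
      have "m / H l (obs x) \<le> m / (g * r / 2)"
        using H_ge_g[OF l, of "obs x"] g r m0
        by (intro divide_left_mono mult_pos_pos H_pos l) (auto simp: r_def)
      then have 1: "m / H l (obs x) \<le> 2 * m / g / r" by (simp add: field_simps)
      have "2 * m / g / r \<le> 2 * m / g / 1"
        using m0 g r by (intro divide_left_mono) auto
      with 1 have 2: "m / H l (obs x) \<le> 2 * m / g" by simp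
      have "L * h \<le> K1 / r" using mult_left_mono[OF h_le L] by (simp add: K1_def)
      then show ?thesis
        using 1 2 K r m0 H_pos[OF l, of "obs x"] by (intro add_mono mult_mono) auto
    qed
    also have "\<dots> = (K1 + K2 * m) / r"
      by (simp add: K2_def add_divide_distrib algebra_simps)
    finally have "\<bar>S_seq l (obs x) - (S (z l) + noise_term x l)\<bar> \<le> (K1 + K2 * m) / r" .
    then have "(S_seq l (obs x) - (S (z l) + noise_term x l))\<^sup>2 \<le> ((K1 + K2 * m) / r)\<^sup>2"
      by (metis abs_ge_zero power2_abs power_mono)
    also have "\<dots> = (K1 + K2 * m)\<^sup>2 / real n" using r by (simp add: power_divide)
    also have "\<dots> \<le> 2 * (K1\<^sup>2 + K2\<^sup>2 * m\<^sup>2) / real n"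
      using sum_squares_bound[of K1 "K2 * m"] n_pos
      by (intro divide_right_mono) (auto simp: power2_sum power_mult_distrib)
    finally show ?thesis .
  qed
  have m2: "m\<^sup>2 \<le> 8 * (y0 ^ 4 + B4 / \<epsilon> ^ 4)"
  proof -
    have sq: "(p + q)\<^sup>2 \<le> 2 * (p\<^sup>2 + q\<^sup>2)" for p q :: real
      using sum_squares_bound[of p q] by (simp add: power2_sum)
    have "m\<^sup>2 \<le> (2 * (\<bar>y0\<bar>\<^sup>2 + (M1 / \<epsilon>)\<^sup>2))\<^sup>2" unfolding m_def by (intro power_mono sq) auto
    also have "\<dots> = 4 * (\<bar>y0\<bar>\<^sup>2 + (M1 / \<epsilon>)\<^sup>2)\<^sup>2"
    proof -
      have "(2 * t)\<^sup>2 = 4 * t\<^sup>2" for t :: real by (simp add: power_mult_distrib)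
      then show ?thesis .
    qed
    also have "\<dots> \<le> 4 * (2 * ((\<bar>y0\<bar>\<^sup>2)\<^sup>2 + ((M1 / \<epsilon>)\<^sup>2)\<^sup>2))" by (intro mult_left_mono sq) auto
    also have "\<dots> = 8 * (y0 ^ 4 + M1 ^ 4 / \<epsilon> ^ 4)" by (simp add: power_divide flip: power_mult)
    finally show ?thesis by (simp add: M1)
  qed
  have "mesh * (\<Sum>l=1..d. (S_seq l (obs x) - (S (z l) + noise_term x l))\<^sup>2)
      \<le> mesh * (\<Sum>l=1..d. 2 * (K1\<^sup>2 + K2\<^sup>2 * m\<^sup>2) / real n)"
    using mesh_pos by (intro mult_left_mono sum_mono each) auto
  also have "\<dots> = (b - a) * (2 * (K1\<^sup>2 + K2\<^sup>2 * m\<^sup>2) / real n)"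
    using d_pos by (simp add: mesh_def)
  also have "\<dots> \<le> (b - a) * (2 * (K1\<^sup>2 + K2\<^sup>2 * (8 * (y0 ^ 4 + B4 / \<epsilon> ^ 4))) / real n)"
    using m2 ab by (intro mult_left_mono divide_right_mono add_left_mono) auto
  also have "\<dots> = bias_const B4 / real n"
  proof -
    have "D * (2 * (p + q * (8 * r)) / m) = 2 * D * (p + 8 * q * r) / m" for D p q r m :: real
      by (simp add: algebra_simps)
    then show ?thesis by (simp only: bias_const_def K1_def K2_def)
  qed
  finally show ?thesis unfolding B4_def .
qed

section \<open>From the pathwise loss to the risk\<close>

definition loss :: "(nat \<Rightarrow> real) \<Rightarrow> (nat \<Rightarrow> real) \<Rightarrow> ennreal" where
  "loss w x = (\<integral>\<^sup>+t\<in>{a..b}. ennreal ((S_weight w (obs x) t - S t)\<^sup>2) \<partial>lborel)"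

lemma knot_error_oracle:
  assumes w: "w \<in> \<Lambda>" "w0 \<in> \<Lambda>" and \<delta>: "0 < \<delta>" "\<delta> \<le> 1 / 12"
    and J: "J \<delta> (obs x) w \<le> J \<delta> (obs x) w0" and G: "Gamma (obs x)"
  shows "knot_error S (S_knot w (obs x))
    \<le> (1 + 4 * \<delta>) / (1 - 6 * \<delta>) * knot_error S (S_knot w0 (obs x)) + 300 * remainder w0 x / \<delta>"
proof (rule knot_error_oracle_on_Gamma[OF orth G _ _ _ _ \<delta>,
      of S "noise_term x" "\<lambda>l. S_seq l (obs x) - (S (z l) + noise_term x l)" w w0 "remainder w0 x",
      folded \<theta>_def, folded U_def N_def])
  show "w \<in> weight_vectors" "w0 \<in> weight_vectors" using w \<Lambda> by auto
  show "0 \<le> remainder w0 x" by (rule remainder_ge)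
  have pen: "pen_const * sq_norm v \<le> (\<Sum>j=1..d. (v j)\<^sup>2 * (mesh * s j (obs x)))" for v
    unfolding sq_norm_def sum_distrib_left
    by (subst mult.commute) (intro sum_mono mult_left_mono pen_const_le, auto)
  \<comment> \<open>A zero denominator makes the quotient in \<open>remainder\<close> uninformative,
    but then the weights vanish on \<open>{1..d}\<close> and the form itself is zero.\<close>
  have zero: "U f x = 0" if "pen_const * sq_norm v = 0" "\<And>j. v j = 0 \<Longrightarrow> f j = 0" for v f
    using that sq_norm_eq_0[of v] pen_const_pos by (auto simp: U_def intro!: sum.neutral)
  have U: "(U f x)\<^sup>2 \<le> remainder w0 x * (\<Sum>j=1..d. (v j)\<^sup>2 * (mesh * s j (obs x)))"
    if "(U f x)\<^sup>2 / (pen_const * sq_norm v) \<le> remainder w0 x" "\<And>j. v j = 0 \<Longrightarrow> f j = 0" for v f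
  proof -
    have "(U f x)\<^sup>2 \<le> remainder w0 x * (pen_const * sq_norm v)"
      using that(1) pen_const_pos sq_norm_nonneg zero[OF _ that(2)] by (intro square_le_of_quotient_le) auto
    also have "\<dots> \<le> remainder w0 x * (\<Sum>j=1..d. (v j)\<^sup>2 * (mesh * s j (obs x)))"
      by (intro mult_left_mono pen remainder_ge(6))
    finally show ?thesis .
  qed
  have N: "(N f x)\<^sup>2 \<le> remainder w0 x * sq_norm v"
    if "(N f x)\<^sup>2 / sq_norm v \<le> remainder w0 x" "\<And>j. v j = 0 \<Longrightarrow> f j * \<theta> j = 0" for v f
    using that(1) sq_norm_nonneg
  proof (rule square_le_of_quotient_le)
    assume "sq_norm v = 0"
    then show "N f x = 0" using that(2) sq_norm_eq_0[of v] by (auto simp: N_def intro!: sum.neutral)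
  qed
  show "(U v x)\<^sup>2 \<le> remainder w0 x * (\<Sum>j=1..d. (v j)\<^sup>2 * (mesh * s j (obs x)))" if "v \<in> {w, w0}" for v
    using that w by (intro U remainder_ge(1)) auto
  show "(U (\<lambda>j. (v j)\<^sup>2) x)\<^sup>2 \<le> remainder w0 x * (\<Sum>j=1..d. (v j)\<^sup>2 * (mesh * s j (obs x)))"
    if "v \<in> {w, w0}" for v
    using that w by (intro U remainder_ge(2)) auto
  show "(N (\<lambda>j. w j - w0 j) x)\<^sup>2 \<le> remainder w0 x * (\<Sum>j=1..d. ((w j - w0 j) * \<theta> j)\<^sup>2)"
    using N[OF remainder_ge(3)[OF w(1)]] by (simp add: sq_norm_def)
  show "(N (\<lambda>j. v j * (1 - v j)) x)\<^sup>2 \<le> remainder w0 x * (\<Sum>j=1..d. ((1 - v j) * \<theta> j)\<^sup>2)"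
    if "v \<in> {w, w0}" for v
  proof -
    have v: "v \<in> \<Lambda>" using that w by auto
    show ?thesis using N[OF remainder_ge(4)[OF v]] by (auto simp: sq_norm_def)
  qed
  show "mesh * (\<Sum>l=1..d. (S_seq l (obs x) - (S (z l) + noise_term x l))\<^sup>2) \<le> remainder w0 x"
    using bias_le[OF G] remainder_ge(5) by (rule order_trans)
  show "J \<delta> (obs x) w \<le> J \<delta> (obs x) w0" by (rule J)
qed auto

lemma loss_oracle:
  assumes w: "w \<in> \<Lambda>" "w0 \<in> \<Lambda>" and \<delta>: "0 < \<delta>" "\<delta> \<le> 1 / 12"
    and J: "J \<delta> (obs x) w \<le> J \<delta> (obs x) w0"
  shows "loss w x \<le> ennreal ((1 + 4 * \<delta>) * (1 + \<delta>)\<^sup>2 / (1 - 6 * \<delta>)) * loss w0 x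
    + ennreal ((14 * ((b - a) * (L * mesh)\<^sup>2) + 600 * remainder w0 x) / \<delta>)"
proof (cases "Gamma (obs x)")
  case False
  have "S_knot v (obs x) = (\<lambda>_. 0)" for v using False by (auto simp: S_knot_def)
  then have "loss w x = loss w0 x"
    by (simp add: loss_def S_weight_eq_step)
  also have "\<dots> = ennreal 1 * loss w0 x" by simp
  also have "\<dots> \<le> ennreal ((1 + 4 * \<delta>) * (1 + \<delta>)\<^sup>2 / (1 - 6 * \<delta>)) * loss w0 x"
  proof (intro mult_right_mono ennreal_leI)
    have "1 * 1 \<le> (1 + 4 * \<delta>) * (1 + \<delta>)\<^sup>2" using \<delta> by (intro mult_mono one_le_power) auto
    then show "1 \<le> (1 + 4 * \<delta>) * (1 + \<delta>)\<^sup>2 / (1 - 6 * \<delta>)" using \<delta> by (simp add: le_divide_eq)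
  qed simp
  finally show ?thesis by (rule order_trans) simp
next
  case True
  define C where "C = (1 + 4 * \<delta>) / (1 - 6 * \<delta>)"
  define c where "c = (b - a) * (L * mesh)\<^sup>2"
  define X where "X = remainder w0 x"
  define E0 where "E0 = knot_error S (S_knot w0 (obs x))"
  have c: "0 \<le> c" using ab by (simp add: c_def)
  have X: "0 \<le> X" unfolding X_def by (rule remainder_ge)
  have C: "0 \<le> C" "(1 + \<delta>) * C \<le> 3"
  proof -
    show "0 \<le> C" using \<delta> by (simp add: C_def)
    have "C \<le> (4/3) / (1/2)" unfolding C_def using \<delta> by (intro frac_le) auto
    then have "(1 + \<delta>) * C \<le> (13/12) * ((4/3) / (1/2))" using \<delta> \<open>0 \<le> C\<close> by (intro mult_mono) auto
    then show "(1 + \<delta>) * C \<le> 3" by simp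
  qed
  have E0: "0 \<le> E0" using mesh_pos by (simp add: E0_def knot_error_def sum_nonneg)
  have "loss w x \<le> ennreal ((1 + \<delta>) * knot_error S (S_knot w (obs x)) + (1 + 1 / \<delta>) * c)"
    unfolding loss_def S_weight_eq_step c_def
    by (rule integrated_error_le_knot_error[OF lip L \<delta>(1)])
  also have "\<dots> \<le> ennreal ((1 + \<delta>) * (C * E0 + 300 * X / \<delta>) + (1 + 1 / \<delta>) * c)"
    using knot_error_oracle[OF w \<delta> J True] \<delta>
    by (intro ennreal_leI add_right_mono mult_left_mono) (auto simp: C_def E0_def X_def)
  also have "\<dots> = ennreal ((1 + \<delta>) * C) * ennreal E0 + ennreal ((1 + \<delta>) * (300 * X / \<delta>) + (1 + 1 / \<delta>) * c)"
    using \<delta> C E0 X c by (simp add: algebra_simps flip: ennreal_mult ennreal_plus)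
  also have "\<dots> \<le> ennreal ((1 + \<delta>) * C) * (ennreal (1 + \<delta>) * loss w0 x + ennreal ((1 + 1 / \<delta>) * c))
      + ennreal ((1 + \<delta>) * (300 * X / \<delta>) + (1 + 1 / \<delta>) * c)"
    unfolding loss_def S_weight_eq_step c_def E0_def
    by (intro add_right_mono mult_left_mono knot_error_le_integrated_error[OF lip L \<delta>(1)]) auto
  also have "\<dots> = ennreal ((1 + \<delta>) * C * (1 + \<delta>)) * loss w0 x
      + ennreal ((1 + \<delta>) * C * ((1 + 1 / \<delta>) * c) + ((1 + \<delta>) * (300 * X / \<delta>) + (1 + 1 / \<delta>) * c))"
  proof -
    define k where "k = (1 + 1 / \<delta>) * c"
    define m where "m = (1 + \<delta>) * (300 * X / \<delta>) + k"
    have km: "0 \<le> k" "0 \<le> m" "0 \<le> (1 + \<delta>) * C" using \<delta> C X c by (auto simp: k_def m_def)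
    have 1: "ennreal ((1 + \<delta>) * C * (1 + \<delta>)) = ennreal ((1 + \<delta>) * C) * ennreal (1 + \<delta>)"
      using \<delta> km by (intro ennreal_mult) auto
    have 2: "ennreal ((1 + \<delta>) * C * k + m) = ennreal ((1 + \<delta>) * C) * ennreal k + ennreal m"
      using km by (simp only: ennreal_plus ennreal_mult mult_nonneg_nonneg)
    show ?thesis
      unfolding k_def[symmetric] m_def[symmetric] 1 2 by (simp only: distrib_left mult.assoc add.assoc)
  qed
  also have "\<dots> \<le> ennreal ((1 + \<delta>) * C * (1 + \<delta>)) * loss w0 x + ennreal ((14 * c + 600 * X) / \<delta>)"
  \<comment> \<open>\<open>(1 + \<delta>) * C \<le> 3\<close> and
    \<open>1 + 1 / \<delta> \<le> 2 / \<delta>\<close> give 3 * 2 + 2 = 8 multiples of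
    \<open>c / \<delta>\<close>, which 14 covers; 600 comes from
    \<open>1 + \<delta> \<le> 2\<close>.\<close>
  proof (intro add_left_mono ennreal_leI)
    have k: "(1 + 1 / \<delta>) * c \<le> 2 / \<delta> * c"
      using \<delta> c by (intro mult_right_mono) (auto simp: field_simps)
    have k0: "0 \<le> (1 + 1 / \<delta>) * c" using \<delta> c by simp
    have "(1 + \<delta>) * C * ((1 + 1 / \<delta>) * c) \<le> 3 * (2 / \<delta> * c)"
      by (rule mult_mono[OF C(2) k _ k0]) simp
    moreover have "(1 + \<delta>) * (300 * X / \<delta>) \<le> 2 * (300 * X / \<delta>)"
      using \<delta> X by (intro mult_right_mono) auto
    moreover have "(14 * c + 600 * X) / \<delta> = 14 * (c / \<delta>) + 600 * (X / \<delta>)" by (simp add: add_divide_distrib)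
    moreover have "0 \<le> c / \<delta>" using c \<delta> by simp
    ultimately show "(1 + \<delta>) * C * ((1 + 1 / \<delta>) * c) + ((1 + \<delta>) * (300 * X / \<delta>) + (1 + 1 / \<delta>) * c)
        \<le> (14 * c + 600 * X) / \<delta>" using k by simp
  qed
  also have "(1 + \<delta>) * C * (1 + \<delta>) = (1 + 4 * \<delta>) * (1 + \<delta>)\<^sup>2 / (1 - 6 * \<delta>)"
    by (simp add: C_def power2_eq_square mult_ac)
  finally show ?thesis unfolding c_def X_def .
qed

definition risk_const :: "real \<Rightarrow> real" where
  "risk_const t = 56 * L\<^sup>2 * (b - a) ^ 3 + 600 * remainder_const t"

text \<open>The pathwise inequality is used at the selected vector and then integrated.
  \<open>remainder\<close> involves neither \<open>\<delta>\<close> nor the selector, so its mean is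
  bounded uniformly in both and \<open>\<delta>\<close> enters the error term only as a
  divisor.\<close>

lemma risk_oracle:
  assumes \<delta>: "0 < \<delta>" "\<delta> \<le> 1 / 12" and sel: "is_selector \<delta> \<Lambda> w_hat" and w0: "w0 \<in> \<Lambda>"
  shows "(\<integral>\<^sup>+x. loss (w_hat (obs x)) x \<partial>noise)
    \<le> ennreal ((1 + 4 * \<delta>) * (1 + \<delta>)\<^sup>2 / (1 - 6 * \<delta>)) * (\<integral>\<^sup>+x. loss w0 x \<partial>noise)
      + ennreal (risk_const (max_moment n) / (\<delta> * real n))"
proof -
  interpret PiM: prob_space noise by (intro prob_space_PiM) unfold_locales
  define C where "C = (1 + 4 * \<delta>) * (1 + \<delta>)\<^sup>2 / (1 - 6 * \<delta>)"
  define c where "c = 14 * ((b - a) * (L * mesh)\<^sup>2)"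
  have C: "0 < C" using \<delta> by (simp add: C_def)
  have c: "0 \<le> c" using ab by (simp add: c_def)
  note [measurable] = remainder_measurable
  have obs_space: "obs x \<in> space (observation_space n)" for x
    by (simp add: observation_space_def space_PiM obs_def observation_def)
  have "loss (w_hat (obs x)) x \<le> ennreal C * loss w0 x + ennreal ((c + 600 * remainder w0 x) / \<delta>)" for x
    unfolding C_def c_def
  proof (rule loss_oracle[OF _ w0 \<delta>])
    have "is_arg_min (J \<delta> (obs x)) (\<lambda>w. w \<in> \<Lambda>) (w_hat (obs x))"
      using sel obs_space unfolding is_selector_def by blast
    then show "w_hat (obs x) \<in> \<Lambda>" "J \<delta> (obs x) (w_hat (obs x)) \<le> J \<delta> (obs x) w0"
      using w0 by (auto simp: is_arg_min_def not_less)
  qed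
  then have "(\<integral>\<^sup>+x. loss (w_hat (obs x)) x \<partial>noise)
      \<le> (\<integral>\<^sup>+x. ennreal C * loss w0 x + ennreal ((c + 600 * remainder w0 x) / \<delta>) \<partial>noise)"
    by (rule nn_integral_mono)
  also have "\<dots> \<le> ennreal C * (\<integral>\<^sup>+x. loss w0 x \<partial>noise) + (\<integral>\<^sup>+x. ennreal ((c + 600 * remainder w0 x) / \<delta>) \<partial>noise)"
    by (rule nn_integral_affine_le[OF _ C]) measurable
  also have "(\<integral>\<^sup>+x. ennreal ((c + 600 * remainder w0 x) / \<delta>) \<partial>noise) \<le> ennreal (risk_const (max_moment n) / (\<delta> * real n))"
  proof -
    have rc: "0 \<le> remainder_const (max_moment n) / real n"
      using n_pos ab g m4_nonneg ln_n_nonneg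
      by (auto simp: remainder_const_def max_moment_def intro!: divide_nonneg_nonneg add_nonneg_nonneg mult_nonneg_nonneg bias_const_nonneg)
    have "(\<integral>\<^sup>+x. ennreal ((c + 600 * remainder w0 x) / \<delta>) \<partial>noise)
        = (\<integral>\<^sup>+x. ennreal (c / \<delta>) + ennreal (600 / \<delta>) * ennreal (remainder w0 x) \<partial>noise)"
      using c \<delta> remainder_ge(6)
      by (intro nn_integral_cong) (simp add: add_divide_distrib flip: ennreal_mult ennreal_plus)
    also have "\<dots> = ennreal (c / \<delta>) + ennreal (600 / \<delta>) * (\<integral>\<^sup>+x. ennreal (remainder w0 x) \<partial>noise)"
      using PiM.emeasure_space_1 by (subst nn_integral_add) (auto simp: nn_integral_cmult)
    also have "\<dots> \<le> ennreal (c / \<delta>) + ennreal (600 / \<delta>) * ennreal (remainder_const (max_moment n) / real n)"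
      by (intro add_left_mono mult_left_mono nn_integral_remainder_le) auto
    also have "\<dots> = ennreal (c / \<delta> + 600 / \<delta> * (remainder_const (max_moment n) / real n))"
    proof -
      have "ennreal (600 / \<delta>) * ennreal (remainder_const (max_moment n) / real n)
          = ennreal (600 / \<delta> * (remainder_const (max_moment n) / real n))"
        using \<delta> rc by (intro ennreal_mult[symmetric]) auto
      moreover have "0 \<le> 600 / \<delta> * (remainder_const (max_moment n) / real n)"
        using \<delta> rc by (intro mult_nonneg_nonneg) auto
      ultimately show ?thesis using c \<delta> by (simp only: ennreal_plus divide_nonneg_pos)
    qed
    also have "\<dots> \<le> ennreal (risk_const (max_moment n) / (\<delta> * real n))"
    proof (rule ennreal_leI)
      have "c = 14 * (b - a) * L\<^sup>2 * mesh\<^sup>2" by (simp add: c_def power_mult_distrib)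
      also have "\<dots> \<le> 14 * (b - a) * L\<^sup>2 * (4 * (b - a)\<^sup>2 / real n)"
        using ab by (intro mult_left_mono mesh_square_le) auto
      also have "\<dots> = 56 * L\<^sup>2 * (b - a) ^ 3 / real n"
      proof -
        have "14 * D * E * (4 * D\<^sup>2 / m) = 56 * E * D ^ 3 / m" for D E m :: real
          by (simp add: power2_eq_square power3_eq_cube)
        then show ?thesis .
      qed
      finally have "c / \<delta> \<le> 56 * L\<^sup>2 * (b - a) ^ 3 / real n / \<delta>" using \<delta> by (intro divide_right_mono) auto
      then show "c / \<delta> + 600 / \<delta> * (remainder_const (max_moment n) / real n) \<le> risk_const (max_moment n) / (\<delta> * real n)"
        by (simp add: risk_const_def add_divide_distrib mult.commute)
    qed
    finally show ?thesis .
  qed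
  finally show ?thesis unfolding C_def by (simp add: add_left_mono)
qed

end

section \<open>Uniform constants and conclusion\<close>

lemma smooth_class_lipschitz:
  assumes S: "S \<in> smooth_class a b \<epsilon> L" and x: "x \<in> {a..b}" "x' \<in> {a..b}"
  shows "\<bar>S x - S x'\<bar> \<le> L * \<bar>x - x'\<bar>"
proof -
  obtain S' where S': "\<And>x. x \<in> {a..b} \<Longrightarrow> (S has_real_derivative S' x) (at x within {a..b})"
    "\<And>x. x \<in> {a..b} \<Longrightarrow> \<bar>S' x\<bar> \<le> L"
    using S unfolding smooth_class_def by blast
  have "norm (S x - S x') \<le> L * norm (x - x')"
    by (rule field_differentiable_bound[of "{a..b}" S S']) (use S' x in auto)
  then show ?thesis by simp
qed

theorem theorem5p3:
  fixes a b \<epsilon> L y0 \<mu>0 :: real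
    and vs :: "nat \<Rightarrow> real"
    and \<phi> :: "nat \<Rightarrow> nat \<Rightarrow> real \<Rightarrow> real"
    and \<Lambda> :: "nat \<Rightarrow> (nat \<Rightarrow> real) set"
  assumes "a < b" and "0 < \<epsilon>" and "\<epsilon> < 1" and "0 < L" and "0 < \<mu>0" and "\<mu>0 < 1"
    and "\<And>n. 3 \<le> n \<Longrightarrow> 1 \<le> vs n"
    and "\<And>n. 3 \<le> n \<Longrightarrow> ar_procedure.orthonormal_system a b n (\<phi> n)"
    and "\<And>n. 3 \<le> n \<Longrightarrow>
           \<Lambda> n \<subseteq> ar_procedure.weight_vectors n \<and> finite (\<Lambda> n) \<and> \<Lambda> n \<noteq> {}"
    and "subpolynomial vs"
    and "subpolynomial (\<lambda>n. real (card (\<Lambda> n)))"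
  shows "\<forall>p. (\<forall>n\<ge>3. p \<in> noise_densities (vs n)) \<longrightarrow>
    (\<exists>B :: nat \<Rightarrow> real. subpolynomial B \<and>
      (\<forall>S\<in>smooth_class a b \<epsilon> L. \<forall>n\<ge>3. \<forall>\<delta>. \<forall>w_hat.
         ar_procedure.thresholds_positive a b \<mu>0 n \<longrightarrow>
         0 < \<delta> \<and> \<delta> \<le> 1 / 12 \<longrightarrow>
         ar_procedure.is_selector a b \<mu>0 n (\<phi> n) \<delta> (\<Lambda> n) w_hat \<longrightarrow>
         risk a b y0 n p (ar_procedure.S_star a b \<mu>0 n (\<phi> n) w_hat) S
           \<le> ennreal ((1 + 4 * \<delta>) * (1 + \<delta>)\<^sup>2 / (1 - 6 * \<delta>))
               * Min ((\<lambda>w. risk a b y0 n p (ar_procedure.S_weight a b \<mu>0 n (\<phi> n) w) S) ` \<Lambda> n)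
             + ennreal (B n / (\<delta> * real n))))"
proof (intro allI impI)
  fix p assume "\<forall>n\<ge>3. p \<in> noise_densities (vs n)"
  \<comment> \<open>The density does not vary with n, so its moments are fixed numbers, which can be
    read off at a single n.\<close>
  then have p: "p \<in> noise_densities (vs 3)" by simp
  have vs3: "1 \<le> vs 3" by (rule assms(7)) simp
  define M where "M = density lborel (\<lambda>x. ennreal (p x))"
  obtain m4 where noise: "standardized_noise M m4"
    using standardized_noise_of_density(1)[OF p vs3] unfolding M_def by blast
  note moments = standardized_noise_of_density(2)[OF p vs3, folded M_def]
  obtain g where g: "0 < g" and gap: "\<And>a b n l. admissible_ar_procedure a b \<mu>0 n \<Longrightarrow>
      l \<in> {1..ar_procedure.d n} \<Longrightarrow> g * sqrt (real n) \<le> admissible_ar_procedure.gap a b \<mu>0 n l"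
    using exists_gap_bound[OF assms(6)] by blast
  interpret standardized_noise M m4 by (fact noise)
  define c1 c2 c3 c4 c5 where "c1 = 56 * L\<^sup>2 * (b - a) ^ 3" and "c2 = 32 * (b - a) * (8 + 2 * m4) / g\<^sup>2"
    and "c3 = 8 * (b - a) / g" and "c4 = 2 * (b - a)"
    and "c5 = 8 * (2 * (L * (b - a) + 1) / g)\<^sup>2"
  \<comment> \<open>This is \<open>risk_const (max_moment n)\<close>, written out because it has to
    be fixed before \<open>S\<close>, \<open>\<delta>\<close> and the selector. Sums and products of
    constants, cardinalities, logarithms and moments are what the closure lemmas handle.\<close>
  define B where "B n = c1 + 600 * (real (card (\<Lambda> n)) * (c2 * (2 + ln (real n)) + c3)
      + c4 * ((L * (b - a))\<^sup>2 + c5 * (y0 ^ 4 + max_moment n * (1 / \<epsilon> ^ 4))))" for n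
  have "subpolynomial B"
    unfolding B_def
    by (intro subpolynomial_add subpolynomial_mult subpolynomial_const subpolynomial_ln assms(11)
        subpolynomial_max_moment moments)
  moreover have "risk a b y0 n p (ar_procedure.S_star a b \<mu>0 n (\<phi> n) w_hat) S
           \<le> ennreal ((1 + 4 * \<delta>) * (1 + \<delta>)\<^sup>2 / (1 - 6 * \<delta>))
               * Min ((\<lambda>w. risk a b y0 n p (ar_procedure.S_weight a b \<mu>0 n (\<phi> n) w) S) ` \<Lambda> n)
             + ennreal (B n / (\<delta> * real n))"
    if S: "S \<in> smooth_class a b \<epsilon> L" and n: "3 \<le> n"
      and pos: "ar_procedure.thresholds_positive a b \<mu>0 n"
      and \<delta>: "0 < \<delta>" "\<delta> \<le> 1 / 12"
      and sel: "ar_procedure.is_selector a b \<mu>0 n (\<phi> n) \<delta> (\<Lambda> n) w_hat"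
    for S n \<delta> w_hat
  proof -
    have adm: "admissible_ar_procedure a b \<mu>0 n"
      using assms(1) n pos by (simp add: admissible_ar_procedure_def)
    have Lam: "finite (\<Lambda> n)" "\<Lambda> n \<subseteq> ar_procedure.weight_vectors n" "\<Lambda> n \<noteq> {}"
      using assms(9)[OF n] by auto
    interpret ar_experiment a b \<mu>0 n "\<phi> n" M m4 S \<epsilon> L y0 g "\<Lambda> n"
    proof (intro ar_experiment.intro adm noise ar_experiment_axioms.intro)
      show "ar_procedure.orthonormal_system a b n (\<phi> n)" by (rule assms(8)[OF n])
      show "\<bar>S x\<bar> \<le> 1 - \<epsilon>" if "x \<in> {a..b}" for x
        using S that by (auto simp: smooth_class_def)
      show "\<bar>S x - S x'\<bar> \<le> L * \<bar>x - x'\<bar>" if "x \<in> {a..b}" "x' \<in> {a..b}" for x x'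
        by (rule smooth_class_lipschitz[OF S that])
      show "g * sqrt (real n) \<le> admissible_ar_procedure.gap a b \<mu>0 n l" if "l \<in> {1..ar_procedure.d n}" for l
        by (rule gap[OF adm that])
    qed (use assms(2-4) g Lam moments in auto)
    have B: "B n = risk_const (max_moment n)"
      by (simp add: B_def risk_const_def remainder_const_def bias_const_def c1_def c2_def c3_def c4_def c5_def)
    have risk: "risk a b y0 n p (\<lambda>y. S_weight (w y) y) S = (\<integral>\<^sup>+x. loss (w (obs x)) x \<partial>noise)" for w
      by (simp add: risk_def loss_def obs_def noise_law_def M_def)
    have "Min ((\<lambda>w. risk a b y0 n p (S_weight w) S) ` \<Lambda> n) \<in> (\<lambda>w. risk a b y0 n p (S_weight w) S) ` \<Lambda> n"
      using Lam by (intro Min_in) auto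
    then obtain w0 where w0: "w0 \<in> \<Lambda> n"
      "Min ((\<lambda>w. risk a b y0 n p (S_weight w) S) ` \<Lambda> n) = risk a b y0 n p (S_weight w0) S" by auto
    have "risk a b y0 n p (S_star w_hat) S = (\<integral>\<^sup>+x. loss (w_hat (obs x)) x \<partial>noise)"
      using risk[of w_hat] by (simp add: S_star_def[abs_def])
    also have "\<dots> \<le> ennreal ((1 + 4 * \<delta>) * (1 + \<delta>)\<^sup>2 / (1 - 6 * \<delta>)) * (\<integral>\<^sup>+x. loss w0 x \<partial>noise)
      + ennreal (risk_const (max_moment n) / (\<delta> * real n))"
      by (rule risk_oracle[OF \<delta> sel w0(1)])
    also have "(\<integral>\<^sup>+x. loss w0 x \<partial>noise) = Min ((\<lambda>w. risk a b y0 n p (S_weight w) S) ` \<Lambda> n)"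
      using risk[of "\<lambda>_. w0"] w0(2) by simp
    finally show ?thesis unfolding B .
  qed
  ultimately show "\<exists>B :: nat \<Rightarrow> real. subpolynomial B \<and>
      (\<forall>S\<in>smooth_class a b \<epsilon> L. \<forall>n\<ge>3. \<forall>\<delta>. \<forall>w_hat.
         ar_procedure.thresholds_positive a b \<mu>0 n \<longrightarrow>
         0 < \<delta> \<and> \<delta> \<le> 1 / 12 \<longrightarrow>
         ar_procedure.is_selector a b \<mu>0 n (\<phi> n) \<delta> (\<Lambda> n) w_hat \<longrightarrow>
         risk a b y0 n p (ar_procedure.S_star a b \<mu>0 n (\<phi> n) w_hat) S
           \<le> ennreal ((1 + 4 * \<delta>) * (1 + \<delta>)\<^sup>2 / (1 - 6 * \<delta>))
               * Min ((\<lambda>w. risk a b y0 n p (ar_procedure.S_weight a b \<mu>0 n (\<phi> n) w) S) ` \<Lambda> n)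
             + ennreal (B n / (\<delta> * real n)))"
    by blast
qed

end
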